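(* Let $n\in\{2,3\}$, let $\Omega\subset\mathbb{R}^n$ and $\Gamma=\partial\Omega$ be as in the context, and let $\mathcal{T}_h$ be a quasi uniform, shape regular mesh on $\Gamma$ of mesh size $h$, with set of nodes $\mathcal{N}$ and node patches $\tau_{\mathbf{y}}$, $\mathbf{y}\in\mathcal{N}$. Let $\Phi=\{\varphi_{\mathbf{y}} : \mathbf{y}\in\mathcal{N}\}\subset H^{1/2}(\Gamma)$ be a set of functions such that, for all $\mathbf{y}\in\mathcal{N}$, $\varphi_{\mathbf{y}}\in W^{1,\infty}_0(\tau_{\mathbf{y}})$ with $$\|\varphi_{\mathbf{y}}\|_{L^\infty(\tau_{\mathbf{y}})}\le C_0,\qquad |\varphi_{\mathbf{y}}|_{W^{1,\infty}(\tau_{\mathbf{y}})}\le C_0\,h^{-1},$$ with $C_0>0$ independent of $\mathbf{y}$ and $h$, and such that $\sum_{\mathbf{y}\in\mathcal{N}}\varphi_{\mathbf{y}}=1$ on $\Gamma$. Then there exist positive constants $c,C$, independent of $h$ (depending only on $\Gamma$, on the shape regularity and quasi uniformity constants of the mesh, and on $C_0$), such that every $\zeta\in H^{-1/2}(\Gamma)$ satisfying $$\langle\zeta,\varphi_{\mathbf{y}}\rangle_\Gamma=0\quad\text{for all }\mathbf{y}\in\mathcal{N}$$ satisfies $$c\sum_{\mathbf{y}\in\mathcal{N}}\|\zeta\|^2_{\widetilde H^{-1/2}(\tau_{\mathbf{y}})}\le\|\zeta\|^2_{-1/2,\Gamma}\le C\sum_{\mathbf{y}\in\mathcal{N}}\|\zeta\|^2_{\widetilde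 H^{-1/2}(\tau_{\mathbf{y}})}.$$
   Context: Domain. $\Omega\subset\mathbb{R}^n$ ($n=2,3$) is a bounded, simply connected, possibly curvilinear polygon ($n=2$) or polyhedron ($n=3$) with Lipschitz boundary $\Gamma=\partial\Omega$, such that the geodesic distance on $\Gamma$ is bounded from above by a constant times the Euclidean distance in $\mathbb{R}^n$. Mesh. $\mathcal{T}_h$ is a decomposition, in the usual finite element sense, of $\Gamma$ into (possibly curvilinear) segments ($n=2$) or triangles ($n=3$), of mesh size $h$. It is quasi uniform (the diameters of all elements are comparable to $h$) and shape regular (the ratio of the diameter of an element to that of its largest inscribed ball is bounded), with constants fixed independently of $h$. $\mathcal{N}$ is the set of nodes (vertices) of $\mathcal{T}_h$, and for $\mathbf{y}\in\mathcal{N}$ the patch of elements sharing $\mathbf{y}$ as a vertex is $\tau_{\mathbf{y}}=\bigcup_{T\in\mathcal{T}_h:\ \mathbf{y}\in\partial T}T$. Norms. For $\tau\subseteq\Gamma$, $\|\cdot\|_{0,\tau}$ is the $L^2(\tau)$ norm (with respect to the surface/arclength measure on $\Gamma$), and $$|v|^2_{1/2,\tau}=\int_\tau dt\int_\tau ds\,\frac{|v(t)-v(s)|^2}{|t-s|^n},\qquad \|v\|^2_{1/2,\tau}=\|v\|^2_{0,\tau}+|v|^2_{1/2,\tau}.$$ $H^{1/2}(\tau)$ is the space of $v\in L^2(\tau)$ with $\|v\|_{1/2,\tau}<\infty$. $H^{1/2}_{00}(\tau)$ is the subspace of those $v\in H^{1/2}(\tau)$ whose extension by zero $\mathscr{E}(v)$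 to $\Gamma$ belongs to $H^{1/2}(\Gamma)$, with norm $\|v\|_{H^{1/2}_{00}(\tau)}=|\mathscr{E}(v)|_{1/2,\Gamma}$; $v$ and $\mathscr{E}(v)$ are identified. Dual norms. $H^{-1/2}(\Gamma)=(H^{1/2}(\Gamma))'$ and $\widetilde H^{-1/2}(\tau)=(H^{1/2}_{00}(\tau))'$, with duality pairings denoted $\langle\cdot,\cdot\rangle_\Gamma$, $\langle\cdot,\cdot\rangle_\tau$ (extending the $L^2$ scalar product) and norms $$\|\zeta\|_{-1/2,\Gamma}=\sup_{0\ne v\in H^{1/2}(\Gamma)}\frac{\langle\zeta,v\rangle_\Gamma}{\|v\|_{1/2,\Gamma}},\qquad \|\zeta\|_{\widetilde H^{-1/2}(\tau)}=\sup_{0\ne v\in H^{1/2}_{00}(\tau)}\frac{\langle\zeta,v\rangle_\tau}{\|v\|_{H^{1/2}_{00}(\tau)}}.$$ An element $\zeta\in H^{-1/2}(\Gamma)$ is regarded as an element of $\widetilde H^{-1/2}(\tau)$ by restriction: $\langle\zeta,v\rangle_\tau=\langle\zeta,\mathscr{E}(v)\rangle_\Gamma$. $W^{1,\infty}_0(\tau_{\mathbf{y}})$ denotes the functions in $W^{1,\infty}(\tau_{\mathbf{y}})$ (Lipschitz functions) vanishing on $\partial\tau_{\mathbf{y}}$, extended by zero to $\Gamma$; $|\cdot|_{W^{1,\infty}}$ is the seminorm given by the $L^\infty$ norm of the (tangential) gradient. *)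

theory Defs
  imports "HOL-Analysis.Analysis"
begin

section \<open>Surface measure\<close>

text \<open>
  Hausdorff measure, normalised so that the d-dimensional measure on a d-dimensional subspace is
  Lebesgue measure. The outer measure is a metric outer measure, hence countably additive on
  Borel sets, so \<^const>\<open>measure_of\<close> does return it on all Borel sets. The case split makes
  the empty set contribute 0 also for d = 0; boundedness is required because
  \<^const>\<open>diameter\<close> is unspecified on unbounded sets.
\<close>

definition hausdorff_weight :: "nat \<Rightarrow> 'a::metric_space set \<Rightarrow> ennreal" where
  "hausdorff_weight d U =
     (if U = {} then 0 else ennreal (unit_ball_vol (real d) * (diameter U / 2) ^ d))"

definition hausdorff_outer :: "nat \<Rightarrow> 'a::metric_space set \<Rightarrow> ennreal" where
  "hausdorff_outer d A =
     (SUP \<delta>\<in>{0::real<..}.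
        INF U\<in>{U :: nat \<Rightarrow> 'a set. A \<subseteq> (\<Union>i. U i) \<and> (\<forall>i. bounded (U i) \<and> diameter (U i) \<le> \<delta>)}.
          \<Sum>i. hausdorff_weight d (U i))"

definition hausdorff_measure :: "nat \<Rightarrow> 'a::metric_space measure" where
  "hausdorff_measure d = measure_of UNIV (sets borel) (hausdorff_outer d)"

definition surface_measure :: "'a::euclidean_space set \<Rightarrow> 'a measure" where
  "surface_measure \<tau> = restrict_space (hausdorff_measure (DIM('a) - 1)) \<tau>"


section \<open>Geometry of the boundary\<close>

definition curve_length :: "(real \<Rightarrow> 'a::metric_space) \<Rightarrow> ennreal" where
  "curve_length g =
     (SUP ts\<in>{ts. sorted ts \<and> set ts \<subseteq> {0..1}}.
        \<Sum>i<length ts - 1. ennreal (dist (g (ts ! i)) (g (ts ! Suc i))))"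

text \<open>The value is \<^term>\<open>top :: ennreal\<close> if x and y are not joined by a rectifiable path in \<open>\<Gamma>\<close>.\<close>

definition geodesic_dist :: "'a::euclidean_space set \<Rightarrow> 'a \<Rightarrow> 'a \<Rightarrow> ennreal" where
  "geodesic_dist \<Gamma> x y =
     (INF g\<in>{g. path g \<and> path_image g \<subseteq> \<Gamma> \<and> pathstart g = x \<and> pathfinish g = y}. curve_length g)"

definition geodesic_ball :: "'a::euclidean_space set \<Rightarrow> 'a \<Rightarrow> real \<Rightarrow> 'a set" where
  "geodesic_ball \<Gamma> x r = {y\<in>\<Gamma>. geodesic_dist \<Gamma> x y < ennreal r}"

text \<open>
  Near each boundary point, the domain is the strict epigraph, in some direction e, of a
  Lipschitz function on the hyperplane orthogonal to e.
\<close>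

definition lipschitz_boundary :: "'a::euclidean_space set \<Rightarrow> bool" where
  "lipschitz_boundary \<Omega> \<longleftrightarrow>
     (\<forall>x\<in>frontier \<Omega>. \<exists>e r L (f :: 'a \<Rightarrow> real).
        norm e = 1 \<and> r > 0 \<and> L-lipschitz_on {v. v \<bullet> e = 0} f \<and>
        \<Omega> \<inter> ball x r = {y\<in>ball x r. y \<bullet> e > f (y - (y \<bullet> e) *\<^sub>R e)})"

text \<open>
  F maps P (of any dimension) regularly onto a curvilinear copy of P: it is injective and continuously
  differentiable up to the boundary of P, and its differential is injective on the directions
  parallel to P. Values of F and its differential off P, and in directions transversal to P,
  are irrelevant.
\<close>

definition C1_embedding_on :: "'a::euclidean_space set \<Rightarrow> ('a \<Rightarrow> 'a) \<Rightarrow> bool" where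
  "C1_embedding_on P F \<longleftrightarrow>
     inj_on F P \<and>
     (\<exists>U (DF :: 'a \<Rightarrow> 'a \<Rightarrow>\<^sub>L 'a). open U \<and> P \<subseteq> U \<and> continuous_on U DF \<and>
        (\<forall>x\<in>U. (F has_derivative blinfun_apply (DF x)) (at x)) \<and>
        (\<forall>x\<in>P. \<forall>a\<in>affine hull P. blinfun_apply (DF x) (a - x) = 0 \<longrightarrow> a = x))"

text \<open>
  Boundaries of curvilinear polygons (dimension 2) and polyhedra (dimension 3): finitely many
  regular images of (n-1)-dimensional convex polytopes with disjoint interiors. Faces modelled on
  non-convex polygons are covered by cutting them into convex ones.
\<close>

definition curvilinear_polytope_boundary :: "'a::euclidean_space set \<Rightarrow> bool" where
  "curvilinear_polytope_boundary \<Gamma> \<longleftrightarrow>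
     (\<exists>\<P> :: ('a set \<times> ('a \<Rightarrow> 'a)) set. finite \<P> \<and>
        (\<forall>(P, F)\<in>\<P>. polytope P \<and> aff_dim P = int DIM('a) - 1 \<and> C1_embedding_on P F) \<and>
        \<Gamma> = (\<Union>(P, F)\<in>\<P>. F ` P) \<and>
        pairwise (\<lambda>(P, F) (Q, G). F ` rel_interior P \<inter> G ` rel_interior Q = {}) \<P>)"


section \<open>Meshes\<close>

text \<open>
  The reference element is the standard (n-1)-simplex spanned by the unit vectors: a segment for
  n = 2, a triangle for n = 3. A mesh is a set of elements T together with a parametrisation F T of
  each of them over the reference element; vertices, edges and boundaries of T are the images of
  those of the reference element.
\<close>

definition ref_simplex :: "'a::euclidean_space set" where
  "ref_simplex = convex hull Basis"

text \<open>
  The last condition is conformity: two distinct elements meet in a common face, i.e. in the empty set,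
  a common vertex, or a whole common edge.
\<close>

definition surface_mesh ::
  "'a::euclidean_space set \<Rightarrow> 'a set set \<Rightarrow> ('a set \<Rightarrow> 'a \<Rightarrow> 'a) \<Rightarrow> bool" where
  "surface_mesh \<Gamma> Th F \<longleftrightarrow>
     finite Th \<and> \<Union>Th = \<Gamma> \<and>
     (\<forall>T\<in>Th. C1_embedding_on ref_simplex (F T) \<and> T = F T ` ref_simplex) \<and>
     (\<forall>T\<in>Th. \<forall>T'\<in>Th. T \<noteq> T' \<longrightarrow>
        (\<exists>f f'. f face_of ref_simplex \<and> f' face_of ref_simplex \<and>
           T \<inter> T' = F T ` f \<and> T \<inter> T' = F T' ` f'))"

definition mesh_nodes :: "'a::euclidean_space set set \<Rightarrow> ('a set \<Rightarrow> 'a \<Rightarrow> 'a) \<Rightarrow> 'a set" where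
  "mesh_nodes Th F = (\<Union>T\<in>Th. F T ` Basis)"

definition element_boundary :: "('a::euclidean_space set \<Rightarrow> 'a \<Rightarrow> 'a) \<Rightarrow> 'a set \<Rightarrow> 'a set" where
  "element_boundary F T = F T ` rel_frontier ref_simplex"

definition node_patch ::
  "'a::euclidean_space set set \<Rightarrow> ('a set \<Rightarrow> 'a \<Rightarrow> 'a) \<Rightarrow> 'a \<Rightarrow> 'a set" where
  "node_patch Th F y = \<Union>{T\<in>Th. y \<in> element_boundary F T}"

definition quasi_uniform :: "real \<Rightarrow> real \<Rightarrow> 'a::euclidean_space set set \<Rightarrow> bool" where
  "quasi_uniform \<kappa> h Th \<longleftrightarrow> (\<forall>T\<in>Th. h \<le> \<kappa> * diameter T \<and> diameter T \<le> \<kappa> * h)"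

text \<open>
  Balls inscribed in T are balls of the surface \<open>\<Gamma>\<close>, with respect to geodesic distance; for a flat
  element these are the usual inscribed balls. The diameter of T is at most \<open>\<sigma>\<close> times that of its
  largest inscribed ball.
\<close>

definition shape_regular ::
  "real \<Rightarrow> 'a::euclidean_space set \<Rightarrow> 'a set set \<Rightarrow> bool" where
  "shape_regular \<sigma> \<Gamma> Th \<longleftrightarrow>
     (\<forall>T\<in>Th. \<exists>x\<in>T. \<exists>r>0. geodesic_ball \<Gamma> x r \<subseteq> T \<and> diameter T \<le> \<sigma> * (2 * r))"


section \<open>Sobolev spaces on parts of the boundary\<close>

text \<open>
  Elements of the spaces are represented by real functions on the ambient space, of which only
  the values on \<open>\<tau>\<close> matter; functions agreeing almost everywhere on \<open>\<tau>\<close> represent the same element.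
  On the diagonal the integrand of the double integral is 0, as 0 / 0 = 0.
\<close>

definition L2_norm_sq :: "'a::euclidean_space set \<Rightarrow> ('a \<Rightarrow> real) \<Rightarrow> ennreal" where
  "L2_norm_sq \<tau> v = (\<integral>\<^sup>+ t. ennreal ((v t)\<^sup>2) \<partial>surface_measure \<tau>)"

definition H12_seminorm_sq :: "'a::euclidean_space set \<Rightarrow> ('a \<Rightarrow> real) \<Rightarrow> ennreal" where
  "H12_seminorm_sq \<tau> v =
     (\<integral>\<^sup>+ t. (\<integral>\<^sup>+ s. ennreal (\<bar>v t - v s\<bar>\<^sup>2 / dist t s ^ DIM('a)) \<partial>surface_measure \<tau>)
        \<partial>surface_measure \<tau>)"

definition H12_space :: "'a::euclidean_space set \<Rightarrow> ('a \<Rightarrow> real) set" where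
  "H12_space \<tau> =
     {v \<in> borel_measurable (surface_measure \<tau>). L2_norm_sq \<tau> v + H12_seminorm_sq \<tau> v < \<infinity>}"

definition H12_norm :: "'a::euclidean_space set \<Rightarrow> ('a \<Rightarrow> real) \<Rightarrow> real" where
  "H12_norm \<tau> v = sqrt (enn2real (L2_norm_sq \<tau> v + H12_seminorm_sq \<tau> v))"

definition H12_seminorm :: "'a::euclidean_space set \<Rightarrow> ('a \<Rightarrow> real) \<Rightarrow> real" where
  "H12_seminorm \<tau> v = sqrt (enn2real (H12_seminorm_sq \<tau> v))"

definition zero_ext :: "'a set \<Rightarrow> ('a \<Rightarrow> real) \<Rightarrow> 'a \<Rightarrow> real" where
  "zero_ext \<tau> v = (\<lambda>x. if x \<in> \<tau> then v x else 0)"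

definition H1200_space :: "'a::euclidean_space set \<Rightarrow> 'a set \<Rightarrow> ('a \<Rightarrow> real) set" where
  "H1200_space \<Gamma> \<tau> = {v \<in> H12_space \<tau>. zero_ext \<tau> v \<in> H12_space \<Gamma>}"

definition H1200_norm :: "'a::euclidean_space set \<Rightarrow> 'a set \<Rightarrow> ('a \<Rightarrow> real) \<Rightarrow> real" where
  "H1200_norm \<Gamma> \<tau> v = H12_seminorm \<Gamma> (zero_ext \<tau> v)"

text \<open>
  The dual of \<open>H\<close> 1/2: bounded linear functionals, the pairing of \<open>\<zeta>\<close> and \<open>v\<close> being \<open>\<zeta> v\<close>.
  Boundedness makes \<open>\<zeta>\<close> respect almost everywhere equality.
\<close>

definition Hm12_space :: "'a::euclidean_space set \<Rightarrow> (('a \<Rightarrow> real) \<Rightarrow> real) set" where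
  "Hm12_space \<Gamma> =
     {\<zeta>. (\<forall>u\<in>H12_space \<Gamma>. \<forall>v\<in>H12_space \<Gamma>. \<forall>a b. \<zeta> (\<lambda>x. a * u x + b * v x) = a * \<zeta> u + b * \<zeta> v) \<and>
         (\<exists>K. \<forall>v\<in>H12_space \<Gamma>. \<bar>\<zeta> v\<bar> \<le> K * H12_norm \<Gamma> v)}"

text \<open>
  The dual norms are suprema in \<^typ>\<open>ennreal\<close>, so they need no boundedness proviso; negative
  quotients are sent to 0, which is harmless since v and -v occur together.
\<close>

definition Hm12_norm :: "'a::euclidean_space set \<Rightarrow> (('a \<Rightarrow> real) \<Rightarrow> real) \<Rightarrow> ennreal" where
  "Hm12_norm \<Gamma> \<zeta> =
     (SUP v\<in>{v\<in>H12_space \<Gamma>. \<not> (AE t in surface_measure \<Gamma>. v t = 0)}.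
        ennreal (\<zeta> v / H12_norm \<Gamma> v))"

definition tilde_Hm12_norm ::
  "'a::euclidean_space set \<Rightarrow> 'a set \<Rightarrow> (('a \<Rightarrow> real) \<Rightarrow> real) \<Rightarrow> ennreal" where
  "tilde_Hm12_norm \<Gamma> \<tau> \<eta> =
     (SUP v\<in>{v\<in>H1200_space \<Gamma> \<tau>. \<not> (AE t in surface_measure \<tau>. v t = 0)}.
        ennreal (\<eta> v / H1200_norm \<Gamma> \<tau> v))"

definition restrict_dual :: "'a set \<Rightarrow> (('a \<Rightarrow> real) \<Rightarrow> real) \<Rightarrow> ('a \<Rightarrow> real) \<Rightarrow> real" where
  "restrict_dual \<tau> \<zeta> = (\<lambda>v. \<zeta> (zero_ext \<tau> v))"


section \<open>Lipschitz functions and tangential gradients\<close>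

text \<open>
  A derivative of \<open>\<phi>\<close> within a surface \<open>\<tau>\<close> is determined on the tangent space only. Among the vectors
  representing it, the tangential one (the orthogonal projection of all the others) has least norm.
\<close>

definition has_tangential_gradient ::
  "'a::euclidean_space set \<Rightarrow> ('a \<Rightarrow> real) \<Rightarrow> 'a \<Rightarrow> 'a \<Rightarrow> bool" where
  "has_tangential_gradient \<tau> \<phi> x g \<longleftrightarrow>
     (\<phi> has_derivative (\<lambda>v. g \<bullet> v)) (at x within \<tau>) \<and>
     (\<forall>g'. (\<phi> has_derivative (\<lambda>v. g' \<bullet> v)) (at x within \<tau>) \<longrightarrow> norm g \<le> norm g')"

definition Linf_norm_le :: "'a::euclidean_space set \<Rightarrow> ('a \<Rightarrow> real) \<Rightarrow> real \<Rightarrow> bool" where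
  "Linf_norm_le \<tau> \<phi> K \<longleftrightarrow> (AE x in surface_measure \<tau>. \<bar>\<phi> x\<bar> \<le> K)"

text \<open>Existence of the gradient almost everywhere is automatic for Lipschitz \<open>\<phi>\<close> (Rademacher).\<close>

definition W1inf_seminorm_le :: "'a::euclidean_space set \<Rightarrow> ('a \<Rightarrow> real) \<Rightarrow> real \<Rightarrow> bool" where
  "W1inf_seminorm_le \<tau> \<phi> K \<longleftrightarrow>
     (AE x in surface_measure \<tau>. \<exists>g. has_tangential_gradient \<tau> \<phi> x g \<and> norm g \<le> K)"

text \<open>The boundary of \<open>\<tau>\<close> is taken relative to \<open>\<Gamma>\<close>, and the functions are extended by zero to \<open>\<Gamma>\<close>.\<close>

definition W1inf0_space :: "'a::euclidean_space set \<Rightarrow> 'a set \<Rightarrow> ('a \<Rightarrow> real) set" where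
  "W1inf0_space \<Gamma> \<tau> =
     {\<phi>. (\<exists>L. L-lipschitz_on \<tau> \<phi>) \<and>
         (\<forall>x\<in>(top_of_set \<Gamma>) frontier_of \<tau>. \<phi> x = 0) \<and> (\<forall>x\<in>\<Gamma> - \<tau>. \<phi> x = 0)}"

definition admissible_partition ::
  "real \<Rightarrow> real \<Rightarrow> 'a::euclidean_space set \<Rightarrow> 'a set set \<Rightarrow> ('a set \<Rightarrow> 'a \<Rightarrow> 'a) \<Rightarrow>
   ('a \<Rightarrow> 'a \<Rightarrow> real) \<Rightarrow> bool" where
  "admissible_partition C0 h \<Gamma> Th F \<phi> \<longleftrightarrow>
     (\<forall>y\<in>mesh_nodes Th F.
        \<phi> y \<in> H12_space \<Gamma> \<and>
        \<phi> y \<in> W1inf0_space \<Gamma> (node_patch Th F y) \<and>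
        Linf_norm_le (node_patch Th F y) (\<phi> y) C0 \<and>
        W1inf_seminorm_le (node_patch Th F y) (\<phi> y) (C0 / h)) \<and>
     (\<forall>x\<in>\<Gamma>. (\<Sum>y\<in>mesh_nodes Th F. \<phi> y x) = 1)"

end

theory Submission
  imports Defs
begin

text \<open>
  The constraints and the partition of unity give \<open>\<langle>\<zeta>, 1\<rangle> = 0\<close>, so the Poincare inequality of the
  nonlocal seminorm lets the full norm be replaced by the seminorm throughout.

  Lower bound: for functions \<open>w\<^sub>y\<close> supported in the patches, at most 2N terms of
  \<open>\<Sum>\<^sub>y (w\<^sub>y(t) - w\<^sub>y(s))\<close> are nonzero, where N bounds the number of patches through a point. Hence the
  squared seminorm of \<open>\<Sum>\<^sub>y w\<^sub>y\<close> is at most \<open>2N \<Sum>\<^sub>y |w\<^sub>y|\<^sup>2\<close>, and one tests \<open>\<zeta>\<close> with a sum of almost optimal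
  functions of the patches.

  Upper bound: \<open>\<langle>\<zeta>, v\<rangle> = \<Sum>\<^sub>y \<langle>\<zeta>, \<phi>\<^sub>y (v - c\<^sub>y)\<rangle>\<close> for any constants \<open>c\<^sub>y\<close>. As \<open>\<phi>\<^sub>y\<close> is Lipschitz with constant
  C/h and \<open>\<Gamma>\<close> is Ahlfors regular, the squared seminorm of \<open>\<phi>\<^sub>y (v - c\<^sub>y)\<close> is bounded by that of v on
  the patch plus \<open>C h\<^sup>-\<^sup>1\<close> times the squared \<open>L\<^sup>2\<close> norm of \<open>v - c\<^sub>y\<close> on the patch, which the local
  Poincare inequality controls.

  Hausdorff measure on \<open>\<Gamma>\<close> is compared with Lebesgue measure of the full space by sweeping sets along the
  direction of a Lipschitz chart, so that no measure on the hyperplanes is needed. The same device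
  turns the bound on the tangential gradient almost everywhere into a Lipschitz bound on \<open>\<Gamma>\<close>: a function
  on \<open>\<Gamma>\<close> is extended constantly along the chart direction, estimated on balls of the full space, and the
  local bounds are chained along almost shortest paths.
\<close>

section \<open>Hausdorff measure and sweeps\<close>

text \<open>The powers of h have to cancel in the upper bound. The integral over s of the kernel of
  \<open>\<phi> y\<close> is of order 1/h, by a dyadic decomposition about t at the scale h. On a
  patch of diameter O(h) and of measure at least a multiple of h^(n-1), the Poincare constant is of
  order h^n / h^(n-1) = h. The nonlocal seminorm compares any two points of a patch directly, so
  measure and diameter of the patch suffice for this. The constants may be chosen freely because
  \<zeta> annihilates each \<open>\<phi> y\<close>.

  The geodesic hypothesis has two uses: it turns inscribed geodesic balls into Euclidean balls
  intersected with \<Gamma>, and it supplies paths of length comparable to the distance of their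
  ends. The overlap number comes from packing: inscribed balls with centres too close together would
  share a part of \<Gamma> of positive measure, while distinct elements meet in a null set.

  The norm on a patch is the seminorm of the extension by zero. It can vanish on a nonzero function
  if the patch exhausts \<Gamma>, and there too \<zeta> vanishing on constants is what saves the
  estimate.\<close>

lemma bounded_diameter_zero_subset:
  fixes U :: "'a::metric_space set"
  assumes "bounded U" "diameter U = 0" "u \<in> U"
  shows "U \<subseteq> {u}"
  using diameter_bounded_bound[OF assms(1) _ assms(3)] assms(2) by fastforce

text \<open>The Minkowski sum of \<open>A\<close> with a segment. Its volume links Lebesgue to
  Hausdorff measure twice: in the lower growth bound of \<Gamma> and in the transfer of null sets
  from \<Gamma> to the full space.\<close>

definition sweep :: "'a::real_normed_vector \<Rightarrow> real \<Rightarrow> 'a set \<Rightarrow> 'a set" where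
  "sweep e s A = {a + t *\<^sub>R e | a t. a \<in> A \<and> \<bar>t\<bar> \<le> s}"

text \<open>Balls of radius 2 D, centred at spacing D on the line through a point of
  \<open>U\<close>, cover the swept set. About 2 s / D of them occur, each of volume a multiple of
  D^n, whence s D^(n-1). A measurable superset is asserted because \<open>U\<close> is
  arbitrary.\<close>

lemma sweep_bounded_cover:
  fixes U :: "'a::euclidean_space set"
  assumes e: "norm e = 1" and s: "0 < s" and U: "bounded U" "diameter U \<le> s" and dim: "2 \<le> DIM('a)"
  shows "\<exists>V\<in>sets lborel. sweep e s U \<subseteq> V \<and>
    emeasure lborel V \<le> ennreal (5 * 2 ^ DIM('a) * unit_ball_vol DIM('a) * s * diameter U ^ (DIM('a) - 1))"
proof (cases "U = {}")
  case True
  then show ?thesis by (intro bexI[of _ "{}"]) (auto simp: sweep_def)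
next
  case False
  then obtain u where u: "u \<in> U" by blast
  define D where "D = diameter U"
  have D0: "0 \<le> D" using U(1) by (simp add: D_def diameter_ge_0)
  show ?thesis
  proof (cases "D = 0")
    case True
    \<comment> \<open>For D = 0 the claimed bound is 0, as the exponent n - 1 is positive; the swept
      point is a segment, which is null in dimension at least 2.\<close>
    define V where "V = closed_segment (u - s *\<^sub>R e) (u + s *\<^sub>R e)"
    have sub: "sweep e s U \<subseteq> V"
    proof
      fix x assume "x \<in> sweep e s U"
      then obtain t where t: "x = u + t *\<^sub>R e" "\<bar>t\<bar> \<le> s"
        using bounded_diameter_zero_subset[OF U(1) _ u] True by (auto simp: sweep_def D_def)
      define l where "l = (t + s) / (2 * s)"
      have l: "l * (2 * s) = t + s" using s by (simp add: l_def)
      have "(1 - l) *\<^sub>R (u - s *\<^sub>R e) + l *\<^sub>R (u + s *\<^sub>R e) = u + (l * (2 * s) - s) *\<^sub>R e"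
        by (simp add: algebra_simps flip: scaleR_add_left)
      also have "\<dots> = x" unfolding l using t by simp
      finally have "x = (1 - l) *\<^sub>R (u - s *\<^sub>R e) + l *\<^sub>R (u + s *\<^sub>R e)" by simp
      moreover have "0 \<le> l" "l \<le> 1"
        using t s by (auto simp: l_def field_simps)
      ultimately show "x \<in> V" unfolding V_def in_segment by blast
    qed
    have "negligible V"
      using negligible_convex_interior[of V] interior_closed_segment_ge2[OF dim] by (simp add: V_def)
    then have "V \<in> null_sets lebesgue" by (simp add: negligible_iff_null_sets)
    moreover have V: "V \<in> sets lborel" unfolding V_def by simp
    ultimately have "emeasure lborel V = 0"
      by (simp add: null_sets_def emeasure_completion main_part_sets)
    with V sub show ?thesis by auto
  next
    case False
    with D0 have D: "0 < D" by simp
    define m where "m = \<lceil>s / D\<rceil>"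
    define B where "B = (\<lambda>k::int. cball (u + (of_int k * D) *\<^sub>R e) (2 * D))"
    define V where "V = (\<Union>k\<in>{-m..m}. B k)"
    have sub: "sweep e s U \<subseteq> V"
    proof
      fix x assume "x \<in> sweep e s U"
      then obtain a t where t: "x = a + t *\<^sub>R e" "a \<in> U" "\<bar>t\<bar> \<le> s" by (auto simp: sweep_def)
      define k where "k = \<lfloor>t / D\<rfloor>"
      have k: "of_int k \<le> t / D" "t / D < of_int k + 1" unfolding k_def by linarith+
      have kD: "\<bar>t - of_int k * D\<bar> \<le> D" using k D by (simp add: field_simps abs_le_iff)
      have "t / D \<le> s / D" "- (s / D) \<le> t / D"
        using t(3) D divide_right_mono[of t s D] divide_right_mono[of "-s" t D] by auto
      then have km: "k \<in> {-m..m}" unfolding k_def m_def by (auto simp: abs_le_iff) linarith+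
      have "dist (u + (of_int k * D) *\<^sub>R e) x = norm ((u - a) + (of_int k * D - t) *\<^sub>R e)"
        by (simp add: dist_norm t(1) algebra_simps)
      also have "\<dots> \<le> norm (u - a) + \<bar>of_int k * D - t\<bar> * norm e"
        by (metis norm_triangle_ineq norm_scaleR)
      also have "\<dots> \<le> D + D"
        using diameter_bounded_bound[OF U(1) u t(2)] kD e by (simp add: D_def dist_norm abs_minus_commute)
      finally have "x \<in> B k" by (simp add: B_def)
      with km show "x \<in> V" by (auto simp: V_def)
    qed
    have "0 < s / D" using s D by simp
    then have m0: "0 \<le> m" unfolding m_def by linarith
    have "emeasure lborel V \<le> (\<Sum>k\<in>{-m..m}. emeasure lborel (B k))"
      unfolding V_def by (intro emeasure_subadditive_finite) (auto simp: B_def)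
    also have "\<dots> = (\<Sum>k\<in>{-m..m}. ennreal (unit_ball_vol DIM('a) * (2 * D) ^ DIM('a)))"
      unfolding B_def using D by (intro sum.cong) (auto simp: emeasure_cball)
    also have "\<dots> = ennreal ((2 * of_int m + 1) * (unit_ball_vol DIM('a) * (2 * D) ^ DIM('a)))"
      using D m0 by (simp add: ennreal_of_nat_eq_real_of_nat ennreal_mult'[symmetric] del: ennreal_plus)
    also have "\<dots> \<le> ennreal (5 * s / D * (unit_ball_vol DIM('a) * (2 * D) ^ DIM('a)))"
    proof (intro ennreal_leI mult_right_mono)
      \<comment> \<open>The number of balls is 2 m + 1 \<le> 2 s / D + 3, and 1 \<le> s / D absorbs
        the 3; this is the origin of the 5.\<close>
      have "of_int m \<le> s / D + 1" unfolding m_def by linarith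
      moreover have "1 \<le> s / D" using U(2) D by (simp add: D_def)
      ultimately show "2 * of_int m + 1 \<le> 5 * s / D" by linarith
    qed (use D in auto)
    also have "5 * s / D * (unit_ball_vol DIM('a) * (2 * D) ^ DIM('a)) =
       5 * 2 ^ DIM('a) * unit_ball_vol DIM('a) * s * D ^ (DIM('a) - 1)"
    proof -
      have "D ^ DIM('a) = D * D ^ (DIM('a) - 1)" using dim by (cases "DIM('a)") auto
      then show ?thesis using D by (simp add: power_mult_distrib field_simps)
    qed
    finally show ?thesis using sub
      by (intro bexI[of _ V]) (auto simp: D_def V_def B_def)
  qed
qed

lemma suminf_ennreal_cmult_le:
  fixes f g :: "nat \<Rightarrow> ennreal"
  assumes "\<And>i. f i \<le> c * g i" shows "(\<Sum>i. f i) \<le> c * (\<Sum>i. g i)"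
  using suminf_le[OF assms] by (simp add: ennreal_suminf_cmult)

text \<open>The quotient of 2^(n-1) by \<open>unit_ball_vol (n - 1)\<close> undoes the normalisation
  of \<open>hausdorff_weight\<close>; the other factors come from
  \<open>sweep_bounded_cover\<close>.\<close>

definition sweep_const :: "nat \<Rightarrow> real" where
  "sweep_const n = 5 * 2 ^ n * unit_ball_vol n * 2 ^ (n - 1) / unit_ball_vol (n - 1)"

lemma sweep_const_pos: "0 < sweep_const n"
  by (simp add: sweep_const_def)

text \<open>A cover of \<open>A\<close> with total weight below \<open>B\<close> is swept set by
  set. The bound \<open>B\<close> is strict because the infimum over covers need not be
  attained.\<close>

lemma sweep_cover:
  fixes A :: "'a::euclidean_space set"
  assumes e: "norm e = 1" and s: "0 < s" and dim: "2 \<le> DIM('a)"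
    and B: "hausdorff_outer (DIM('a) - 1) A < B"
  shows "\<exists>V\<in>sets lborel. sweep e s A \<subseteq> V \<and> emeasure lborel V \<le> ennreal (sweep_const DIM('a) * s) * B"
proof -
  let ?d = "DIM('a) - 1"
  let ?K = "sweep_const DIM('a) * s"
  have K: "0 < ?K" using s sweep_const_pos by simp
  define I where "I = {U :: nat \<Rightarrow> 'a set. A \<subseteq> (\<Union>i. U i) \<and> (\<forall>i. bounded (U i) \<and> diameter (U i) \<le> s)}"
  \<comment> \<open>The supremum over \<delta> dominates its term at \<delta> = \<open>s\<close>,
    the scale that \<open>sweep_bounded_cover\<close> asks for.\<close>
  have "(INF U\<in>I. \<Sum>i. hausdorff_weight ?d (U i)) \<le> hausdorff_outer ?d A"
    unfolding hausdorff_outer_def I_def using s by (intro SUP_upper) auto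
  also note B
  finally obtain U where U: "U \<in> I" and UB: "(\<Sum>i. hausdorff_weight ?d (U i)) < B"
    by (auto simp: INF_less_iff)
  have "\<exists>V. V \<in> sets lborel \<and> sweep e s (U i) \<subseteq> V \<and>
     emeasure lborel V \<le> ennreal ?K * hausdorff_weight ?d (U i)" for i
  proof (cases "U i = {}")
    case True
    then show ?thesis by (intro exI[of _ "{}"]) (auto simp: sweep_def)
  next
    case False
    have b: "bounded (U i)" "diameter (U i) \<le> s" using U by (auto simp: I_def)
    obtain V where V: "V \<in> sets lborel" "sweep e s (U i) \<subseteq> V"
      "emeasure lborel V \<le> ennreal (5 * 2 ^ DIM('a) * unit_ball_vol DIM('a) * s * diameter (U i) ^ ?d)"
      using sweep_bounded_cover[OF e s b dim] by blast
    have ub: "unit_ball_vol (real ?d) \<noteq> 0" using unit_ball_vol_pos[of "real ?d"] by linarith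
    have "ennreal ?K * hausdorff_weight ?d (U i) =
      ennreal (?K * (unit_ball_vol (real ?d) * (diameter (U i) / 2) ^ ?d))"
      using False K b diameter_ge_0[of "U i"]
      by (simp add: hausdorff_weight_def ennreal_mult'[symmetric] del: of_nat_diff)
    also have "?K * (unit_ball_vol (real ?d) * (diameter (U i) / 2) ^ ?d) =
      5 * 2 ^ DIM('a) * unit_ball_vol DIM('a) * s * diameter (U i) ^ ?d"
      using ub by (simp add: sweep_const_def power_divide del: of_nat_diff)
    finally show ?thesis using V by auto
  qed
  then obtain V where V: "\<And>i. V i \<in> sets lborel" "\<And>i. sweep e s (U i) \<subseteq> V i"
     "\<And>i. emeasure lborel (V i) \<le> ennreal ?K * hausdorff_weight ?d (U i)" by metis
  have "sweep e s A \<subseteq> (\<Union>i. sweep e s (U i))" using U unfolding I_def sweep_def by blast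
  then have "sweep e s A \<subseteq> (\<Union>i. V i)" using V(2) by blast
  moreover have "emeasure lborel (\<Union>i. V i) \<le> (\<Sum>i. emeasure lborel (V i))"
    using V(1) by (intro emeasure_subadditive_countably) auto
  moreover have "\<dots> \<le> ennreal ?K * (\<Sum>i. hausdorff_weight ?d (U i))"
    by (intro suminf_ennreal_cmult_le V)
  moreover have "\<dots> \<le> ennreal ?K * B" using UB by (intro mult_left_mono) auto
  ultimately show ?thesis using V(1) by (intro bexI[of _ "\<Union>i. V i"]) auto
qed

lemma less_divide_ennreal: "b \<noteq> 0 \<Longrightarrow> b < top \<Longrightarrow> a < c / b \<longleftrightarrow> a * b < (c :: ennreal)"
  by (cases a; cases b; cases c)
     (auto simp: divide_ennreal ennreal_mult'[symmetric] ennreal_less_iff field_simps ennreal_top_divide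
        ennreal_mult_eq_top_iff top_unique less_top[symmetric] ennreal_top_mult)

text \<open>If the inequality failed, density of \<open>ennreal\<close> would give a bound strictly
  between the outer measure and the quotient of the volume by the constant, and
  \<open>sweep_cover\<close> would apply to it.\<close>

lemma emeasure_sweep_le:
  fixes A Q :: "'a::euclidean_space set"
  assumes e: "norm e = 1" and s: "0 < s" and dim: "2 \<le> DIM('a)"
    and Q: "Q \<in> sets lborel" "Q \<subseteq> sweep e s A"
  shows "emeasure lborel Q \<le> ennreal (sweep_const DIM('a) * s) * hausdorff_outer (DIM('a) - 1) A"
proof (rule ccontr)
  let ?K = "ennreal (sweep_const DIM('a) * s)"
  have K: "0 < ?K" using s sweep_const_pos by simp
  assume "\<not> ?thesis"
  then have "hausdorff_outer (DIM('a) - 1) A < emeasure lborel Q / ?K"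
    using K by (subst less_divide_ennreal) (auto simp: mult.commute not_le)
  then obtain B where B: "hausdorff_outer (DIM('a) - 1) A < B" "B < emeasure lborel Q / ?K"
    using dense by blast
  obtain V where "V \<in> sets lborel" "sweep e s A \<subseteq> V" "emeasure lborel V \<le> ?K * B"
    using sweep_cover[OF e s dim B(1)] by blast
  then have "emeasure lborel Q \<le> ?K * B"
    using Q emeasure_mono[of Q V lborel] by force
  with B(2) show False using K by (subst (asm) less_divide_ennreal) (auto simp: mult.commute not_less[symmetric])
qed

lemma negligible_sweep:
  fixes A :: "'a::euclidean_space set"
  assumes e: "norm e = 1" and s: "0 < s" and dim: "2 \<le> DIM('a)"
    and A: "hausdorff_outer (DIM('a) - 1) A = 0"
  shows "negligible (sweep e s A)"
  unfolding negligible_outer_le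
proof (intro allI impI)
  fix \<epsilon> :: real assume eps: "0 < \<epsilon>"
  let ?K = "sweep_const DIM('a) * s"
  have K: "0 < ?K" using s sweep_const_pos by simp
  obtain V where V: "V \<in> sets lborel" "sweep e s A \<subseteq> V" "emeasure lborel V \<le> ennreal ?K * ennreal (\<epsilon> / ?K)"
    using sweep_cover[OF e s dim, of A "ennreal (\<epsilon> / ?K)"] A eps K by auto
  have le: "emeasure lborel V \<le> ennreal \<epsilon>"
    using V(3) K eps by (subst (asm) ennreal_mult'[symmetric]) (auto simp: mult_eq_0_iff split: if_splits)
  have "emeasure lebesgue V = emeasure lborel V" using V(1) by simp
  then show "\<exists>T. sweep e s A \<subseteq> T \<and> T \<in> lmeasurable \<and> measure lebesgue T \<le> \<epsilon>"
    using V le eps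
    by (intro exI[of _ V]) (auto simp: fmeasurable_def measure_def enn2real_leI order_le_less_trans[OF le])
qed

section \<open>Finite covers and packings\<close>

lemma hausdorff_outer_le_covers:
  fixes A :: "'a::metric_space set"
  assumes "\<And>\<delta>. 0 < \<delta> \<Longrightarrow> \<exists>\<C>. finite \<C> \<and> A \<subseteq> \<Union>\<C> \<and>
     (\<forall>U\<in>\<C>. bounded U \<and> diameter U \<le> \<delta>) \<and> (\<Sum>U\<in>\<C>. hausdorff_weight d U) \<le> B"
  shows "hausdorff_outer d A \<le> B"
  unfolding hausdorff_outer_def
proof (intro SUP_least)
  fix \<delta> :: real assume "\<delta> \<in> {0<..}"
  then have d: "0 < \<delta>" by simp
  then obtain \<C> where C: "finite \<C>" "A \<subseteq> \<Union>\<C>" "\<And>U. U\<in>\<C> \<Longrightarrow> bounded U \<and> diameter U \<le> \<delta>"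
    "(\<Sum>U\<in>\<C>. hausdorff_weight d U) \<le> B" using assms by meson
  obtain f where f: "bij_betw f {..<card \<C>} \<C>"
    using ex_bij_betw_nat_finite[OF C(1)] by (auto simp: atLeast0LessThan)
  \<comment> \<open>Empty sets pad the finite cover to a sequence at no cost, since
    \<open>hausdorff_weight\<close> is 0 on them even for d = 0.\<close>
  define U where "U i = (if i < card \<C> then f i else {})" for i
  have Uin: "U i \<in> insert {} \<C>" for i using f by (auto simp: U_def bij_betw_def)
  have CU: "\<Union>\<C> \<subseteq> (\<Union>i. U i)"
  proof
    fix x assume "x \<in> \<Union>\<C>"
    then obtain W where "W \<in> \<C>" "x \<in> W" by blast
    then obtain i where "i < card \<C>" "f i = W" using f unfolding bij_betw_def by (metis imageE lessThan_iff)
    then show "x \<in> (\<Union>i. U i)" using \<open>x \<in> W\<close> by (auto simp: U_def intro!: exI[of _ i])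
  qed
  have bU: "bounded (U i) \<and> diameter (U i) \<le> \<delta>" for i
  proof (cases "U i = {}")
    case True
    show ?thesis unfolding True using d by simp
  next
    case False
    then show ?thesis using C(3) Uin by blast
  qed
  have U: "U \<in> {U. A \<subseteq> (\<Union>i. U i) \<and> (\<forall>i. bounded (U i) \<and> diameter (U i) \<le> \<delta>)}"
    by (rule CollectI, rule conjI, rule subset_trans[OF C(2) CU], rule allI, rule bU)
  have "(INF U\<in>{U :: nat \<Rightarrow> 'a set. A \<subseteq> (\<Union>i. U i) \<and> (\<forall>i. bounded (U i) \<and> diameter (U i) \<le> \<delta>)}.
          \<Sum>i. hausdorff_weight d (U i)) \<le> (\<Sum>i. hausdorff_weight d (U i))"
    by (rule INF_lower[OF U])
  also have "\<dots> = (\<Sum>i<card \<C>. hausdorff_weight d (U i))"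
    by (intro suminf_finite) (auto simp: U_def hausdorff_weight_def)
  also have "\<dots> = (\<Sum>i<card \<C>. hausdorff_weight d (f i))" by (simp add: U_def)
  also have "\<dots> = (\<Sum>U\<in>\<C>. hausdorff_weight d U)"
    by (rule sum.reindex_bij_betw[OF f])
  finally show "(INF U\<in>{U :: nat \<Rightarrow> 'a set. A \<subseteq> (\<Union>i. U i) \<and> (\<forall>i. bounded (U i) \<and> diameter (U i) \<le> \<delta>)}.
          \<Sum>i. hausdorff_weight d (U i)) \<le> B" using C(4) by (rule order_trans)
qed

text \<open>The balls of radius \<epsilon>/2 about the points are disjoint and lie in a ball of
  radius R + \<epsilon>/2; their volumes are compared.\<close>

lemma separated_card_le:
  fixes S :: "'a::euclidean_space set"
  assumes S: "finite S" "S \<subseteq> cball x R" and eps: "0 < \<epsilon>"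
    and sep: "\<And>a b. a \<in> S \<Longrightarrow> b \<in> S \<Longrightarrow> a \<noteq> b \<Longrightarrow> \<epsilon> \<le> dist a b" and R: "0 \<le> R"
  shows "real (card S) * \<epsilon> ^ DIM('a) \<le> (2 * R + \<epsilon>) ^ DIM('a)"
proof -
  let ?n = "DIM('a)"
  have "disjoint_family_on (\<lambda>a. ball a (\<epsilon>/2)) S"
    unfolding disjoint_family_on_def
  proof (intro ballI impI)
    fix a b assume ab: "a \<in> S" "b \<in> S" "a \<noteq> b"
    show "ball a (\<epsilon>/2) \<inter> ball b (\<epsilon>/2) = {}"
      using sep[OF ab] by (intro disjoint_ballI) simp
  qed
  then have "(\<Sum>a\<in>S. emeasure lborel (ball a (\<epsilon>/2))) = emeasure lborel (\<Union>a\<in>S. ball a (\<epsilon>/2))"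
    by (intro sum_emeasure) (auto simp: S)
  also have "\<dots> \<le> emeasure lborel (cball x (R + \<epsilon>/2))"
  proof (intro emeasure_mono subsetI)
    fix z assume "z \<in> (\<Union>a\<in>S. ball a (\<epsilon>/2))"
    then obtain a where "a \<in> S" "dist a z < \<epsilon>/2" by auto
    moreover have "dist x a \<le> R" using S(2) \<open>a \<in> S\<close> by auto
    ultimately show "z \<in> cball x (R + \<epsilon>/2)" using dist_triangle[of x z a] by simp
  qed auto
  finally have "ennreal (real (card S) * (unit_ball_vol ?n * (\<epsilon>/2) ^ ?n)) \<le> ennreal (unit_ball_vol ?n * (R + \<epsilon>/2) ^ ?n)"
    using eps R by (simp add: emeasure_ball emeasure_cball ennreal_of_nat_eq_real_of_nat ennreal_mult'[symmetric])
  then have "unit_ball_vol ?n * (real (card S) * (\<epsilon>/2) ^ ?n) \<le> unit_ball_vol ?n * (R + \<epsilon>/2) ^ ?n"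
    using eps R by (subst (asm) ennreal_le_iff) (auto simp: algebra_simps)
  then have "real (card S) * (\<epsilon>/2) ^ ?n \<le> (R + \<epsilon>/2) ^ ?n" by simp
  then have "2 ^ ?n * (real (card S) * (\<epsilon>/2) ^ ?n) \<le> 2 ^ ?n * (R + \<epsilon>/2) ^ ?n" by simp
  also have "2 ^ ?n * (R + \<epsilon>/2) ^ ?n = (2 * R + \<epsilon>) ^ ?n"
    by (simp add: power_mult_distrib[symmetric] algebra_simps)
  finally show ?thesis by (simp add: power_divide)
qed

section \<open>Lipschitz charts and Ahlfors regularity\<close>

text \<open>The projection along \<open>e\<close> onto a Lipschitz graph, known only through its
  properties. It is Lipschitz on the whole space and a retraction onto \<Gamma> near
  \<open>x\<close>, so that functions on \<Gamma> pull back to a ball of the full space and no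
  coordinates on the hyperplane appear.\<close>

definition graph_chart :: "'a::euclidean_space set \<Rightarrow> 'a \<Rightarrow> real \<Rightarrow> real \<Rightarrow> 'a \<Rightarrow> ('a \<Rightarrow> 'a) \<Rightarrow> bool" where
  "graph_chart \<Gamma> x \<rho> \<Lambda> e \<Psi> \<longleftrightarrow>
     norm e = 1 \<and> (\<forall>p q. dist (\<Psi> p) (\<Psi> q) \<le> \<Lambda> * dist p q) \<and> \<Psi> ` ball x \<rho> \<subseteq> \<Gamma> \<and>
     (\<forall>p\<in>\<Gamma> \<inter> ball x \<rho>. \<Psi> p = p) \<and> (\<forall>q s. \<Psi> (q + s *\<^sub>R e) = \<Psi> q) \<and> (\<forall>q. \<exists>s. \<Psi> q = q + s *\<^sub>R e)"

lemma graph_chart_mono: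
  assumes "graph_chart \<Gamma> x \<rho> \<Lambda> e \<Psi>" "ball y \<rho>' \<subseteq> ball x \<rho>" "\<Lambda> \<le> \<Lambda>'"
  shows "graph_chart \<Gamma> y \<rho>' \<Lambda>' e \<Psi>"
proof -
  have "dist (\<Psi> p) (\<Psi> q) \<le> \<Lambda>' * dist p q" for p q
    using assms(1,3) mult_right_mono[of \<Lambda> \<Lambda>' "dist p q"] unfolding graph_chart_def
    by (meson order_trans zero_le_dist)
  then show ?thesis using assms unfolding graph_chart_def by blast
qed

lemma lipschitz_boundary_chart:
  fixes \<Omega> :: "'a::euclidean_space set"
  assumes \<Omega>: "open \<Omega>" "lipschitz_boundary \<Omega>" and x: "x \<in> frontier \<Omega>"
  shows "\<exists>\<rho>>0. \<exists>\<Lambda>\<ge>1. \<exists>e \<Psi>. graph_chart (frontier \<Omega>) x \<rho> \<Lambda> e \<Psi>"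
proof -
  obtain e r L and f :: "'a \<Rightarrow> real" where e: "norm e = 1" and r: "r > 0"
    and L: "L-lipschitz_on {v. v \<bullet> e = 0} f"
    and eq: "\<Omega> \<inter> ball x r = {y\<in>ball x r. y \<bullet> e > f (y - (y \<bullet> e) *\<^sub>R e)}"
    using assms unfolding lipschitz_boundary_def by blast
  have ee: "e \<bullet> e = 1" using e by (simp add: norm_eq_1)
  define \<pi> where "\<pi> = (\<lambda>y. y - (y \<bullet> e) *\<^sub>R e)"
  define \<Psi> where "\<Psi> = (\<lambda>y. \<pi> y + f (\<pi> y) *\<^sub>R e)"
  have pi_e: "\<pi> y \<bullet> e = 0" for y by (simp add: \<pi>_def inner_diff_left ee)
  have pi_add: "\<pi> (y + s *\<^sub>R e) = \<pi> y" for y s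
    by (simp add: \<pi>_def inner_add_left ee algebra_simps)
  have pi_split: "y = \<pi> y + (y \<bullet> e) *\<^sub>R e" for y by (simp add: \<pi>_def)
  have pi_lip: "dist (\<pi> p) (\<pi> q) \<le> dist p q" for p q
  proof -
    have eq: "\<pi> p - \<pi> q = \<pi> (p - q)" by (simp add: \<pi>_def inner_diff_left algebra_simps)
    have "(norm (\<pi> (p - q)))\<^sup>2 + ((p - q) \<bullet> e)\<^sup>2 = (norm (p - q))\<^sup>2"
      unfolding power2_norm_eq_inner by (simp add: \<pi>_def inner_diff_left inner_diff_right ee inner_commute power2_eq_square algebra_simps)
    then have "(norm (\<pi> (p - q)))\<^sup>2 \<le> (norm (p - q))\<^sup>2" by (smt (verit) zero_le_power2)
    then show ?thesis by (simp add: dist_norm eq power2_le_iff_abs_le)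
  qed
  have L0: "0 \<le> L" using L by (rule lipschitz_on_nonneg)
  have f_lip: "dist (f (\<pi> p)) (f (\<pi> q)) \<le> L * dist p q" for p q
    using lipschitz_onD[OF L, of "\<pi> p" "\<pi> q"] pi_e pi_lip[of p q] L0
    by (smt (verit, best) mem_Collect_eq mult_left_mono)
  have lip: "dist (\<Psi> p) (\<Psi> q) \<le> (1 + L) * dist p q" for p q
  proof -
    have "dist (\<Psi> p) (\<Psi> q) \<le> dist (\<pi> p) (\<pi> q) + dist (f (\<pi> p) *\<^sub>R e) (f (\<pi> q) *\<^sub>R e)"
      unfolding \<Psi>_def by (rule dist_triangle_add)
    also have "dist (f (\<pi> p) *\<^sub>R e) (f (\<pi> q) *\<^sub>R e) = dist (f (\<pi> p)) (f (\<pi> q))"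
      by (simp add: dist_norm e flip: scaleR_diff_left)
    finally show ?thesis using pi_lip[of p q] f_lip[of p q] by (simp add: algebra_simps)
  qed
  have contpi: "continuous_on UNIV \<pi>" unfolding \<pi>_def by (intro continuous_intros)
  have contf: "continuous_on UNIV (\<lambda>y. f (\<pi> y))"
    by (rule lipschitz_on_continuous_on[of L]) (simp add: lipschitz_on_def L0 f_lip)
  \<comment> \<open>Points strictly below the graph have a neighbourhood free of \<Omega>, and
    \<Omega>, being open, contains no frontier point; conversely, small shifts of a graph point in
    direction \<open>e\<close> lie in \<Omega>.\<close>
  have fr: "p \<in> frontier \<Omega> \<longleftrightarrow> p \<bullet> e = f (\<pi> p)" if p: "p \<in> ball x r" for p
  proof
    assume pf: "p \<in> frontier \<Omega>"
    then have pc: "p \<in> closure \<Omega>" "p \<notin> \<Omega>" using \<Omega>(1) by (auto simp: frontier_def interior_open)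
    have "\<not> p \<bullet> e > f (\<pi> p)"
      using eq p pc(2) unfolding \<pi>_def by blast
    moreover have "\<not> p \<bullet> e < f (\<pi> p)"
    proof
      assume lt: "p \<bullet> e < f (\<pi> p)"
      have "open (ball x r \<inter> {y. y \<bullet> e < f (\<pi> y)})"
        by (intro open_Int open_ball open_Collect_less contf continuous_intros)
      moreover have "p \<in> ball x r \<inter> {y. y \<bullet> e < f (\<pi> y)}" using lt p by simp
      ultimately obtain z where "z \<in> \<Omega>" "z \<in> ball x r" "z \<bullet> e < f (\<pi> z)"
        using pc(1) unfolding closure_iff_nhds_not_empty by blast
      moreover have "f (\<pi> z) < z \<bullet> e" using eq \<open>z \<in> \<Omega>\<close> \<open>z \<in> ball x r\<close> unfolding \<pi>_def by blast
      ultimately show False by simp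
    qed
    ultimately show "p \<bullet> e = f (\<pi> p)" by simp
  next
    assume pe: "p \<bullet> e = f (\<pi> p)"
    have "p \<notin> \<Omega>" using eq p pe unfolding \<pi>_def by force
    moreover have "p \<in> closure \<Omega>"
      unfolding closure_approachable
    proof (intro allI impI)
      fix \<epsilon> :: real assume "0 < \<epsilon>"
      define t where "t = min (\<epsilon> / 2) ((r - dist x p) / 2)"
      have t: "0 < t" "t < \<epsilon>" "t < r - dist x p" using \<open>0 < \<epsilon>\<close> p by (auto simp: t_def min_def field_simps)
      have d: "dist (p + t *\<^sub>R e) p = t" using t e by (simp add: dist_norm)
      have "p + t *\<^sub>R e \<in> ball x r"
        using dist_triangle[of x "p + t *\<^sub>R e" p] d t by (simp add: dist_commute)
      moreover have "f (\<pi> (p + t *\<^sub>R e)) < (p + t *\<^sub>R e) \<bullet> e"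
        using pe t by (simp add: pi_add inner_add_left ee)
      ultimately have "p + t *\<^sub>R e \<in> \<Omega>" using eq unfolding \<pi>_def by blast
      moreover have "dist (p + t *\<^sub>R e) p < \<epsilon>" using d t by linarith
      ultimately show "\<exists>y\<in>\<Omega>. dist y p < \<epsilon>" by blast
    qed
    ultimately show "p \<in> frontier \<Omega>" using \<Omega>(1) by (simp add: frontier_def interior_open)
  qed
  have fixp: "\<Psi> p = p" if "p \<in> frontier \<Omega>" "p \<in> ball x r" for p
    using fr[OF that(2)] that(1) pi_split[of p] by (simp add: \<Psi>_def)
  \<comment> \<open>The projection fixes \<open>x\<close> and expands distances by at most 1 + L, so
    from this smaller ball its values stay in \<open>ball x r\<close>, where the frontier is the
    graph.\<close>
  define \<rho> where "\<rho> = r / (1 + L)"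
  have rho: "0 < \<rho>" "\<rho> \<le> r" using r L0 by (auto simp: \<rho>_def field_simps)
  have "\<Psi> q \<in> frontier \<Omega>" if "q \<in> ball x \<rho>" for q
  proof -
    have "dist x (\<Psi> q) = dist (\<Psi> x) (\<Psi> q)" using fixp[OF x] r by simp
    also have "\<dots> \<le> (1 + L) * dist x q" by (rule lip)
    also have "\<dots> < r" using that L0 by (simp add: \<rho>_def pos_less_divide_eq mult.commute)
    finally have "\<Psi> q \<in> ball x r" by simp
    moreover have "\<pi> (\<Psi> q) = \<pi> q" unfolding \<Psi>_def pi_add by (simp add: \<pi>_def inner_diff_left ee)
    then have "\<Psi> q \<bullet> e = f (\<pi> (\<Psi> q))" by (simp add: \<Psi>_def inner_add_left pi_e ee)
    ultimately show ?thesis using fr by blast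
  qed
  moreover have "\<exists>s. \<Psi> q = q + s *\<^sub>R e" for q
    by (rule exI[of _ "f (\<pi> q) - q \<bullet> e"]) (simp add: \<Psi>_def \<pi>_def algebra_simps)
  moreover have "\<Psi> (q + s *\<^sub>R e) = \<Psi> q" for q s by (simp add: \<Psi>_def pi_add)
  ultimately have "graph_chart (frontier \<Omega>) x \<rho> (1 + L) e \<Psi>"
    unfolding graph_chart_def using e lip fixp rho(2) by auto
  then show ?thesis using rho(1) L0 by (metis le_add_same_cancel1)
qed

text \<open>As for a Lebesgue number: the balls of half radius cover by compactness, and a chart at
  their centre also serves every point of the half ball with the remaining half of the
  radius.\<close>

lemma lipschitz_boundary_charts:
  fixes \<Omega> :: "'a::euclidean_space set"
  assumes "open \<Omega>" "lipschitz_boundary \<Omega>" "bounded \<Omega>"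
  shows "\<exists>\<rho>>0. \<exists>\<Lambda>\<ge>1. \<forall>x\<in>frontier \<Omega>. \<exists>e \<Psi>. graph_chart (frontier \<Omega>) x \<rho> \<Lambda> e \<Psi>"
proof -
  let ?\<Gamma> = "frontier \<Omega>"
  obtain R L where RL: "\<And>x. x \<in> ?\<Gamma> \<Longrightarrow> 0 < R x \<and> 1 \<le> L x \<and> (\<exists>e \<Psi>. graph_chart ?\<Gamma> x (R x) (L x) e \<Psi>)"
    using lipschitz_boundary_chart[OF assms(1,2)] by metis
  have "compact ?\<Gamma>" using assms(3) by (rule compact_frontier_bounded)
  then obtain C where C: "C \<subseteq> ?\<Gamma>" "finite C" "?\<Gamma> \<subseteq> (\<Union>x\<in>C. ball x (R x / 2))"
    by (rule compactE_image[of _ ?\<Gamma> "\<lambda>x. ball x (R x / 2)"]) (use RL in \<open>force+\<close>)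
  define \<rho> where "\<rho> = Min (insert 1 ((\<lambda>x. R x / 2) ` C))"
  define \<Lambda> where "\<Lambda> = Max (insert 1 (L ` C))"
  have "0 < \<rho>" using C RL by (auto simp: \<rho>_def)
  moreover have "1 \<le> \<Lambda>" using C by (simp add: \<Lambda>_def)
  moreover have "\<exists>e \<Psi>. graph_chart ?\<Gamma> y \<rho> \<Lambda> e \<Psi>" if y: "y \<in> ?\<Gamma>" for y
  proof -
    obtain x where x: "x \<in> C" "dist x y < R x / 2" using C(3) y by auto
    obtain e \<Psi> where ch: "graph_chart ?\<Gamma> x (R x) (L x) e \<Psi>" using RL x(1) C(1) by blast
    have "\<rho> \<le> R x / 2" unfolding \<rho>_def using C x(1) by (intro Min_le) auto
    then have "ball y \<rho> \<subseteq> ball x (R x)"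
      using x(2) by (auto simp: dist_commute) (smt (verit) dist_triangle dist_commute field_sum_of_halves)
    moreover have "L x \<le> \<Lambda>" using C x by (simp add: \<Lambda>_def)
    ultimately show ?thesis using graph_chart_mono[OF ch] by blast
  qed
  ultimately show ?thesis by blast
qed

text \<open>A solid ball of radius r / (2 \<Lambda>) lies in the sweep of the surface ball: the
  projection moves each of its points by at most r along \<open>e\<close>, onto \<Gamma> and within
  r of \<open>x\<close>. Hence a volume of order r^n is at most r times the surface measure, up to a
  constant.\<close>

lemma graph_chart_lower:
  fixes \<Gamma> :: "'a::euclidean_space set"
  assumes ch: "graph_chart \<Gamma> x \<rho> \<Lambda> e \<Psi>" and r: "0 < r" "r \<le> \<rho>" and L: "1 \<le> \<Lambda>" and x: "x \<in> \<Gamma>"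
    and dim: "2 \<le> DIM('a)"
  shows "ennreal (unit_ball_vol DIM('a) / ((2 * \<Lambda>) ^ DIM('a) * sweep_const DIM('a)) * r ^ (DIM('a) - 1))
    \<le> hausdorff_outer (DIM('a) - 1) (\<Gamma> \<inter> ball x r)"
proof -
  let ?Q = "ball x (r / (2 * \<Lambda>))" and ?n = "DIM('a)"
  have e: "norm e = 1" and lip: "\<And>p q. dist (\<Psi> p) (\<Psi> q) \<le> \<Lambda> * dist p q"
    using ch by (auto simp: graph_chart_def)
  have px: "\<Psi> x = x" using ch x r by (auto simp: graph_chart_def)
  have "?Q \<subseteq> sweep e r (\<Gamma> \<inter> ball x r)"
  proof
    fix q assume "q \<in> ?Q"
    then have q: "\<Lambda> * dist x q < r / 2" using L by (simp add: field_simps)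
    have qr: "dist x q < r / 2" using q L mult_right_mono[OF L, of "dist x q"] by simp
    obtain s where s: "\<Psi> q = q + s *\<^sub>R e" using ch unfolding graph_chart_def by blast
    have "dist x (\<Psi> q) < r / 2" using lip[of x q] px q by simp
    moreover have "dist q (\<Psi> q) = \<bar>s\<bar>" using s e by (simp add: dist_norm)
    ultimately have "\<bar>-s\<bar> \<le> r" using dist_triangle[of q "\<Psi> q" x] qr by (simp add: dist_commute)
    moreover have "\<Psi> q \<in> \<Gamma> \<inter> ball x r"
      using ch qr r \<open>dist x (\<Psi> q) < r / 2\<close> unfolding graph_chart_def by auto
    moreover have "q = \<Psi> q + (-s) *\<^sub>R e" using s by simp
    ultimately show "q \<in> sweep e r (\<Gamma> \<inter> ball x r)" unfolding sweep_def by blast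
  qed
  then have "emeasure lborel ?Q \<le> ennreal (sweep_const ?n * r) * hausdorff_outer (?n - 1) (\<Gamma> \<inter> ball x r)"
    by (intro emeasure_sweep_le[OF e r(1) dim]) auto
  moreover have "emeasure lborel ?Q = ennreal (unit_ball_vol ?n * (r / (2 * \<Lambda>)) ^ ?n)"
    using r L by (simp add: emeasure_ball)
  ultimately have *: "ennreal (unit_ball_vol ?n * (r / (2 * \<Lambda>)) ^ ?n) / ennreal (sweep_const ?n * r)
     \<le> hausdorff_outer (?n - 1) (\<Gamma> \<inter> ball x r)"
    using divide_le_posI_ennreal[of "ennreal (sweep_const ?n * r)"] sweep_const_pos[of ?n] r(1)
    by (simp add: mult.commute)
  have K: "0 < sweep_const ?n * r" using sweep_const_pos r by simp
  have "r ^ ?n = r * r ^ (?n - 1)" using dim by (cases ?n) auto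
  then have "unit_ball_vol ?n * (r / (2 * \<Lambda>)) ^ ?n / (sweep_const ?n * r) =
     unit_ball_vol ?n / ((2 * \<Lambda>) ^ ?n * sweep_const ?n) * r ^ (?n - 1)"
    using r sweep_const_pos[of ?n] L by (simp add: power_divide field_simps)
  then show ?thesis using * K r L by (simp add: divide_ennreal)
qed

text \<open>Packing bounds the cardinality of separated subsets, so a largest one exists; a point
  that it failed to cover could be added to it.\<close>

lemma maximal_separated_exists:
  fixes X :: "'a::euclidean_space set"
  assumes X: "bounded X" and eps: "0 < \<epsilon>"
  shows "\<exists>S. finite S \<and> S \<subseteq> X \<and> (\<forall>a\<in>S. \<forall>b\<in>S. a \<noteq> b \<longrightarrow> \<epsilon> \<le> dist a b) \<and> X \<subseteq> (\<Union>a\<in>S. ball a \<epsilon>)"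
proof -
  obtain R where R: "0 < R" "X \<subseteq> cball 0 R" using bounded_subset_ballD[OF X, of 0] ball_subset_cball by blast
  define P where "P = (\<lambda>S. finite S \<and> S \<subseteq> X \<and> (\<forall>a\<in>S. \<forall>b\<in>S. a \<noteq> b \<longrightarrow> \<epsilon> \<le> dist a b))"
  let ?b = "nat \<lceil>(2 * R + \<epsilon>) ^ DIM('a) / \<epsilon> ^ DIM('a)\<rceil> + 1"
  have bd: "card S < ?b" if "P S" for S
  proof -
    have "real (card S) * \<epsilon> ^ DIM('a) \<le> (2 * R + \<epsilon>) ^ DIM('a)"
      using that R eps by (intro separated_card_le) (auto simp: P_def)
    then have "real (card S) \<le> (2 * R + \<epsilon>) ^ DIM('a) / \<epsilon> ^ DIM('a)"
      using eps by (simp add: field_simps)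
    then show ?thesis by linarith
  qed
  have "P {}" by (simp add: P_def)
  then obtain S where S: "P S" "\<And>T. P T \<Longrightarrow> card T \<le> card S"
    using ex_has_greatest_nat[of P "{}" card ?b] bd by blast
  have "X \<subseteq> (\<Union>a\<in>S. ball a \<epsilon>)"
  proof (rule ccontr)
    assume "\<not> ?thesis"
    then obtain z where z: "z \<in> X" "\<And>a. a \<in> S \<Longrightarrow> \<epsilon> \<le> dist a z" by (force simp: not_less)
    then have "P (insert z S)" using S(1) by (auto simp: P_def dist_commute)
    moreover have "z \<notin> S" using z(2)[of z] eps by auto
    ultimately show False using S(2)[of "insert z S"] S(1) by (simp add: P_def)
  qed
  then show ?thesis using S(1) by (auto simp: P_def)
qed

text \<open>Packing in the full space would only give (r / \<epsilon>)^n. To gain one power, a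
  column of about r / \<eta> points at spacing \<eta> = \<epsilon> / \<Lambda> is erected in
  direction \<open>e\<close> over each point. Different columns stay \<eta> apart because the
  projection collapses each column to its base point and is \<Lambda>-Lipschitz.\<close>

lemma graph_chart_separated_card:
  fixes \<Gamma> :: "'a::euclidean_space set"
  assumes ch: "graph_chart \<Gamma> x \<rho> \<Lambda> e \<Psi>" and r: "0 < r" "r \<le> \<rho>" and L: "1 \<le> \<Lambda>"
    and S: "finite S" "S \<subseteq> \<Gamma> \<inter> ball x r" and sep: "\<forall>a\<in>S. \<forall>b\<in>S. a \<noteq> b \<longrightarrow> \<epsilon> \<le> dist a b"
    and eps: "0 < \<epsilon>" "\<epsilon> \<le> r"
  shows "real (card S) * \<epsilon> ^ (DIM('a) - 1) \<le> 5 ^ DIM('a) * \<Lambda> ^ (DIM('a) - 1) * r ^ (DIM('a) - 1)"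
proof -
  let ?n = "DIM('a)"
  have e: "norm e = 1" and lip: "\<And>p q. dist (\<Psi> p) (\<Psi> q) \<le> \<Lambda> * dist p q"
    using ch by (auto simp: graph_chart_def)
  have pfix: "\<Psi> (p + s *\<^sub>R e) = p" if "p \<in> S" for p s
  proof -
    have "p \<in> \<Gamma> \<inter> ball x \<rho>" using S(2) r(2) that by auto
    then show ?thesis using ch unfolding graph_chart_def by metis
  qed
  define \<eta> where "\<eta> = \<epsilon> / \<Lambda>"
  have eta: "0 < \<eta>" "\<eta> \<le> \<epsilon>" using eps L by (auto simp: \<eta>_def field_simps)
  \<comment> \<open>Columns of height at most \<open>r\<close> remain in
    \<open>cball x (2 * r)\<close>, and (m + 1) \<eta> \<ge> \<open>r\<close> makes them long enough
    for the extra factor.\<close>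
  define m where "m = nat \<lfloor>r / \<eta>\<rfloor>"
  define g where "g = (\<lambda>(p, k::nat). p + (real k * \<eta>) *\<^sub>R e)"
  have m: "real m * \<eta> \<le> r" "r \<le> (real m + 1) * \<eta>"
  proof -
    have "real m \<le> r / \<eta>" "r / \<eta> \<le> real m + 1"
      using divide_pos_pos[OF r(1) eta(1)] unfolding m_def by linarith+
    then show "real m * \<eta> \<le> r" "r \<le> (real m + 1) * \<eta>" using eta by (simp_all add: field_simps)
  qed
  have sepg: "\<eta> \<le> dist (g (p, k)) (g (q, l))" if "p \<in> S" "q \<in> S" "(p, k) \<noteq> (q, l)" for p q k l
  proof (cases "p = q")
    case True
    then have "k \<noteq> l" using that by simp
    then have "1 \<le> \<bar>real k - real l\<bar>" by linarith
    moreover have "dist (g (p, k)) (g (q, l)) = \<bar>real k - real l\<bar> * \<eta>"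
      using True e eta by (simp add: g_def dist_norm abs_mult flip: scaleR_diff_left left_diff_distrib)
    ultimately show ?thesis using eta by (simp add: mult_le_cancel_right1)
  next
    case False
    then have "\<epsilon> \<le> dist p q" using that sep by blast
    also have "\<dots> = dist (\<Psi> (g (p, k))) (\<Psi> (g (q, l)))" using that by (simp add: g_def pfix)
    also have "\<dots> \<le> \<Lambda> * dist (g (p, k)) (g (q, l))" by (rule lip)
    finally show ?thesis using L by (simp add: \<eta>_def field_simps)
  qed
  have inj: "inj_on g (S \<times> {..m})"
  proof (rule inj_onI)
    fix a b assume "a \<in> S \<times> {..m}" "b \<in> S \<times> {..m}" "g a = g b"
    then show "a = b" using sepg[of "fst a" "fst b" "snd a" "snd b"] eta by (cases a; cases b) auto
  qed
  have "real (card (g ` (S \<times> {..m}))) * \<eta> ^ ?n \<le> (2 * (2 * r) + \<eta>) ^ ?n"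
  proof (rule separated_card_le)
    show "g ` (S \<times> {..m}) \<subseteq> cball x (2 * r)"
    proof safe
      fix p k assume "p \<in> S" "k \<le> m"
      then have "dist x p < r" "real k * \<eta> \<le> real m * \<eta>" using S(2) eta by auto
      moreover have "dist p (g (p, k)) = real k * \<eta>" using e eta by (simp add: g_def dist_norm)
      ultimately show "g (p, k) \<in> cball x (2 * r)" using dist_triangle[of x "g (p, k)" p] m by simp
    qed
    show "\<eta> \<le> dist a b" if "a \<in> g ` (S \<times> {..m})" "b \<in> g ` (S \<times> {..m})" "a \<noteq> b" for a b
      using that sepg by (smt (verit) SigmaE imageE)
  qed (use S(1) eta r in \<open>auto\<close>)
  also have "\<dots> \<le> (5 * r) ^ ?n" using eta eps r by (intro power_mono) auto
  finally have "real (card S) * ((real m + 1) * \<eta>) * \<eta> ^ (?n - 1) \<le> (5 * r) ^ ?n"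
    using card_image[OF inj] by (cases ?n) (auto simp: card_cartesian_product algebra_simps)
  moreover have "real (card S) * r * \<eta> ^ (?n - 1) \<le> real (card S) * ((real m + 1) * \<eta>) * \<eta> ^ (?n - 1)"
    using m eta by (intro mult_right_mono mult_left_mono) auto
  ultimately have "real (card S) * r * \<eta> ^ (?n - 1) \<le> r * (5 ^ ?n * r ^ (?n - 1))"
    by (cases ?n) (auto simp: power_mult_distrib algebra_simps)
  then have "real (card S) * \<eta> ^ (?n - 1) \<le> 5 ^ ?n * r ^ (?n - 1)" using r by (simp add: mult.assoc mult.left_commute)
  then have "\<Lambda> ^ (?n - 1) * (real (card S) * \<eta> ^ (?n - 1)) \<le> \<Lambda> ^ (?n - 1) * (5 ^ ?n * r ^ (?n - 1))"
    using L by (intro mult_left_mono) auto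
  then show ?thesis using L by (simp add: \<eta>_def power_divide mult.commute mult.left_commute)
qed

lemma graph_chart_upper:
  fixes \<Gamma> :: "'a::euclidean_space set"
  assumes ch: "graph_chart \<Gamma> x \<rho> \<Lambda> e \<Psi>" and r: "0 < r" "r \<le> \<rho>" and L: "1 \<le> \<Lambda>"
  shows "hausdorff_outer (DIM('a) - 1) (\<Gamma> \<inter> ball x r)
    \<le> ennreal (5 ^ DIM('a) * \<Lambda> ^ (DIM('a) - 1) * unit_ball_vol (DIM('a) - 1) * r ^ (DIM('a) - 1))"
proof (rule hausdorff_outer_le_covers)
  fix \<delta> :: real assume d: "0 < \<delta>"
  let ?d = "DIM('a) - 1"
  \<comment> \<open>The covering balls have diameter 2 \<epsilon>, hence the half of \<delta>; the
    packing bound demands \<epsilon> \<le> \<open>r\<close>.\<close>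
  define \<epsilon> where "\<epsilon> = min (\<delta> / 2) r"
  have eps: "0 < \<epsilon>" "\<epsilon> \<le> r" "2 * \<epsilon> \<le> \<delta>" using d r by (auto simp: \<epsilon>_def)
  obtain S where S: "finite S" "S \<subseteq> \<Gamma> \<inter> ball x r" "\<forall>a\<in>S. \<forall>b\<in>S. a \<noteq> b \<longrightarrow> \<epsilon> \<le> dist a b"
    "\<Gamma> \<inter> ball x r \<subseteq> (\<Union>a\<in>S. ball a \<epsilon>)"
    using maximal_separated_exists[OF bounded_subset[OF bounded_ball Int_lower2] eps(1)] by metis
  note cd = graph_chart_separated_card[OF ch r L S(1-3) eps(1,2)]
  have w: "hausdorff_weight ?d (ball a \<epsilon>) = ennreal (unit_ball_vol ?d * \<epsilon> ^ ?d)" for a :: 'a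
    using eps by (simp add: hausdorff_weight_def)
  have "(\<Sum>U\<in>(\<lambda>a. ball a \<epsilon>) ` S. hausdorff_weight ?d U) \<le> (\<Sum>a\<in>S. hausdorff_weight ?d (ball a \<epsilon>))"
    using sum_image_le[of S "hausdorff_weight ?d" "\<lambda>a. ball a \<epsilon>"] S(1) by (simp add: o_def)
  also have "\<dots> = ennreal (real (card S) * (unit_ball_vol ?d * \<epsilon> ^ ?d))"
    unfolding w using eps by (simp add: ennreal_of_nat_eq_real_of_nat ennreal_mult'[symmetric] del: of_nat_diff)
  also have "\<dots> \<le> ennreal (5 ^ DIM('a) * \<Lambda> ^ ?d * unit_ball_vol ?d * r ^ ?d)"
    using mult_left_mono[OF cd, of "unit_ball_vol ?d"] by (intro ennreal_leI) (simp add: mult_ac)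
  finally show "\<exists>\<C>. finite \<C> \<and> \<Gamma> \<inter> ball x r \<subseteq> \<Union> \<C> \<and> (\<forall>U\<in>\<C>. bounded U \<and> diameter U \<le> \<delta>) \<and>
      (\<Sum>U\<in>\<C>. hausdorff_weight ?d U) \<le> ennreal (5 ^ DIM('a) * \<Lambda> ^ ?d * unit_ball_vol ?d * r ^ ?d)"
    using S(1,4) eps by (intro exI[of _ "(\<lambda>a. ball a \<epsilon>) ` S"]) (auto simp: )
qed

section \<open>From the outer measure to the measure; volume growth at all scales\<close>

lemma sets_hausdorff_measure [simp]: "sets (hausdorff_measure d :: 'a::metric_space measure) = sets borel"
  using sets.sigma_sets_eq[of "borel :: 'a measure"] by (simp add: hausdorff_measure_def sets_measure_of_conv)

lemma space_hausdorff_measure [simp]: "space (hausdorff_measure d) = UNIV"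
  by (simp add: hausdorff_measure_def space_measure_of_conv)

lemma emeasure_hausdorff_measure:
  assumes "measure_space (UNIV :: 'a::metric_space set) (sets borel) (hausdorff_outer d)" "A \<in> sets borel"
  shows "emeasure (hausdorff_measure d) (A :: 'a set) = hausdorff_outer d A"
  unfolding hausdorff_measure_def
proof (rule emeasure_measure_of_sigma)
  show "sigma_algebra UNIV (sets (borel :: 'a measure))" using sets.sigma_algebra_axioms[of "borel :: 'a measure"] by simp
qed (use assms in \<open>auto simp: measure_space_def\<close>)

text \<open>\<open>measure_of\<close> falls back on the zero measure when its argument is not
  countably additive.\<close>

lemma hausdorff_measure_degenerate:
  assumes "\<not> measure_space (UNIV :: 'a::metric_space set) (sets borel) (hausdorff_outer d)"
  shows "emeasure (hausdorff_measure d) (A :: 'a set) = 0"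
  using assms sets.sigma_sets_eq[of "borel :: 'a measure"]
  by (simp add: hausdorff_measure_def emeasure_measure_of_conv)

lemma hausdorff_outer_mono: "A \<subseteq> B \<Longrightarrow> hausdorff_outer d A \<le> hausdorff_outer d B"
  unfolding hausdorff_outer_def
  by (intro SUP_mono bexI INF_superset_mono) (auto simp: subset_iff)

lemma ahlfors_upper:
  fixes \<Gamma> :: "'a::euclidean_space set"
  assumes ms: "measure_space (UNIV :: 'a set) (sets borel) (hausdorff_outer (DIM('a) - 1))"
    and \<Gamma>: "compact \<Gamma>" and \<rho>: "0 < \<rho>" and L: "1 \<le> \<Lambda>"
    and ch: "\<And>x. x \<in> \<Gamma> \<Longrightarrow> \<exists>e \<Psi>. graph_chart \<Gamma> x \<rho> \<Lambda> e \<Psi>"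
  shows "\<exists>A>0. \<forall>x\<in>\<Gamma>. \<forall>r>0. emeasure (hausdorff_measure (DIM('a) - 1)) (\<Gamma> \<inter> ball x r) \<le> ennreal (A * r ^ (DIM('a) - 1))"
proof -
  let ?d = "DIM('a) - 1"
  let ?H = "hausdorff_measure ?d :: 'a measure"
  define B where "B = 5 ^ DIM('a) * \<Lambda> ^ ?d * unit_ball_vol ?d"
  have B0: "0 < B" using L by (simp add: B_def del: of_nat_diff)
  have bor [measurable]: "\<Gamma> \<in> sets borel" using \<Gamma> by (simp add: borel_closed compact_imp_closed)
  have small: "emeasure ?H (\<Gamma> \<inter> ball x r) \<le> ennreal (B * r ^ ?d)" if x: "x \<in> \<Gamma>" and r: "0 < r" "r \<le> \<rho>" for x r
  proof -
    obtain e \<Psi> where "graph_chart \<Gamma> x \<rho> \<Lambda> e \<Psi>" using ch x by blast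
    from graph_chart_upper[OF this r L] show ?thesis
      by (subst emeasure_hausdorff_measure[OF ms]) (simp_all add: B_def del: of_nat_diff)
  qed
  obtain C where C: "C \<subseteq> \<Gamma>" "finite C" "\<Gamma> \<subseteq> (\<Union>x\<in>C. ball x \<rho>)"
    by (rule compactE_image[OF \<Gamma>, of \<Gamma> "\<lambda>x. ball x \<rho>"]) (use \<rho> in auto)
  have total: "emeasure ?H \<Gamma> \<le> ennreal (real (card C) * (B * \<rho> ^ ?d))"
  proof -
    have "emeasure ?H \<Gamma> \<le> emeasure ?H (\<Union>x\<in>C. \<Gamma> \<inter> ball x \<rho>)"
      using C by (intro emeasure_mono) (auto intro!: sets.finite_UN sets.Int[OF bor] simp del: UN_simps)
    also have "\<dots> \<le> (\<Sum>x\<in>C. emeasure ?H (\<Gamma> \<inter> ball x \<rho>))"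
      using C by (intro emeasure_subadditive_finite) (auto intro!: sets.Int[OF bor])
    also have "\<dots> \<le> (\<Sum>x\<in>C. ennreal (B * \<rho> ^ ?d))"
      using C small \<rho> by (intro sum_mono) auto
    also have "\<dots> = ennreal (real (card C) * (B * \<rho> ^ ?d))"
      using B0 \<rho> by (simp add: ennreal_of_nat_eq_real_of_nat ennreal_mult'[symmetric])
    finally show ?thesis .
  qed
  \<comment> \<open>The summand 1 serves radii up to \<rho>, where a single chart suffices. Beyond
    \<rho> the total mass, bounded by \<open>card C\<close> charts, is below the claimed
    bound.\<close>
  define A where "A = (real (card C) + 1) * B"
  have "emeasure ?H (\<Gamma> \<inter> ball x r) \<le> ennreal (A * r ^ ?d)" if x: "x \<in> \<Gamma>" and r: "0 < r" for x r
  proof (cases "r \<le> \<rho>")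
    case True
    note small[OF x r True]
    also have "ennreal (B * r ^ ?d) \<le> ennreal (A * r ^ ?d)"
      using B0 r by (intro ennreal_leI mult_right_mono) (auto simp: A_def)
    finally show ?thesis .
  next
    case False
    have "emeasure ?H (\<Gamma> \<inter> ball x r) \<le> emeasure ?H \<Gamma>" by (intro emeasure_mono) auto
    also note total
    also have "ennreal (real (card C) * (B * \<rho> ^ ?d)) \<le> ennreal (A * r ^ ?d)"
    proof (rule ennreal_leI)
      have "\<rho> ^ ?d \<le> r ^ ?d" using False \<rho> by (intro power_mono) auto
      then have "real (card C) * B * \<rho> ^ ?d \<le> A * r ^ ?d"
        using B0 \<rho> by (intro mult_mono) (auto simp: A_def algebra_simps)
      then show "real (card C) * (B * \<rho> ^ ?d) \<le> A * r ^ ?d" by (simp add: mult.assoc)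
    qed
    finally show ?thesis .
  qed
  moreover have "0 < A" using B0 by (simp add: A_def add_nonneg_pos)
  ultimately show ?thesis by blast
qed

text \<open>The factor \<open>q\<close> shrinks all radii up to \<open>R\<close> to chart radii, at
  the cost of q^(n-1). The outer measure is used because positivity of surface balls is wanted even
  before it is known to be a measure on the Borel sets.\<close>

lemma ahlfors_lower:
  fixes \<Gamma> :: "'a::euclidean_space set"
  assumes dim: "2 \<le> DIM('a)" and \<rho>: "0 < \<rho>" and L: "1 \<le> \<Lambda>"
    and ch: "\<And>x. x \<in> \<Gamma> \<Longrightarrow> \<exists>e \<Psi>. graph_chart \<Gamma> x \<rho> \<Lambda> e \<Psi>"
  shows "\<exists>c>0. \<forall>x\<in>\<Gamma>. \<forall>r. 0 < r \<longrightarrow> r \<le> R \<longrightarrow>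
    ennreal (c * r ^ (DIM('a) - 1)) \<le> hausdorff_outer (DIM('a) - 1) (\<Gamma> \<inter> ball x r)"
proof -
  let ?d = "DIM('a) - 1"
  define b where "b = unit_ball_vol DIM('a) / ((2 * \<Lambda>) ^ DIM('a) * sweep_const DIM('a))"
  define q where "q = \<rho> / (\<rho> + \<bar>R\<bar>)"
  have b: "0 < b" using L sweep_const_pos[of "DIM('a)"] by (simp add: b_def)
  have q: "0 < q" "q \<le> 1" using \<rho> by (auto simp: q_def)
  have "ennreal (b * q ^ ?d * r ^ ?d) \<le> hausdorff_outer ?d (\<Gamma> \<inter> ball x r)" if x: "x \<in> \<Gamma>" and r: "0 < r" "r \<le> R" for x r
  proof -
    have "q * r \<le> q * (\<rho> + \<bar>R\<bar>)" using q r \<rho> by (intro mult_left_mono) auto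
    then have qr: "0 < q * r" "q * r \<le> \<rho>" using q r \<rho> by (auto simp: q_def)
    obtain e \<Psi> where "graph_chart \<Gamma> x \<rho> \<Lambda> e \<Psi>" using ch x by blast
    from graph_chart_lower[OF this qr L x dim]
    have "ennreal (b * (q * r) ^ ?d) \<le> hausdorff_outer ?d (\<Gamma> \<inter> ball x (q * r))" by (simp add: b_def)
    also have "\<dots> \<le> hausdorff_outer ?d (\<Gamma> \<inter> ball x r)"
    proof (rule hausdorff_outer_mono)
      have "q * r \<le> r" using q r by (simp add: mult_left_le_one_le)
      then show "\<Gamma> \<inter> ball x (q * r) \<subseteq> \<Gamma> \<inter> ball x r" by auto
    qed
    finally show ?thesis by (simp add: power_mult_distrib mult.assoc)
  qed
  moreover have "0 < b * q ^ ?d" using b q by simp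
  ultimately show ?thesis by blast
qed

section \<open>Null sets: points, Lipschitz curves and proper faces\<close>

lemma hausdorff_outer_singleton:
  assumes "0 < d" shows "hausdorff_outer d {x} = 0"
proof -
  have "hausdorff_outer d {x} \<le> 0"
    using assms by (intro hausdorff_outer_le_covers exI[of _ "{{x}}"]) (auto simp: hausdorff_weight_def)
  then show ?thesis by simp
qed

lemma hausdorff_outer_curve:
  fixes g :: "real \<Rightarrow> 'a::real_normed_vector"
  assumes M: "\<And>s t. s \<in> {0..1} \<Longrightarrow> t \<in> {0..1} \<Longrightarrow> dist (g s) (g t) \<le> M * \<bar>s - t\<bar>" and M0: "0 < M" and d: "2 \<le> d"
  shows "hausdorff_outer d (g ` {0..1}) = 0"
proof -
  have *: "hausdorff_outer d (g ` {0..1}) \<le> 0 + ennreal \<epsilon>" if eps: "0 < \<epsilon>" for \<epsilon>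
  proof (simp, rule hausdorff_outer_le_covers)
    fix \<delta> :: real assume \<delta>: "0 < \<delta>"
    let ?w = "unit_ball_vol (real d)"
    \<comment> \<open>N pieces of diameter at most M / N have total weight of order M^2 / N. The
      lower bounds on N keep diameters below \<delta>, ensure M / N \<le> 1 so that the exponent d
      may be lowered to 2, and push the sum below \<epsilon>.\<close>
    define N where "N = nat \<lceil>max (max (M / \<delta>) M) (?w * M\<^sup>2 / \<epsilon>)\<rceil> + 1"
    have N: "M / \<delta> \<le> N" "M \<le> N" "?w * M\<^sup>2 / \<epsilon> \<le> N" "0 < N" unfolding N_def by linarith+
    define I where "I i = {real i / N..real (Suc i) / N} \<inter> {0..1}" for i
    have cov: "{0..1} \<subseteq> (\<Union>i<N. I i)"
    proof
      fix t :: real assume t: "t \<in> {0..1}"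
      show "t \<in> (\<Union>i<N. I i)"
      proof (cases "t = 1")
        case True
        then show ?thesis using N(4) by (intro UN_I[of "N - 1"]) (auto simp: I_def field_simps of_nat_diff)
      next
        case False
        define i where "i = nat \<lfloor>t * N\<rfloor>"
        have i: "real i \<le> t * N" "t * N \<le> real (Suc i)" using t unfolding i_def
          by (auto simp: of_nat_nat) linarith
        have "t * real N < 1 * real N" using t False N(4) by (intro mult_strict_right_mono) auto
        then have "i < N" using i(1) by linarith
        then show ?thesis using i t N(4) by (intro UN_I[of i]) (auto simp: I_def field_simps)
      qed
    qed
    have dst: "dist (g s) (g t) \<le> M / N" if "s \<in> I i" "t \<in> I i" for s t i
    proof -
      have "real (Suc i) / N = real i / N + 1 / N" by (simp add: add_divide_distrib)
      then have "\<bar>s - t\<bar> \<le> 1 / N" using that unfolding I_def by auto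
      then have "M * \<bar>s - t\<bar> \<le> M * (1 / N)" using M0 by (intro mult_left_mono) auto
      moreover have "dist (g s) (g t) \<le> M * \<bar>s - t\<bar>" using that unfolding I_def by (blast intro: M)
      ultimately show ?thesis by simp
    qed
    have bd: "bounded (g ` I i)" for i
      using dst[where i=i] unfolding bounded_two_points by (metis imageE)
    have dm: "diameter (g ` I i) \<le> M / N" for i
      using dst[where i=i] M0 by (intro diameter_le) (auto simp: dist_norm)
    have w: "hausdorff_weight d (g ` I i) \<le> ennreal (?w * (M / N)\<^sup>2)" for i
    proof -
      have "(diameter (g ` I i) / 2) ^ d \<le> (M / N) ^ d"
      proof (rule power_mono)
        show "diameter (g ` I i) / 2 \<le> M / N" using dm[of i] diameter_ge_0[OF bd[of i]] by linarith
      qed (use diameter_ge_0[OF bd[of i]] in simp)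
      also have "\<dots> \<le> (M / N)\<^sup>2" using d N(2) M0 N(4) by (intro power_decreasing) auto
      finally show ?thesis
        by (auto simp: hausdorff_weight_def intro!: ennreal_leI mult_left_mono)
    qed
    have "(\<Sum>U\<in>(\<lambda>i. g ` I i) ` {..<N}. hausdorff_weight d U) \<le> (\<Sum>i<N. hausdorff_weight d (g ` I i))"
      using sum_image_le[of "{..<N}" "hausdorff_weight d" "\<lambda>i. g ` I i"] by (simp add: o_def)
    also have "\<dots> \<le> (\<Sum>i<N. ennreal (?w * (M / N)\<^sup>2))" by (intro sum_mono w)
    also have "\<dots> = ennreal (real N * (?w * (M / N)\<^sup>2))"
      by (simp add: ennreal_of_nat_eq_real_of_nat ennreal_mult'[symmetric])
    also have "\<dots> \<le> ennreal \<epsilon>"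
      using N(3,4) eps by (intro ennreal_leI) (simp add: power2_eq_square field_simps)
    finally have S: "(\<Sum>U\<in>(\<lambda>i. g ` I i) ` {..<N}. hausdorff_weight d U) \<le> ennreal \<epsilon>" .
    have "M / N \<le> \<delta>" using N(1,4) \<delta> by (simp add: field_simps)
    then have "\<forall>U\<in>(\<lambda>i. g ` I i) ` {..<N}. bounded U \<and> diameter U \<le> \<delta>"
      using bd order_trans[OF dm] by auto
    moreover have "g ` {0..1} \<subseteq> \<Union> ((\<lambda>i. g ` I i) ` {..<N})" using cov by blast
    ultimately show "\<exists>\<C>. finite \<C> \<and> g ` {0..1} \<subseteq> \<Union> \<C> \<and> (\<forall>U\<in>\<C>. bounded U \<and> diameter U \<le> \<delta>) \<and>
        (\<Sum>U\<in>\<C>. hausdorff_weight d U) \<le> ennreal \<epsilon>"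
      using S by (intro exI[of _ "(\<lambda>i. g ` I i) ` {..<N}"]) auto
  qed
  have "hausdorff_outer d (g ` {0..1}) \<le> 0" by (rule ennreal_le_epsilon) (rule *)
  then show ?thesis by simp
qed

lemma C1_embedding_lipschitz:
  fixes P :: "'a::euclidean_space set"
  assumes "C1_embedding_on P G" "compact P" "convex P"
  shows "\<exists>M>0. \<forall>x\<in>P. \<forall>y\<in>P. dist (G x) (G y) \<le> M * dist x y"
proof -
  obtain U and DF :: "'a \<Rightarrow> 'a \<Rightarrow>\<^sub>L 'a" where U: "P \<subseteq> U" "continuous_on U DF"
    "\<And>x. x \<in> U \<Longrightarrow> (G has_derivative blinfun_apply (DF x)) (at x)"
    using assms(1) unfolding C1_embedding_on_def by blast
  have "compact (DF ` P)"
    using U(1,2) assms(2) by (intro compact_continuous_image continuous_on_subset[OF U(2)])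
  then obtain M where M: "0 < M" "\<And>x. x \<in> P \<Longrightarrow> norm (DF x) \<le> M"
    using compact_imp_bounded bounded_pos by (metis image_eqI)
  have "dist (G x) (G y) \<le> M * dist x y" if "x \<in> P" "y \<in> P" for x y
    unfolding dist_norm
  proof (rule differentiable_bound[OF assms(3) _ _ that])
    fix x assume x: "x \<in> P"
    show "(G has_derivative blinfun_apply (DF x)) (at x within P)"
      using U x by (blast intro: has_derivative_at_withinI)
    show "onorm (blinfun_apply (DF x)) \<le> M" using M(2)[OF x] by (simp add: norm_blinfun.rep_eq)
  qed
  then show ?thesis using M(1) by blast
qed

lemma not_affine_dependent_Basis: "\<not> affine_dependent (Basis :: 'a::euclidean_space set)"
  using affine_dependent_imp_dependent independent_Basis by blast

lemma compact_ref_simplex: "compact (ref_simplex :: 'a::euclidean_space set)"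
  by (simp add: ref_simplex_def finite_imp_compact compact_convex_hull)

lemma convex_ref_simplex: "convex (ref_simplex :: 'a::euclidean_space set)"
  by (simp add: ref_simplex_def)

text \<open>A proper face is the hull of a proper subset of \<open>Basis\<close>. In dimensions 2
  and 3 that leaves the empty set, a vertex, or, in dimension 3, an edge, whose image is a Lipschitz
  curve in a two-dimensional measure.\<close>

lemma hausdorff_outer_face:
  fixes G :: "'a::euclidean_space \<Rightarrow> 'a"
  assumes dim: "DIM('a) = 2 \<or> DIM('a) = 3" and G: "C1_embedding_on ref_simplex G"
    and f: "f face_of ref_simplex" "f \<noteq> ref_simplex"
  shows "hausdorff_outer (DIM('a) - 1) (G ` f) = 0"
proof -
  let ?d = "DIM('a) - 1"
  obtain M where M: "M > 0" "\<And>x y. x \<in> ref_simplex \<Longrightarrow> y \<in> ref_simplex \<Longrightarrow> dist (G x) (G y) \<le> M * dist x y"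
    using C1_embedding_lipschitz[OF G compact_ref_simplex convex_ref_simplex] by blast
  obtain c where c: "c \<subseteq> Basis" "f = convex hull c"
    using f(1) face_of_convex_hull_affine_independent[OF not_affine_dependent_Basis] unfolding ref_simplex_def by blast
  have "c \<noteq> Basis" using c f(2) by (auto simp: ref_simplex_def)
  then have card: "card c < DIM('a)" using c(1) by (simp add: psubsetI psubset_card_mono)
  have fin: "finite c" using c(1) finite_Basis finite_subset by blast
  have fr: "f \<subseteq> ref_simplex" using f(1) by (rule face_of_imp_subset)
  consider "c = {}" | a where "c = {a}" | a b where "c = {a, b}" "a \<noteq> b" "DIM('a) = 3"
  proof -
    have "card c = 0 \<or> card c = 1 \<or> card c = 2 \<and> DIM('a) = 3" using card dim by auto
    then show ?thesis using that fin by (auto simp: card_1_singleton_iff card_2_iff)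
  qed
  then show ?thesis
  proof cases
    case 1
    then have "hausdorff_outer ?d (G ` f) \<le> hausdorff_outer ?d {undefined :: 'a}"
      by (intro hausdorff_outer_mono) (auto simp: c)
    then show ?thesis using hausdorff_outer_singleton[of ?d "undefined :: 'a"] dim by auto
  next
    case (2 a)
    then show ?thesis using hausdorff_outer_singleton[of ?d] dim by (auto simp: c)
  next
    case (3 a b)
    define g where "g = (\<lambda>t. G ((1 - t) *\<^sub>R a + t *\<^sub>R b))"
    have fs: "f = (\<lambda>t. (1 - t) *\<^sub>R a + t *\<^sub>R b) ` {0..1}"
      using 3 c(2) by (auto simp: segment_convex_hull[symmetric] closed_segment_image_interval)
    have eq: "G ` f = g ` {0..1}" unfolding fs g_def by (simp add: image_image)
    have "hausdorff_outer ?d (g ` {0..1}) = 0"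
    proof (rule hausdorff_outer_curve)
      show "0 < M * dist a b" using M 3 by simp
      show "2 \<le> ?d" using 3 by simp
      fix s t :: real assume st: "s \<in> {0..1}" "t \<in> {0..1}"
      have "((1 - s) *\<^sub>R a + s *\<^sub>R b) - ((1 - t) *\<^sub>R a + t *\<^sub>R b) = (s - t) *\<^sub>R (b - a)"
        by (simp add: algebra_simps)
      then have "dist ((1 - s) *\<^sub>R a + s *\<^sub>R b) ((1 - t) *\<^sub>R a + t *\<^sub>R b) = dist a b * \<bar>s - t\<bar>"
        by (simp add: dist_norm norm_minus_commute)
      moreover have "dist (g s) (g t) \<le> M * dist ((1 - s) *\<^sub>R a + s *\<^sub>R b) ((1 - t) *\<^sub>R a + t *\<^sub>R b)"
        unfolding g_def
      proof (rule M)
        show "(1 - s) *\<^sub>R a + s *\<^sub>R b \<in> ref_simplex" "(1 - t) *\<^sub>R a + t *\<^sub>R b \<in> ref_simplex"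
          using fs fr imageI[OF st(1)] imageI[OF st(2)] by (metis (mono_tags, lifting) subsetD)+
      qed
      ultimately show "dist (g s) (g t) \<le> M * dist a b * \<bar>s - t\<bar>" by simp
    qed
    then show ?thesis by (simp add: eq)
  qed
qed

section \<open>Meshes\<close>

text \<open>Vertices are extreme points, and dimension at least 2 excludes the one-point simplex,
  whose relative frontier is empty. Patches are defined by element boundaries, so this is what puts
  each element with vertex y into the patch of y.\<close>

lemma Basis_subset_rel_frontier:
  assumes "2 \<le> DIM('a::euclidean_space)"
  shows "(Basis :: 'a set) \<subseteq> rel_frontier ref_simplex"
proof
  fix b :: 'a assume b: "b \<in> Basis"
  have "{b} face_of ref_simplex"
    using extreme_point_of_convex_hull_affine_independent[OF not_affine_dependent_Basis, of b] b
    by (simp add: ref_simplex_def face_of_singleton)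
  moreover have "{b} \<noteq> ref_simplex"
  proof
    assume "{b} = ref_simplex"
    then have "(Basis :: 'a set) \<subseteq> {b}" unfolding ref_simplex_def using hull_subset[of Basis convex] by blast
    then have "DIM('a) \<le> 1" using card_mono[of "{b}" Basis] by simp
    then show False using assms by simp
  qed
  ultimately show "b \<in> rel_frontier ref_simplex" using face_of_subset_rel_frontier by blast
qed

text \<open>Of the measure only \<open>pos\<close> is assumed, for the outer measure: together with
  null intersections it separates inscribed balls. The locale is thereby available also in the
  degenerate case of the final proof.\<close>

locale regular_mesh =
  fixes \<Gamma> :: "'a::euclidean_space set" and \<kappa> \<sigma> K h :: real and Th F
  assumes dim: "DIM('a) = 2 \<or> DIM('a) = 3"
    and compact: "compact \<Gamma>" and nonempty: "\<Gamma> \<noteq> {}"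
    and geo: "\<And>x y. x \<in> \<Gamma> \<Longrightarrow> y \<in> \<Gamma> \<Longrightarrow> geodesic_dist \<Gamma> x y \<le> ennreal (K * dist x y)"
    and K: "1 \<le> K" and h: "0 < h"
    and pos: "\<And>x r. x \<in> \<Gamma> \<Longrightarrow> 0 < r \<Longrightarrow> 0 < hausdorff_outer (DIM('a) - 1) (\<Gamma> \<inter> ball x r)"
    and mesh: "surface_mesh \<Gamma> Th F" and qu: "quasi_uniform \<kappa> h Th" and sr: "shape_regular \<sigma> \<Gamma> Th"
begin

lemma finite_Th: "finite Th" and Union_Th: "\<Union>Th = \<Gamma>"
  and element: "T \<in> Th \<Longrightarrow> C1_embedding_on ref_simplex (F T)" "T \<in> Th \<Longrightarrow> T = F T ` ref_simplex"
  using mesh by (auto simp: surface_mesh_def)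

lemma conforming:
  assumes "T \<in> Th" "T' \<in> Th" "T \<noteq> T'"
  shows "\<exists>f f'. f face_of ref_simplex \<and> f' face_of ref_simplex \<and> T \<inter> T' = F T ` f \<and> T \<inter> T' = F T' ` f'"
  using mesh[unfolded surface_mesh_def, THEN conjunct2, THEN conjunct2, THEN conjunct2, rule_format, OF assms] .

lemma compact_element: assumes "T \<in> Th" shows "compact T"
proof -
  obtain M where M: "M > 0" "\<forall>x\<in>ref_simplex. \<forall>y\<in>ref_simplex. dist (F T x) (F T y) \<le> M * dist x y"
    using C1_embedding_lipschitz[OF element(1)[OF assms] compact_ref_simplex convex_ref_simplex] by blast
  then have "continuous_on ref_simplex (F T)"
    by (intro lipschitz_on_continuous_on[of M]) (simp add: lipschitz_on_def)
  then show ?thesis using compact_continuous_image compact_ref_simplex element(2)[OF assms] by metis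
qed

text \<open>The mesh conditions carry no sign conditions on \<kappa> and \<sigma>; a single element
  forces both to be positive.\<close>

lemma diam_pos: assumes "T \<in> Th" shows "0 < diameter T" "0 < \<kappa>" "0 < \<sigma>"
proof -
  have d: "0 \<le> diameter T" using compact_element[OF assms] by (simp add: compact_imp_bounded diameter_ge_0)
  have "0 < \<kappa> * diameter T" using qu assms h by (auto simp: quasi_uniform_def)
  then show *: "0 < diameter T" "0 < \<kappa>" using d by (auto simp: zero_less_mult_iff)
  obtain r where "r > 0" "diameter T \<le> \<sigma> * (2 * r)" using sr assms unfolding shape_regular_def by meson
  then show "0 < \<sigma>" using * by (smt (verit) mult_nonpos_nonneg)
qed

lemma mesh_size_le: "h \<le> \<kappa> * diameter \<Gamma>" and kappa_pos: "0 < \<kappa>" and sigma_pos: "0 < \<sigma>"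
proof -
  obtain T where T: "T \<in> Th" using nonempty Union_Th by blast
  show k: "0 < \<kappa>" "0 < \<sigma>" using diam_pos[OF T] by auto
  have "diameter T \<le> diameter \<Gamma>" using T Union_Th compact by (intro diameter_subset compact_imp_bounded) auto
  then have "\<kappa> * diameter T \<le> \<kappa> * diameter \<Gamma>" using k by simp
  then show "h \<le> \<kappa> * diameter \<Gamma>" using qu T unfolding quasi_uniform_def by force
qed

text \<open>An inscribed ball of geodesic radius r satisfies h \<le> \<kappa>
  \<open>diameter T\<close> \<le> 2 \<kappa> \<sigma> r, and division by \<open>K\<close> passes
  from geodesic to Euclidean balls. Thus \<open>rad * h\<close> is a Euclidean inscribed radius
  common to all elements.\<close>

definition rad :: real where "rad = 1 / (2 * \<sigma> * \<kappa> * K)"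

lemma rad_pos: "0 < rad"
  using kappa_pos sigma_pos K by (simp add: rad_def)

lemma inscribed_ball: assumes T: "T \<in> Th" shows "\<exists>x\<in>T. \<Gamma> \<inter> ball x (rad * h) \<subseteq> T"
proof -
  obtain x r where x: "x \<in> T" and r: "r > 0" "geodesic_ball \<Gamma> x r \<subseteq> T" "diameter T \<le> \<sigma> * (2 * r)"
    using sr T unfolding shape_regular_def by meson
  have "h \<le> \<kappa> * diameter T" using qu T by (simp add: quasi_uniform_def)
  also have "\<dots> \<le> \<kappa> * (\<sigma> * (2 * r))" using r(3) kappa_pos by simp
  finally have "rad * h \<le> r / K" using kappa_pos sigma_pos K by (simp add: rad_def field_simps)
  have "\<Gamma> \<inter> ball x (rad * h) \<subseteq> geodesic_ball \<Gamma> x r"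
  proof
    fix y assume y: "y \<in> \<Gamma> \<inter> ball x (rad * h)"
    then have "dist x y < r / K" using \<open>rad * h \<le> r / K\<close> by auto
    then have "K * dist x y < r" using K by (simp add: field_simps)
    moreover have "geodesic_dist \<Gamma> x y \<le> ennreal (K * dist x y)" using y x T Union_Th by (intro geo) auto
    ultimately show "y \<in> geodesic_ball \<Gamma> x r" using y K r(1)
      by (auto simp: geodesic_ball_def intro: order_le_less_trans ennreal_lessI)
  qed
  then show ?thesis using x r(2) by blast
qed

text \<open>The intersection is the image of a face in either parametrisation, and both faces can be
  the whole simplex only if the elements coincide.\<close>

lemma null_intersection:
  assumes T: "T \<in> Th" "T' \<in> Th" "T \<noteq> T'" shows "hausdorff_outer (DIM('a) - 1) (T \<inter> T') = 0"
proof -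
  obtain f f' where f: "f face_of ref_simplex" "f' face_of ref_simplex" "T \<inter> T' = F T ` f" "T \<inter> T' = F T' ` f'"
    using conforming[OF T] by blast
  have "T \<inter> T' \<noteq> T \<or> T \<inter> T' \<noteq> T'" using T(3) by blast
  then consider "f \<noteq> ref_simplex" | "f' \<noteq> ref_simplex"
    using f(3,4) element(2)[OF T(1)] element(2)[OF T(2)] by fastforce
  then show ?thesis
  proof cases
    case 1
    show ?thesis unfolding f(3) by (rule hausdorff_outer_face[OF dim element(1)[OF T(1)] f(1) 1])
  next
    case 2
    show ?thesis unfolding f(4) by (rule hausdorff_outer_face[OF dim element(1)[OF T(2)] f(2) 2])
  qed
qed

text \<open>The bound of \<open>separated_card_le\<close> for points in a ball of radius (R +
  \<kappa>) h at mutual distance \<open>rad * h\<close>, with \<open>h\<close> cancelled.\<close>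

definition overlap :: "real \<Rightarrow> real" where
  "overlap R = (2 * (R + \<kappa>) + rad) ^ DIM('a) / rad ^ DIM('a)"

text \<open>The centres of the inscribed balls are \<open>rad * h\<close> apart: two closer ones
  would leave a surface ball inside both elements, against \<open>pos\<close> and
  \<open>null_intersection\<close>. Each centre is within \<kappa> h of any point of its element, so
  packing applies.\<close>

lemma elements_near:
  assumes R: "0 \<le> R"
  shows "real (card {T\<in>Th. T \<inter> cball z (R * h) \<noteq> {}}) \<le> overlap R"
proof -
  let ?E = "{T\<in>Th. T \<inter> cball z (R * h) \<noteq> {}}"
  obtain x where x: "\<And>T. T \<in> Th \<Longrightarrow> x T \<in> T" "\<And>T. T \<in> Th \<Longrightarrow> \<Gamma> \<inter> ball (x T) (rad * h) \<subseteq> T"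
    using inscribed_ball by metis
  have rh: "0 < rad * h" using rad_pos h by simp
  have sep: "rad * h \<le> dist (x T) (x T')" if T: "T \<in> Th" "T' \<in> Th" "T \<noteq> T'" for T T'
  proof (rule ccontr)
    assume "\<not> ?thesis"
    then have lt: "0 < rad * h - dist (x T) (x T')" by simp
    let ?r = "rad * h - dist (x T) (x T')"
    have "\<Gamma> \<inter> ball (x T') ?r \<subseteq> \<Gamma> \<inter> ball (x T) (rad * h)"
    proof
      fix w assume "w \<in> \<Gamma> \<inter> ball (x T') ?r"
      then show "w \<in> \<Gamma> \<inter> ball (x T) (rad * h)" using dist_triangle[of "x T" w "x T'"] by auto
    qed
    moreover have "\<Gamma> \<inter> ball (x T') ?r \<subseteq> \<Gamma> \<inter> ball (x T') (rad * h)"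
      by (intro Int_mono subset_ball) auto
    ultimately have "\<Gamma> \<inter> ball (x T') ?r \<subseteq> T \<inter> T'" using x(2) T by blast
    then have "hausdorff_outer (DIM('a) - 1) (\<Gamma> \<inter> ball (x T') ?r) \<le> 0"
      using hausdorff_outer_mono null_intersection[OF T] by metis
    moreover have "x T' \<in> \<Gamma>" using x(1) T Union_Th by blast
    ultimately show False using pos[OF _ lt] by (metis not_le)
  qed
  have inj: "inj_on x ?E" using sep rh by (intro inj_onI) (metis (mono_tags, lifting) dist_self mem_Collect_eq not_le)
  have "real (card (x ` ?E)) * (rad * h) ^ DIM('a) \<le> (2 * ((R + \<kappa>) * h) + rad * h) ^ DIM('a)"
  proof (rule separated_card_le)
    show "x ` ?E \<subseteq> cball z ((R + \<kappa>) * h)"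
    proof (rule image_subsetI)
      fix T assume "T \<in> ?E"
      then obtain w where T: "T \<in> Th" and w: "w \<in> T" "w \<in> cball z (R * h)" by blast
      have "dist w (x T) \<le> diameter T" using T w x(1) compact_element by (intro diameter_bounded_bound compact_imp_bounded) auto
      also have "\<dots> \<le> \<kappa> * h" using qu T by (simp add: quasi_uniform_def)
      finally show "x T \<in> cball z ((R + \<kappa>) * h)"
        using w dist_triangle[of z "x T" w] by (simp add: algebra_simps)
    qed
    show "finite (x ` ?E)" using finite_Th by simp
    show "rad * h \<le> dist a b" if "a \<in> x ` ?E" "b \<in> x ` ?E" "a \<noteq> b" for a b
      using that sep by blast
  qed (use rh kappa_pos h R in auto)
  also have "\<dots> = (2 * (R + \<kappa>) + rad) ^ DIM('a) * h ^ DIM('a)"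
    by (simp add: power_mult_distrib[symmetric] algebra_simps)
  finally have "real (card ?E) * rad ^ DIM('a) \<le> (2 * (R + \<kappa>) + rad) ^ DIM('a)"
    using h by (simp add: card_image[OF inj] power_mult_distrib mult.assoc[symmetric])
  then show ?thesis using rad_pos by (simp add: overlap_def field_simps)
qed

lemma finite_nodes: "finite (mesh_nodes Th F)"
  using finite_Th by (simp add: mesh_nodes_def)

lemma element_boundary_subset: "T \<in> Th \<Longrightarrow> element_boundary F T \<subseteq> T"
  using element(2)[of T] closure_closed[OF compact_imp_closed[OF compact_ref_simplex]]
  unfolding element_boundary_def rel_frontier_def by (metis Diff_subset image_mono)

text \<open>An element of the patch of y that contains z has y within \<kappa> h of z. Such nodes
  are therefore vertices of the elements counted by \<open>elements_near\<close>, and each element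
  has \<open>DIM('a)\<close> vertices.\<close>

lemma patch_overlap:
  "real (card {y\<in>mesh_nodes Th F. z \<in> node_patch Th F y}) \<le> real DIM('a) * overlap \<kappa>"
proof -
  let ?E = "{T\<in>Th. T \<inter> cball z (\<kappa> * h) \<noteq> {}}"
  have fE: "finite ?E" using finite_Th by simp
  have "{y\<in>mesh_nodes Th F. z \<in> node_patch Th F y} \<subseteq> (\<Union>T\<in>?E. F T ` Basis)"
  proof safe
    fix y assume y: "y \<in> mesh_nodes Th F" "z \<in> node_patch Th F y"
    then obtain T b where T: "T \<in> Th" "b \<in> Basis" "y = F T b" by (auto simp: mesh_nodes_def)
    obtain S where S: "S \<in> Th" "y \<in> element_boundary F S" "z \<in> S" using y(2) by (auto simp: node_patch_def)
    have "dist z y \<le> diameter S"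
      using S element_boundary_subset compact_element by (intro diameter_bounded_bound compact_imp_bounded) auto
    also have "\<dots> \<le> \<kappa> * h" using qu S by (simp add: quasi_uniform_def)
    finally have "y \<in> cball z (\<kappa> * h)" by simp
    moreover have "y \<in> T" using T element(2) hull_subset[of Basis convex] unfolding ref_simplex_def by blast
    ultimately show "y \<in> (\<Union>T\<in>?E. F T ` Basis)" using T by blast
  qed
  then have "card {y\<in>mesh_nodes Th F. z \<in> node_patch Th F y} \<le> card (\<Union>T\<in>?E. F T ` Basis)"
    using fE by (intro card_mono) auto
  also have "\<dots> \<le> (\<Sum>T\<in>?E. card (F T ` Basis))" by (rule card_UN_le[OF fE])
  also have "\<dots> \<le> (\<Sum>T\<in>?E. DIM('a))" by (intro sum_mono card_image_le) simp
  also have "\<dots> = card ?E * DIM('a)" by simp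
  finally have "real (card {y\<in>mesh_nodes Th F. z \<in> node_patch Th F y}) \<le> real (card ?E * DIM('a))"
    by (rule of_nat_mono)
  also have "\<dots> = real (card ?E) * real DIM('a)" by (rule of_nat_mult)
  also have "\<dots> \<le> overlap \<kappa> * real DIM('a)" using elements_near kappa_pos by (intro mult_right_mono) auto
  finally show ?thesis by (simp add: mult.commute)
qed

lemma patch_closed: "closed (node_patch Th F y)"
  using finite_Th compact_element unfolding node_patch_def by (intro closed_Union) (auto simp: compact_imp_closed)

lemma patch_subset: "node_patch Th F y \<subseteq> \<Gamma>"
  using Union_Th by (auto simp: node_patch_def)

lemma patch_dist:
  assumes "s \<in> node_patch Th F y" "t \<in> node_patch Th F y" shows "dist s t \<le> 2 * \<kappa> * h"
proof -
  have "dist y s \<le> \<kappa> * h" if s: "s \<in> node_patch Th F y" for s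
  proof -
    obtain S where S: "S \<in> Th" "y \<in> element_boundary F S" "s \<in> S" using s by (auto simp: node_patch_def)
    have "dist y s \<le> diameter S"
      using S element_boundary_subset compact_element by (intro diameter_bounded_bound compact_imp_bounded) auto
    also have "\<dots> \<le> \<kappa> * h" using qu S by (simp add: quasi_uniform_def)
    finally show ?thesis .
  qed
  from this[OF assms(1)] this[OF assms(2)] show ?thesis using dist_triangle3[of s t y] by simp
qed

lemma patch_ball:
  assumes "y \<in> mesh_nodes Th F"
  shows "\<exists>x\<in>\<Gamma>. \<Gamma> \<inter> ball x (rad * h) \<subseteq> node_patch Th F y"
proof -
  obtain T b where T: "T \<in> Th" "b \<in> Basis" "y = F T b" using assms by (auto simp: mesh_nodes_def)
  then have "y \<in> element_boundary F T"
    using Basis_subset_rel_frontier[where 'a='a] dim unfolding element_boundary_def by fastforce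
  then have "T \<subseteq> node_patch Th F y" using T by (auto simp: node_patch_def)
  then show ?thesis using inscribed_ball[OF T(1)] T(1) Union_Th by blast
qed

end

section \<open>Lipschitz functions\<close>

lemma nn_integral_lborel_shift:
  fixes f :: "'a::euclidean_space \<Rightarrow> ennreal"
  assumes [measurable]: "f \<in> borel_measurable borel"
  shows "(\<integral>\<^sup>+ u. f (c + u) \<partial>lborel) = (\<integral>\<^sup>+ u. f u \<partial>lborel)"
proof -
  have "(\<integral>\<^sup>+ u. f u \<partial>lborel) = (\<integral>\<^sup>+ u. f u \<partial>distr lborel borel ((+) c))"
    by (simp add: lborel_distr_plus)
  also have "\<dots> = (\<integral>\<^sup>+ u. f (c + u) \<partial>lborel)" by (subst nn_integral_distr) auto
  finally show ?thesis by simp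
qed

text \<open>
  The segment itself may lie in the null set. Averaging over translates of the segment replaces
  Fubini's theorem, since almost all translates of an equidistant subdivision avoid the null set.
\<close>

lemma lipschitz_segment_bound:
  fixes G :: "'a::euclidean_space \<Rightarrow> real"
  assumes L: "\<And>p q. \<bar>G p - G q\<bar> \<le> L * dist p q" and N: "negligible N"
    and M: "0 \<le> M" and \<delta>: "0 < \<delta>"
    and pw: "\<And>q \<epsilon> t. q \<notin> N \<Longrightarrow> 0 \<le> t \<Longrightarrow> t \<le> 1 \<Longrightarrow> dist (a + t *\<^sub>R w) q < \<delta> \<Longrightarrow> 0 < \<epsilon> \<Longrightarrow>
       \<exists>d>0. \<forall>p. dist p q < d \<longrightarrow> \<bar>G p - G q\<bar> \<le> (M + \<epsilon>) * dist p q"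
  shows "\<bar>G (a + w) - G a\<bar> \<le> M * norm w + 2 * L * \<delta>"
proof (cases "w = 0")
  case True
  have "0 \<le> L"
    using order_trans[OF abs_ge_zero L[of a "a + (SOME b. b \<in> Basis)"]] some_in_eq[of "Basis :: 'a set"]
    by (simp add: dist_norm zero_le_mult_iff)
  then show ?thesis using True \<delta> by simp
next
  case False
  then have w0: "0 < norm w" by simp
  have L0: "0 \<le> L" using order_trans[OF abs_ge_zero L[of "w" 0]] w0 by (simp add: zero_le_mult_iff)
  define Q where "Q = (\<Union>t\<in>{0..1}. ball (a + t *\<^sub>R w) \<delta>)"
  have openQ: "open Q" by (simp add: Q_def open_UN)
  then have Q [measurable]: "Q \<in> sets borel" by simp
  have "Q \<subseteq> ball a (norm w + \<delta>)"
  proof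
    fix q assume "q \<in> Q"
    then obtain t where t: "0 \<le> t" "t \<le> 1" "dist (a + t *\<^sub>R w) q < \<delta>" by (auto simp: Q_def)
    have "dist a (a + t *\<^sub>R w) \<le> norm w" using t by (simp add: dist_norm mult_left_le_one_le)
    then show "q \<in> ball a (norm w + \<delta>)" using dist_triangle[of a q "a + t *\<^sub>R w"] t by simp
  qed
  then have Qfin: "emeasure lborel Q < \<infinity>"
    by (intro order_le_less_trans[OF emeasure_mono emeasure_bounded_finite]) auto
  have contG: "continuous_on UNIV G"
    using L L0 by (intro lipschitz_on_continuous_on[of L]) (simp add: lipschitz_on_def dist_real_def)
  have [measurable]: "G \<in> borel_measurable borel" using contG by (rule borel_measurable_continuous_onI)
  \<comment> \<open>The excess of the difference quotient at step 1 / (m + 1) over M |w|, cut off to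
    the \<delta>-neighbourhood \<open>Q\<close> of the segment. Off \<open>N\<close> it tends to 0,
    and it is dominated by a multiple of the indicator of \<open>Q\<close>, so its integrals tend to
    0.\<close>
  define f where "f = (\<lambda>m q. max 0 (real (Suc m) * \<bar>G (q + (1 / real (Suc m)) *\<^sub>R w) - G q\<bar> - M * norm w) * indicator Q q)"
  have fm [measurable]: "f m \<in> borel_measurable borel" for m unfolding f_def by measurable
  have f0: "0 \<le> f m q" for m q by (simp add: f_def)
  have fle: "f m q \<le> L * norm w * indicator Q q" for m q
  proof -
    have "real (Suc m) * \<bar>G (q + (1 / real (Suc m)) *\<^sub>R w) - G q\<bar> \<le> real (Suc m) * (L * dist (q + (1 / real (Suc m)) *\<^sub>R w) q)"
      by (intro mult_left_mono L) simp
    also have "\<dots> = L * norm w" by (simp add: dist_norm del: of_nat_Suc)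
    finally have "max 0 (real (Suc m) * \<bar>G (q + (1 / real (Suc m)) *\<^sub>R w) - G q\<bar> - M * norm w) \<le> L * norm w"
      using M L0 by (simp add: max_def) (smt (verit) mult_nonneg_nonneg norm_ge_zero)
    then show ?thesis unfolding f_def by (intro mult_right_mono) auto
  qed
  have lim: "(\<lambda>m. f m q) \<longlonglongrightarrow> 0" if q: "q \<notin> N" for q
  proof (cases "q \<in> Q")
    case False
    then show ?thesis by (simp add: f_def)
  next
    case True
    then obtain t where t: "0 \<le> t" "t \<le> 1" "dist (a + t *\<^sub>R w) q < \<delta>" by (auto simp: Q_def)
    show ?thesis
    proof (rule LIMSEQ_I)
      fix r :: real assume r: "0 < r"
      define \<epsilon> where "\<epsilon> = r / (2 * norm w)"
      have \<epsilon>: "0 < \<epsilon>" "\<epsilon> * norm w < r" using r w0 by (auto simp: \<epsilon>_def)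
      obtain d where d: "0 < d" "\<And>p. dist p q < d \<Longrightarrow> \<bar>G p - G q\<bar> \<le> (M + \<epsilon>) * dist p q"
        using pw[OF q t \<epsilon>(1)] by blast
      obtain n0 where n0: "norm w / d < real n0" using reals_Archimedean2 by blast
      have "norm (f m q - 0) < r" if m: "n0 \<le> m" for m
      proof -
        define k where "k = real (Suc m)"
        have k: "0 < k" "norm w / d < k" using n0 m by (auto simp: k_def)
        have dq: "dist (q + (1 / k) *\<^sub>R w) q = norm w / k" using k by (simp add: dist_norm)
        have "norm w / k < d" using k d(1) by (simp add: field_simps)
        then have "\<bar>G (q + (1 / k) *\<^sub>R w) - G q\<bar> \<le> (M + \<epsilon>) * (norm w / k)" using d(2) dq by metis
        then have "k * \<bar>G (q + (1 / k) *\<^sub>R w) - G q\<bar> \<le> k * ((M + \<epsilon>) * (norm w / k))"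
          using k by (intro mult_left_mono) auto
        also have "\<dots> = (M + \<epsilon>) * norm w" using k by simp
        finally have "k * \<bar>G (q + (1 / k) *\<^sub>R w) - G q\<bar> - M * norm w \<le> \<epsilon> * norm w" by (simp add: algebra_simps)
        then show ?thesis using True \<epsilon>(2) r unfolding f_def k_def[symmetric] by auto
      qed
      then show "\<exists>n0. \<forall>m\<ge>n0. norm (f m q - 0) < r" by blast
    qed
  qed
  have "AE q in lebesgue. q \<notin> N" using N AE_not_in by (auto simp: negligible_iff_null_sets)
  then have AEN: "AE q in lborel. q \<notin> N" by (simp add: AE_completion_iff)
  have J: "(\<lambda>m. \<integral>\<^sup>+ q. ennreal (f m q) \<partial>lborel) \<longlonglongrightarrow> (\<integral>\<^sup>+ (q::'a). 0 \<partial>lborel)"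
  proof (rule nn_integral_dominated_convergence[where w="\<lambda>q. ennreal (L * norm w) * indicator Q q"])
    show "(\<integral>\<^sup>+ q. ennreal (L * norm w) * indicator Q q \<partial>lborel) < \<infinity>"
      using Qfin by (simp add: nn_integral_cmult_indicator ennreal_mult_less_top)
    show "AE q in lborel. ennreal (f j q) \<le> ennreal (L * norm w) * indicator Q q" for j
    proof (rule AE_I2)
      fix q
      have "ennreal (L * norm w * indicator Q q) = ennreal (L * norm w) * indicator Q q" by (simp split: split_indicator)
      then show "ennreal (f j q) \<le> ennreal (L * norm w) * indicator Q q" using ennreal_leI[OF fle[of j q]] by simp
    qed
    show "AE q in lborel. (\<lambda>m. ennreal (f m q)) \<longlonglongrightarrow> 0"
      using AEN
    proof eventually_elim
      case (elim q)
      show ?case using tendsto_ennrealI[OF lim[OF elim]] by simp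
    qed
  qed auto
  \<comment> \<open>A translation by u in \<open>ball 0 \<delta>\<close> costs L \<delta> at each
    end of the segment. For every such u, the mean of \<open>f m\<close> over the translated
    subdivision points is then at least \<open>c\<close>; integration over u shows that
    \<open>c\<close> cannot be positive.\<close>
  define c where "c = \<bar>G (a + w) - G a\<bar> - 2 * L * \<delta> - M * norm w"
  have key: "ennreal c * emeasure lborel (ball (0::'a) \<delta>) \<le> (\<integral>\<^sup>+ q. ennreal (f m q) \<partial>lborel)" for m
  proof -
    let ?k = "Suc m"
    define z where "z = (\<lambda>j. a + (real j / real ?k) *\<^sub>R w)"
    have pt: "c \<le> (\<Sum>j<?k. f m (z j + u)) / real ?k" if u: "u \<in> ball 0 \<delta>" for u
    proof -
      have inQ: "z j + u \<in> Q" if "j < ?k" for j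
        unfolding Q_def z_def using that u
        by (intro UN_I[of "real j / real ?k"]) (auto simp: dist_norm field_simps)
      have st: "z (Suc j) + u = (z j + u) + (1 / real ?k) *\<^sub>R w" for j
        by (simp add: z_def add_divide_distrib scaleR_add_left algebra_simps)
      have "\<bar>G (z (Suc j) + u) - G (z j + u)\<bar> \<le> (M * norm w + f m (z j + u)) / real ?k" if "j < ?k" for j
      proof -
        have "f m (z j + u) = max 0 (real ?k * \<bar>G (z (Suc j) + u) - G (z j + u)\<bar> - M * norm w)"
          using inQ[OF that] by (simp only: f_def st) simp
        then have "real ?k * \<bar>G (z (Suc j) + u) - G (z j + u)\<bar> \<le> M * norm w + f m (z j + u)"
          by linarith
        then show ?thesis by (simp add: field_simps del: of_nat_Suc)
      qed
      then have "(\<Sum>j<?k. \<bar>G (z (Suc j) + u) - G (z j + u)\<bar>) \<le> (\<Sum>j<?k. (M * norm w + f m (z j + u)) / real ?k)"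
        by (intro sum_mono) auto
      also have "\<dots> = M * norm w + (\<Sum>j<?k. f m (z j + u)) / real ?k"
        by (simp add: sum_divide_distrib[symmetric] sum.distrib add_divide_distrib del: of_nat_Suc sum.lessThan_Suc)
      finally have "(\<Sum>j<?k. \<bar>G (z (Suc j) + u) - G (z j + u)\<bar>) \<le> M * norm w + (\<Sum>j<?k. f m (z j + u)) / real ?k" .
      moreover have "\<bar>\<Sum>j<?k. G (z (Suc j) + u) - G (z j + u)\<bar> \<le> (\<Sum>j<?k. \<bar>G (z (Suc j) + u) - G (z j + u)\<bar>)"
        by (rule sum_abs)
      moreover have "(\<Sum>j<?k. G (z (Suc j) + u) - G (z j + u)) = G (z ?k + u) - G (z 0 + u)"
        by (rule sum_lessThan_telescope)
      moreover have "z ?k = a + w" "z 0 = a" by (auto simp: z_def simp del: of_nat_Suc)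
      moreover have "\<bar>G (a + w + u) - G (a + w)\<bar> \<le> L * \<delta>" "\<bar>G (a + u) - G a\<bar> \<le> L * \<delta>"
        using u L[of "a + w + u" "a + w"] L[of "a + u" a] mult_left_mono[of "norm u" \<delta> L] L0
        by (auto simp: dist_norm)
      ultimately show ?thesis unfolding c_def by (simp add: abs_le_iff) linarith
    qed
    have "ennreal c * emeasure lborel (ball (0::'a) \<delta>) = (\<integral>\<^sup>+ (u::'a). ennreal c * indicator (ball 0 \<delta>) u \<partial>lborel)"
      by (simp add: nn_integral_cmult_indicator)
    also have "\<dots> \<le> (\<integral>\<^sup>+ u. (\<Sum>j<?k. ennreal (1 / real ?k) * ennreal (f m (z j + u))) \<partial>lborel)"
    proof (intro nn_integral_mono)
      fix u :: 'a
      show "ennreal c * indicator (ball 0 \<delta>) u \<le> (\<Sum>j<?k. ennreal (1 / real ?k) * ennreal (f m (z j + u)))"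
      proof (cases "u \<in> ball 0 \<delta>")
        case True
        have "ennreal c \<le> ennreal (\<Sum>j<?k. 1 / real ?k * f m (z j + u))"
          using pt[OF True] by (intro ennreal_leI) (simp add: sum_divide_distrib del: of_nat_Suc sum.lessThan_Suc)
        also have "\<dots> = (\<Sum>j<?k. ennreal (1 / real ?k) * ennreal (f m (z j + u)))"
          by (subst sum_ennreal[symmetric]) (auto simp: f0 ennreal_mult'[symmetric] simp del: of_nat_Suc sum.lessThan_Suc)
        finally show ?thesis using True by simp
      qed simp
    qed
    also have "\<dots> = (\<Sum>j<?k. ennreal (1 / real ?k) * (\<integral>\<^sup>+ u. ennreal (f m (z j + u)) \<partial>lborel))"
      by (simp add: nn_integral_sum nn_integral_cmult del: of_nat_Suc sum.lessThan_Suc)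
    also have "\<dots> = (\<Sum>j<?k. ennreal (1 / real ?k) * (\<integral>\<^sup>+ u. ennreal (f m u) \<partial>lborel))"
      by (simp add: nn_integral_lborel_shift[of "\<lambda>u. ennreal (f m u)"] del: of_nat_Suc sum.lessThan_Suc)
    also have "\<dots> = (\<Sum>j<?k. ennreal (1 / real ?k)) * (\<integral>\<^sup>+ u. ennreal (f m u) \<partial>lborel)"
      by (rule sum_distrib_right[symmetric])
    also have "(\<Sum>j<?k. ennreal (1 / real ?k)) = 1"
      by (subst sum_ennreal) (auto simp del: of_nat_Suc sum.lessThan_Suc)
    finally show ?thesis by simp
  qed
  have "ennreal c * emeasure lborel (ball (0::'a) \<delta>) \<le> 0"
  proof -
    have "ennreal c * emeasure lborel (ball (0::'a) \<delta>) \<le> (\<integral>\<^sup>+ (q::'a). 0 \<partial>lborel)"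
      by (rule LIMSEQ_le_const[OF J], rule exI[of _ 0], intro allI impI, rule key)
    then show ?thesis by simp
  qed
  then have "ennreal c = 0" using \<delta> less_imp_neq[OF unit_ball_vol_pos[of "real DIM('a)"], symmetric] by (simp add: emeasure_ball)
  then have "c \<le> 0" by (simp add: ennreal_eq_0_iff)
  then show ?thesis by (simp add: c_def)
qed

text \<open>\<open>lipschitz_segment_bound\<close> asks for a function on the whole space. Here
  \<open>G\<close> is first composed with the projection to a compact convex subset of
  \<open>S\<close> containing a neighbourhood of the segment; then \<delta> tends to 0, which
  removes the a priori constant \<open>L\<close>.\<close>

lemma lipschitz_from_pointwise:
  fixes G :: "'a::euclidean_space \<Rightarrow> real"
  assumes S: "open S" "convex S" and L: "\<And>p q. p \<in> S \<Longrightarrow> q \<in> S \<Longrightarrow> \<bar>G p - G q\<bar> \<le> L * dist p q"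
    and N: "negligible N" and M: "0 \<le> M"
    and pw: "\<And>q \<epsilon>. q \<in> S \<Longrightarrow> q \<notin> N \<Longrightarrow> 0 < \<epsilon> \<Longrightarrow>
       \<exists>d>0. \<forall>p\<in>S. dist p q < d \<longrightarrow> \<bar>G p - G q\<bar> \<le> (M + \<epsilon>) * dist p q"
    and ab: "a \<in> S" "b \<in> S"
  shows "\<bar>G b - G a\<bar> \<le> M * dist a b"
proof -
  obtain d1 d2 where "0 < d1" "cball a d1 \<subseteq> S" "0 < d2" "cball b d2 \<subseteq> S"
    using S(1) ab open_contains_cball by metis
  then obtain d0 where d0: "0 < d0" "cball a d0 \<subseteq> S" "cball b d0 \<subseteq> S"
    using subset_cball[of "min d1 d2" d1 a] subset_cball[of "min d1 d2" d2 b]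
    by (metis min.cobounded1 min.cobounded2 min_less_iff_conj subset_trans)
  define T where "T = convex hull (cball a d0 \<union> cball b d0)"
  have T: "compact T" "convex T" "T \<noteq> {}" "T \<subseteq> S"
    using d0 hull_minimal[of "cball a d0 \<union> cball b d0" S convex] S(2)
    by (auto simp: T_def compact_convex_hull compact_Un)
  have ballT: "ball (a + t *\<^sub>R (b - a)) d0 \<subseteq> T" if t: "0 \<le> t" "t \<le> 1" for t
  proof
    fix q assume q: "q \<in> ball (a + t *\<^sub>R (b - a)) d0"
    define u where "u = q - (a + t *\<^sub>R (b - a))"
    have u: "norm u < d0" using q by (simp add: u_def dist_norm norm_minus_commute)
    have "a + u \<in> T" "b + u \<in> T" unfolding T_def using u by (auto intro!: hull_inc simp: dist_norm)
    then have "(1 - t) *\<^sub>R (a + u) + t *\<^sub>R (b + u) \<in> T" using T(2) t by (simp add: convexD)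
    also have "(1 - t) *\<^sub>R (a + u) + t *\<^sub>R (b + u) = q" by (simp add: u_def algebra_simps)
    finally show "q \<in> T" .
  qed
  \<comment> \<open>The closest point projection does not increase distances, so the Lipschitz
    constant survives, and near the segment nothing changes because the \<delta>-neighbourhood lies
    in \<open>T\<close>.\<close>
  define G' where "G' = (\<lambda>q. G (closest_point T q))"
  have cpT: "closest_point T q \<in> T" for q using T by (intro closest_point_in_set compact_imp_closed)
  have G'T: "G' q = G q" if "q \<in> T" for q using that by (simp add: G'_def closest_point_self)
  have L0: "0 \<le> L"
  proof -
    obtain v :: 'a where v: "v \<in> Basis" using nonempty_Basis by blast
    then have "a + d0 *\<^sub>R v \<in> S" using d0 by (auto simp: dist_norm subset_iff)
    then show ?thesis using order_trans[OF abs_ge_zero L[OF _ ab(1)]] d0 v by (fastforce simp: dist_norm zero_le_mult_iff)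
  qed
  have L': "\<bar>G' p - G' q\<bar> \<le> L * dist p q" for p q
  proof -
    have "\<bar>G' p - G' q\<bar> \<le> L * dist (closest_point T p) (closest_point T q)"
      unfolding G'_def using cpT T(4) by (intro L) auto
    also have "\<dots> \<le> L * dist p q"
      using T L0 by (intro mult_left_mono closest_point_lipschitz compact_imp_closed) auto
    finally show ?thesis .
  qed
  have bound: "\<bar>G' (a + (b - a)) - G' a\<bar> \<le> M * norm (b - a) + 2 * L * \<delta>" if \<delta>: "0 < \<delta>" "\<delta> \<le> d0" for \<delta>
  proof (rule lipschitz_segment_bound[OF L' N M \<delta>(1)])
    fix q :: 'a and \<epsilon> t :: real
    assume q: "q \<notin> N" and t: "0 \<le> t" "t \<le> 1" "dist (a + t *\<^sub>R (b - a)) q < \<delta>" and e: "0 < \<epsilon>"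
    have qb: "q \<in> ball (a + t *\<^sub>R (b - a)) d0" using t(3) \<delta>(2) by simp
    then obtain d' where d': "0 < d'" "ball q d' \<subseteq> ball (a + t *\<^sub>R (b - a)) d0"
      using open_ball open_contains_ball by metis
    have qT: "q \<in> T" using ballT[OF t(1,2)] qb by blast
    obtain d where d: "0 < d" "\<forall>p\<in>S. dist p q < d \<longrightarrow> \<bar>G p - G q\<bar> \<le> (M + \<epsilon>) * dist p q"
      using pw[OF _ q e] qT T(4) by blast
    have "\<bar>G' p - G' q\<bar> \<le> (M + \<epsilon>) * dist p q" if p: "dist p q < min d d'" for p
    proof -
      have "p \<in> T" using p d'(2) ballT[OF t(1,2)] by (auto simp: dist_commute subset_iff)
      then show ?thesis using d(2) p qT T(4) by (auto simp: G'T)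
    qed
    then show "\<exists>d>0. \<forall>p. dist p q < d \<longrightarrow> \<bar>G' p - G' q\<bar> \<le> (M + \<epsilon>) * dist p q"
      using d(1) d'(1) by (intro exI[of _ "min d d'"]) auto
  qed
  have "\<bar>G b - G a\<bar> \<le> M * dist a b + e" if e: "0 < e" for e
  proof -
    define \<delta> where "\<delta> = min d0 (e / (2 * (L + 1)))"
    have \<delta>: "0 < \<delta>" "\<delta> \<le> d0" using d0 e L0 by (auto simp: \<delta>_def)
    have "2 * L * \<delta> \<le> 2 * L * (e / (2 * (L + 1)))" using L0 by (intro mult_left_mono) (auto simp: \<delta>_def)
    also have "\<dots> \<le> e" using L0 e by (simp add: field_simps)
    finally have "2 * L * \<delta> \<le> e" .
    moreover have "a \<in> T" "b \<in> T" using d0 by (auto simp: T_def intro!: hull_inc)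
    ultimately show ?thesis using bound[OF \<delta>] by (simp add: G'T dist_norm norm_minus_commute)
  qed
  then show ?thesis by (rule field_le_epsilon)
qed

section \<open>Paths on the surface and gradient bounds\<close>

lemma curve_length_ge:
  assumes "sorted ts" "set ts \<subseteq> {0..1}"
  shows "(\<Sum>i<length ts - 1. ennreal (dist (g (ts ! i)) (g (ts ! Suc i)))) \<le> curve_length g"
  unfolding curve_length_def using assms by (intro SUP_upper) auto

lemma curve_length_ge_dist:
  assumes "t \<in> {0..1}"
  shows "ennreal (dist (g 0) (g t)) \<le> curve_length g"
  using curve_length_ge[of "[0, t]" g] assms by simp

text \<open>Uniform continuity gives an equidistant subdivision with chords shorter than \<rho>, to
  which \<open>loc\<close> applies; the chords sum to at most the length of the path.\<close>

lemma path_lipschitz_bound: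
  fixes g :: "real \<Rightarrow> 'a::metric_space" and \<phi> :: "'a \<Rightarrow> real"
  assumes g: "continuous_on {0..1} g" "g ` {0..1} \<subseteq> \<Gamma>" and len: "curve_length g \<le> ennreal l" "0 \<le> l"
    and \<rho>: "0 < \<rho>" and M: "0 \<le> M"
    and loc: "\<And>p q. p \<in> \<Gamma> \<Longrightarrow> q \<in> \<Gamma> \<Longrightarrow> dist p q < \<rho> \<Longrightarrow> \<bar>\<phi> q - \<phi> p\<bar> \<le> M * dist p q"
  shows "\<bar>\<phi> (g 1) - \<phi> (g 0)\<bar> \<le> M * l"
proof -
  have "uniformly_continuous_on {0..1} g" using g(1) by (intro compact_uniformly_continuous) auto
  then obtain d where d: "0 < d" "\<And>s t. s \<in> {0..1} \<Longrightarrow> t \<in> {0..1} \<Longrightarrow> dist t s < d \<Longrightarrow> dist (g t) (g s) < \<rho>"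
    unfolding uniformly_continuous_on_def using \<rho> by metis
  obtain m where m: "1 / d < real m" using reals_Archimedean2 by blast
  have m0: "0 < real m" using m d(1) by (meson order_less_trans zero_less_divide_1_iff)
  define z where "z i = real i / real m" for i :: nat
  have z01: "z i \<in> {0..1}" if "i \<le> m" for i using that m0 by (simp add: z_def)
  have dz: "dist (z i) (z (Suc i)) < d" for i
    using m m0 d(1) by (simp add: z_def dist_real_def diff_divide_distrib[symmetric] field_simps)
  define ts where "ts = map z [0..<Suc m]"
  have tsn: "ts ! i = z i" if "i \<le> m" for i using that unfolding ts_def by (simp del: upt_Suc)
  have "sorted ts" unfolding ts_def sorted_iff_nth_mono
    using m0 by (auto simp: z_def divide_right_mono simp del: upt_Suc)
  moreover have "set ts \<subseteq> {0..1}" using z01 by (auto simp: ts_def simp del: upt_Suc)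
  ultimately have "(\<Sum>i<length ts - 1. ennreal (dist (g (ts ! i)) (g (ts ! Suc i)))) \<le> curve_length g"
    by (rule curve_length_ge)
  also have "(\<Sum>i<length ts - 1. ennreal (dist (g (ts ! i)) (g (ts ! Suc i)))) =
      (\<Sum>i<m. ennreal (dist (g (z i)) (g (z (Suc i)))))"
    by (intro sum.cong) (auto simp: ts_def tsn[unfolded ts_def] simp del: upt_Suc)
  also have "\<dots> = ennreal (\<Sum>i<m. dist (g (z i)) (g (z (Suc i))))" by (rule sum_ennreal) simp
  finally have "ennreal (\<Sum>i<m. dist (g (z i)) (g (z (Suc i)))) \<le> ennreal l"
    using len(1) by (rule order_trans)
  then have S: "(\<Sum>i<m. dist (g (z i)) (g (z (Suc i)))) \<le> l"
    using len(2) by (simp add: ennreal_le_iff)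
  have "g (z 0) = g 0" "g (z m) = g 1" using m0 by (auto simp: z_def)
  then have "\<bar>\<phi> (g 1) - \<phi> (g 0)\<bar> = \<bar>\<Sum>i<m. \<phi> (g (z (Suc i))) - \<phi> (g (z i))\<bar>"
    using sum_lessThan_telescope[of "\<lambda>i. \<phi> (g (z i))" m] by simp
  also have "\<dots> \<le> (\<Sum>i<m. \<bar>\<phi> (g (z (Suc i))) - \<phi> (g (z i))\<bar>)" by (rule sum_abs)
  also have "\<dots> \<le> (\<Sum>i<m. M * dist (g (z i)) (g (z (Suc i))))"
  proof (intro sum_mono loc)
    fix i assume i: "i \<in> {..<m}"
    then have "z i \<in> {0..1}" "z (Suc i) \<in> {0..1}" using z01[of i] z01[of "Suc i"] by auto
    then show "g (z i) \<in> \<Gamma>" "g (z (Suc i)) \<in> \<Gamma>" "dist (g (z i)) (g (z (Suc i))) < \<rho>"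
      using g(2) d(2) dz by auto
  qed
  also have "\<dots> = M * (\<Sum>i<m. dist (g (z i)) (g (z (Suc i))))" by (simp add: sum_distrib_left)
  also have "\<dots> \<le> M * l" using S M by (rule mult_left_mono)
  finally show ?thesis .
qed

text \<open>Doubling the bound makes it strict for distinct points, so that some path undercuts it
  although the infimum need not be attained.\<close>

lemma short_path:
  assumes geo: "geodesic_dist \<Gamma> p q \<le> ennreal (K * dist p q)" and K: "1 \<le> K" and pq: "p \<noteq> q"
  shows "\<exists>g. continuous_on {0..1} g \<and> g ` {0..1} \<subseteq> \<Gamma> \<and> g 0 = p \<and> g 1 = q \<and> curve_length g \<le> ennreal (2 * K * dist p q)"
proof -
  have "K * dist p q < 2 * K * dist p q" using K pq by simp
  then have "geodesic_dist \<Gamma> p q < ennreal (2 * K * dist p q)"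
    using K pq by (intro order_le_less_trans[OF geo] ennreal_lessI) auto
  then obtain g where "path g" "path_image g \<subseteq> \<Gamma>" "pathstart g = p" "pathfinish g = q"
     "curve_length g < ennreal (2 * K * dist p q)"
    unfolding geodesic_dist_def INF_less_iff by blast
  then show ?thesis
    by (intro exI[of _ g]) (auto simp: path_def path_image_def pathstart_def pathfinish_def)
qed

text \<open>Between a point of \<tau> and a point outside, a path crosses the relative frontier,
  where \<phi> vanishes, and the crossing is no farther from the first point than the path is long.
  The constant depends on \<phi>; it is the a priori bound that later drops out.\<close>

lemma W1inf0_global_lipschitz:
  fixes \<Gamma> \<tau> :: "'a::euclidean_space set"
  assumes \<phi>: "\<phi> \<in> W1inf0_space \<Gamma> \<tau>" and \<tau>: "\<tau> \<subseteq> \<Gamma>" "closed \<tau>"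
    and geo: "\<And>x y. x \<in> \<Gamma> \<Longrightarrow> y \<in> \<Gamma> \<Longrightarrow> geodesic_dist \<Gamma> x y \<le> ennreal (K * dist x y)" and K: "1 \<le> K"
  shows "\<exists>L\<ge>0. \<forall>p\<in>\<Gamma>. \<forall>q\<in>\<Gamma>. \<bar>\<phi> q - \<phi> p\<bar> \<le> L * dist p q"
proof -
  obtain L where L: "L-lipschitz_on \<tau> \<phi>" and fr: "\<And>x. x \<in> (top_of_set \<Gamma>) frontier_of \<tau> \<Longrightarrow> \<phi> x = 0"
    and out: "\<And>x. x \<in> \<Gamma> - \<tau> \<Longrightarrow> \<phi> x = 0"
    using \<phi> unfolding W1inf0_space_def by blast
  have L0: "0 \<le> L" using L by (rule lipschitz_on_nonneg)
  have mixed: "\<bar>\<phi> p\<bar> \<le> L * (2 * K * dist p q)" if p: "p \<in> \<tau>" and q: "q \<in> \<Gamma> - \<tau>" for p q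
  proof -
    have "p \<in> \<Gamma>" "q \<in> \<Gamma>" "p \<noteq> q" using p q \<tau> by auto
    then obtain g where g: "continuous_on {0..1} g" "g ` {0..1} \<subseteq> \<Gamma>" "g 0 = p" "g 1 = q"
      "curve_length g \<le> ennreal (2 * K * dist p q)"
      using short_path[OF geo K] by metis
    have "connectedin (top_of_set \<Gamma>) (g ` {0..1})"
      using g(1,2) by (simp add: connectedin_subtopology connected_continuous_image)
    moreover have "g ` {0..1} \<inter> \<tau> \<noteq> {}" "g ` {0..1} - \<tau> \<noteq> {}"
      using p q g(3,4) by (force simp: image_iff)+
    ultimately have "g ` {0..1} \<inter> (top_of_set \<Gamma>) frontier_of \<tau> \<noteq> {}"
      by (rule connectedin_Int_frontier_of)
    then obtain t where t: "t \<in> {0..1}" "g t \<in> (top_of_set \<Gamma>) frontier_of \<tau>" by blast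
    have "closedin (top_of_set \<Gamma>) \<tau>" using \<tau> by (simp add: closed_subset)
    then have gt: "g t \<in> \<tau>" using t(2) frontier_of_subset_closedin by blast
    have "ennreal (dist p (g t)) \<le> ennreal (2 * K * dist p q)"
      using curve_length_ge_dist[OF t(1), of g] g(3,5) order_trans by simp
    then have "dist p (g t) \<le> 2 * K * dist p q" using K by (simp add: ennreal_le_iff)
    moreover have "\<bar>\<phi> p - \<phi> (g t)\<bar> \<le> L * dist p (g t)"
      using lipschitz_onD[OF L p gt] by (simp add: dist_real_def)
    ultimately show ?thesis using fr[OF t(2)] L0 mult_left_mono[of "dist p (g t)" "2 * K * dist p q" L] by simp
  qed
  have "\<bar>\<phi> q - \<phi> p\<bar> \<le> (L * (2 * K)) * dist p q" if pq: "p \<in> \<Gamma>" "q \<in> \<Gamma>" for p q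
  proof (cases "p \<in> \<tau>")
    case True
    show ?thesis
    proof (cases "q \<in> \<tau>")
      case q: True
      have "\<bar>\<phi> q - \<phi> p\<bar> \<le> L * dist p q" using lipschitz_onD[OF L True q] by (simp add: dist_real_def abs_minus_commute)
      also have "\<dots> \<le> (L * (2 * K)) * dist p q" using L0 K by (intro mult_right_mono) (auto simp: mult_le_cancel_left1)
      finally show ?thesis .
    next
      case False
      then show ?thesis using mixed[OF True, of q] out[of q] pq by (simp add: mult.assoc)
    qed
  next
    case False
    show ?thesis
    proof (cases "q \<in> \<tau>")
      case q: True
      then show ?thesis using mixed[OF q, of p] out[of p] pq False by (simp add: mult.assoc dist_commute)
    next
      case q: False
      then show ?thesis using out pq False L0 K by simp
    qed
  qed
  moreover have "0 \<le> L * (2 * K)" using L0 K by simp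
  ultimately show ?thesis by blast
qed

lemma AE_surface_measure_null:
  fixes \<tau> :: "'a::euclidean_space set"
  assumes ms: "measure_space (UNIV :: 'a set) (sets borel) (hausdorff_outer (DIM('a) - 1))"
    and \<tau>: "closed \<tau>" and AE: "AE x in surface_measure \<tau>. P x"
  shows "\<exists>N. hausdorff_outer (DIM('a) - 1) N = 0 \<and> (\<forall>x\<in>\<tau> - N. P x)"
proof -
  obtain N where N: "{x \<in> space (surface_measure \<tau>). \<not> P x} \<subseteq> N" "N \<in> null_sets (surface_measure \<tau>)"
    using AE by (rule AE_E3) (auto)
  have b: "\<tau> \<in> sets borel" using \<tau> by simp
  have "N \<in> null_sets (hausdorff_measure (DIM('a) - 1))"
    using N(2) b unfolding surface_measure_def by (subst (asm) null_sets_restrict_space) auto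
  then have "hausdorff_outer (DIM('a) - 1) N = 0"
    using emeasure_hausdorff_measure[OF ms, of N] by (metis null_setsD1 null_setsD2 sets_hausdorff_measure)
  moreover have "space (surface_measure \<tau>) = \<tau>" by (simp add: surface_measure_def space_restrict_space)
  ultimately show ?thesis using N(1) by blast
qed

text \<open>The gradient controls \<phi> only within \<tau>, whereas a bound along \<Gamma> is
  wanted. If \<phi> x = 0, nearby points off \<tau> have the same value 0; if \<phi> x is nonzero, x
  cannot be on the relative frontier, so \<Gamma> near x lies in \<tau>.\<close>

lemma W1inf0_pointwise_lipschitz:
  fixes \<Gamma> \<tau> :: "'a::euclidean_space set"
  assumes ms: "measure_space (UNIV :: 'a set) (sets borel) (hausdorff_outer (DIM('a) - 1))"
    and \<phi>: "\<phi> \<in> W1inf0_space \<Gamma> \<tau>" and \<tau>: "\<tau> \<subseteq> \<Gamma>" "closed \<tau>"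
    and grad: "W1inf_seminorm_le \<tau> \<phi> k" and k: "0 \<le> k"
  shows "\<exists>N. hausdorff_outer (DIM('a) - 1) N = 0 \<and>
    (\<forall>x\<in>\<Gamma> - N. \<forall>\<epsilon>>0. \<exists>d>0. \<forall>p\<in>\<Gamma>. dist p x < d \<longrightarrow> \<bar>\<phi> p - \<phi> x\<bar> \<le> (k + \<epsilon>) * dist p x)"
proof -
  have fr: "\<And>x. x \<in> (top_of_set \<Gamma>) frontier_of \<tau> \<Longrightarrow> \<phi> x = 0"
    and out: "\<And>x. x \<in> \<Gamma> - \<tau> \<Longrightarrow> \<phi> x = 0"
    using \<phi> unfolding W1inf0_space_def by blast+
  obtain N where N: "hausdorff_outer (DIM('a) - 1) N = 0"
    "\<And>x. x \<in> \<tau> - N \<Longrightarrow> \<exists>g. has_tangential_gradient \<tau> \<phi> x g \<and> norm g \<le> k"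
    using AE_surface_measure_null[OF ms \<tau>(2) grad[unfolded W1inf_seminorm_le_def]] by blast
  have "\<exists>d>0. \<forall>p\<in>\<Gamma>. dist p x < d \<longrightarrow> \<bar>\<phi> p - \<phi> x\<bar> \<le> (k + \<epsilon>) * dist p x"
    if x: "x \<in> \<Gamma>" "x \<notin> N" and e: "0 < \<epsilon>" for x \<epsilon>
  proof (cases "x \<in> \<tau>")
    case False
    have "open (- \<tau>)" using \<tau>(2) by (simp add: open_Compl)
    then obtain d where d: "0 < d" "ball x d \<subseteq> - \<tau>" using False open_contains_ball by blast
    have "\<bar>\<phi> p - \<phi> x\<bar> \<le> (k + \<epsilon>) * dist p x" if p: "p \<in> \<Gamma>" "dist p x < d" for p
    proof -
      have "p \<in> ball x d" using p by (simp add: dist_commute)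
      then have "p \<notin> \<tau>" using d(2) by blast
      then show ?thesis using out p x False k e by simp
    qed
    then show ?thesis using d(1) by blast
  next
    case True
    then obtain g where g: "has_tangential_gradient \<tau> \<phi> x g" "norm g \<le> k" using N(2) x by blast
    then have "(\<phi> has_derivative (\<lambda>v. g \<bullet> v)) (at x within \<tau>)" by (simp add: has_tangential_gradient_def)
    then obtain d where d: "0 < d" "\<And>p. p \<in> \<tau> \<Longrightarrow> norm (p - x) < d \<Longrightarrow>
        norm (\<phi> p - \<phi> x - g \<bullet> (p - x)) \<le> \<epsilon> * norm (p - x)"
      using e unfolding has_derivative_within_alt by metis
    have inner: "\<bar>\<phi> p - \<phi> x\<bar> \<le> (k + \<epsilon>) * dist p x" if p: "p \<in> \<tau>" "dist p x < d" for p
    proof -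
      have "\<bar>\<phi> p - \<phi> x - g \<bullet> (p - x)\<bar> \<le> \<epsilon> * dist p x" using d(2)[OF p(1)] p(2) by (simp add: dist_norm)
      moreover have "\<bar>g \<bullet> (p - x)\<bar> \<le> k * dist p x"
        using Cauchy_Schwarz_ineq2[of g "p - x"] mult_right_mono[OF g(2), of "norm (p - x)"]
        by (simp add: dist_norm)
      ultimately show ?thesis by (simp add: algebra_simps)
    qed
    show ?thesis
    proof (cases "\<phi> x = 0")
      case z: True
      have "\<bar>\<phi> p - \<phi> x\<bar> \<le> (k + \<epsilon>) * dist p x" if "p \<in> \<Gamma>" "dist p x < d" for p
        using that inner[of p] out[of p] z k e by (cases "p \<in> \<tau>") auto
      then show ?thesis using d(1) by blast
    next
      case nz: False
      then have "x \<notin> (top_of_set \<Gamma>) frontier_of \<tau>" using fr by blast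
      moreover have "x \<in> (top_of_set \<Gamma>) closure_of \<tau>"
        using True closure_of_subset[of \<tau> "top_of_set \<Gamma>"] \<tau>(1) by auto
      ultimately have "x \<in> (top_of_set \<Gamma>) interior_of \<tau>" by (simp add: frontier_of_def)
      then obtain U where U: "openin (top_of_set \<Gamma>) U" "x \<in> U" "U \<subseteq> \<tau>"
        by (auto simp: interior_of_def)
      then obtain d' where d': "0 < d'" "ball x d' \<inter> \<Gamma> \<subseteq> U" using openin_contains_ball by metis
      have "\<bar>\<phi> p - \<phi> x\<bar> \<le> (k + \<epsilon>) * dist p x" if p: "p \<in> \<Gamma>" "dist p x < min d d'" for p
      proof (rule inner)
        show "p \<in> \<tau>" using p d'(2) U(3) by (auto simp: dist_commute subset_iff)
      qed (use p in simp)
      then show ?thesis using d(1) d'(1) by (intro exI[of _ "min d d'"]) auto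
    qed
  qed
  then show ?thesis using N(1) by blast
qed

text \<open>In a chart, \<phi> is pulled back to a solid ball, where
  \<open>lipschitz_from_pointwise\<close> tolerates the swept null set. The factor \<Lambda> is the
  Lipschitz constant of the chart, and 2 K comes from chaining along an almost shortest
  path.\<close>

lemma W1inf0_lipschitz:
  fixes \<Gamma> \<tau> :: "'a::euclidean_space set"
  assumes dim: "2 \<le> DIM('a)"
    and ms: "measure_space (UNIV :: 'a set) (sets borel) (hausdorff_outer (DIM('a) - 1))"
    and \<phi>: "\<phi> \<in> W1inf0_space \<Gamma> \<tau>" and \<tau>: "\<tau> \<subseteq> \<Gamma>" "closed \<tau>"
    and geo: "\<And>x y. x \<in> \<Gamma> \<Longrightarrow> y \<in> \<Gamma> \<Longrightarrow> geodesic_dist \<Gamma> x y \<le> ennreal (K * dist x y)" and K: "1 \<le> K"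
    and \<rho>: "0 < \<rho>" and \<Lambda>: "1 \<le> \<Lambda>"
    and ch: "\<And>x. x \<in> \<Gamma> \<Longrightarrow> \<exists>e \<Psi>. graph_chart \<Gamma> x \<rho> \<Lambda> e \<Psi>"
    and grad: "W1inf_seminorm_le \<tau> \<phi> k" and k: "0 \<le> k"
    and pq: "p \<in> \<Gamma>" "q \<in> \<Gamma>"
  shows "\<bar>\<phi> q - \<phi> p\<bar> \<le> 2 * K * \<Lambda> * k * dist p q"
proof -
  obtain L where L: "0 \<le> L" "\<And>p q. p \<in> \<Gamma> \<Longrightarrow> q \<in> \<Gamma> \<Longrightarrow> \<bar>\<phi> q - \<phi> p\<bar> \<le> L * dist p q"
    using W1inf0_global_lipschitz[OF \<phi> \<tau> geo K] by blast
  obtain N where N: "hausdorff_outer (DIM('a) - 1) N = 0"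
    "\<And>x \<epsilon>. x \<in> \<Gamma> - N \<Longrightarrow> 0 < \<epsilon> \<Longrightarrow> \<exists>d>0. \<forall>p\<in>\<Gamma>. dist p x < d \<longrightarrow> \<bar>\<phi> p - \<phi> x\<bar> \<le> (k + \<epsilon>) * dist p x"
    using W1inf0_pointwise_lipschitz[OF ms \<phi> \<tau> grad k] by blast
  have loc: "\<bar>\<phi> q - \<phi> p\<bar> \<le> (\<Lambda> * k) * dist p q" if p: "p \<in> \<Gamma>" and q: "q \<in> \<Gamma>" and d: "dist p q < \<rho>" for p q
  proof -
    obtain e \<Psi> where chart: "graph_chart \<Gamma> p \<rho> \<Lambda> e \<Psi>" using ch p by blast
    have e: "norm e = 1" and lip: "\<And>a b. dist (\<Psi> a) (\<Psi> b) \<le> \<Lambda> * dist a b"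
      and into: "\<And>a. a \<in> ball p \<rho> \<Longrightarrow> \<Psi> a \<in> \<Gamma>" and fixp: "\<And>a. a \<in> \<Gamma> \<Longrightarrow> a \<in> ball p \<rho> \<Longrightarrow> \<Psi> a = a"
      and along: "\<And>a. \<exists>s. \<Psi> a = a + s *\<^sub>R e"
      using chart unfolding graph_chart_def by auto
    \<comment> \<open>On the ball of radius \<rho> the projection moves points by at most this much,
      so every point projected into \<open>N\<close> belongs to the sweep of
      \<open>N\<close>.\<close>
    define s0 where "s0 = (\<Lambda> + 1) * \<rho>"
    have "0 < s0" using \<Lambda> \<rho> by (simp add: s0_def)
    then have neg: "negligible (sweep e s0 N)" using negligible_sweep[OF e _ dim N(1)] by blast
    have "\<bar>(\<phi> \<circ> \<Psi>) q - (\<phi> \<circ> \<Psi>) p\<bar> \<le> (\<Lambda> * k) * dist p q"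
    proof (rule lipschitz_from_pointwise[OF open_ball convex_ball _ neg])
      show "\<bar>(\<phi> \<circ> \<Psi>) a - (\<phi> \<circ> \<Psi>) b\<bar> \<le> (L * \<Lambda>) * dist a b" if "a \<in> ball p \<rho>" "b \<in> ball p \<rho>" for a b
      proof -
        have "\<bar>\<phi> (\<Psi> a) - \<phi> (\<Psi> b)\<bar> \<le> L * dist (\<Psi> b) (\<Psi> a)" by (rule L(2)[OF into[OF that(2)] into[OF that(1)]])
        also have "\<dots> \<le> L * (\<Lambda> * dist b a)" by (rule mult_left_mono[OF lip L(1)])
        finally show ?thesis by (simp add: dist_commute mult.assoc)
      qed
      show "0 \<le> \<Lambda> * k" using \<Lambda> k by simp
      show "p \<in> ball p \<rho>" "q \<in> ball p \<rho>" using \<rho> d by auto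
      fix a \<epsilon> assume a: "a \<in> ball p \<rho>" "a \<notin> sweep e s0 N" and eps: "0 < (\<epsilon>::real)"
      obtain s where s: "\<Psi> a = a + s *\<^sub>R e" using along by blast
      have "dist p (\<Psi> a) \<le> \<Lambda> * dist p a" using lip[of p a] fixp[of p] p \<rho> by simp
      also have "\<dots> \<le> \<Lambda> * \<rho>" using a(1) \<Lambda> by (intro mult_left_mono) auto
      finally have "dist a (\<Psi> a) \<le> s0"
        using dist_triangle[of a "\<Psi> a" p] a(1) by (simp add: s0_def dist_commute algebra_simps)
      moreover have "dist a (\<Psi> a) = \<bar>-s\<bar>" using s e by (simp add: dist_norm)
      moreover have "a = \<Psi> a + (-s) *\<^sub>R e" using s by simp
      ultimately have "\<Psi> a \<notin> N" using a(2) unfolding sweep_def by fastforce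
      then have "\<Psi> a \<in> \<Gamma> - N" using into[OF a(1)] by blast
      \<comment> \<open>Slopes on \<Gamma> are multiplied by \<Lambda> in the pull-back, so a
        tolerance \<epsilon> / \<Lambda> becomes \<epsilon>.\<close>
      moreover have "0 < \<epsilon> / \<Lambda>" using eps \<Lambda> by simp
      ultimately obtain r where r: "r > 0"
        "\<And>b. b \<in> \<Gamma> \<Longrightarrow> dist b (\<Psi> a) < r \<Longrightarrow> \<bar>\<phi> b - \<phi> (\<Psi> a)\<bar> \<le> (k + \<epsilon> / \<Lambda>) * dist b (\<Psi> a)"
        using N(2) by blast
      have "\<bar>(\<phi> \<circ> \<Psi>) b - (\<phi> \<circ> \<Psi>) a\<bar> \<le> (\<Lambda> * k + \<epsilon>) * dist b a" if b: "b \<in> ball p \<rho>" "dist b a < r / \<Lambda>" for b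
      proof -
        have "\<Lambda> * dist b a < r" using b(2) \<Lambda> by (simp add: field_simps)
        then have "dist (\<Psi> b) (\<Psi> a) < r" using lip[of b a] by linarith
        then have "\<bar>\<phi> (\<Psi> b) - \<phi> (\<Psi> a)\<bar> \<le> (k + \<epsilon> / \<Lambda>) * dist (\<Psi> b) (\<Psi> a)" by (rule r(2)[OF into[OF b(1)]])
        also have "\<dots> \<le> (k + \<epsilon> / \<Lambda>) * (\<Lambda> * dist b a)" using k eps \<Lambda> by (intro mult_left_mono lip) simp
        also have "\<dots> = (\<Lambda> * k + \<epsilon>) * dist b a" using \<Lambda> by (simp add: field_simps)
        finally show ?thesis by simp
      qed
      moreover have "0 < r / \<Lambda>" using r \<Lambda> by simp
      ultimately show "\<exists>d>0. \<forall>b\<in>ball p \<rho>. dist b a < d \<longrightarrow> \<bar>(\<phi> \<circ> \<Psi>) b - (\<phi> \<circ> \<Psi>) a\<bar> \<le> (\<Lambda> * k + \<epsilon>) * dist b a"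
        by blast
    qed
    then show ?thesis using fixp[OF p] fixp[OF q] \<rho> d by simp
  qed
  show ?thesis
  proof (cases "p = q")
    case False
    obtain g where g: "continuous_on {0..1} g" "g ` {0..1} \<subseteq> \<Gamma>" "g 0 = p" "g 1 = q"
      "curve_length g \<le> ennreal (2 * K * dist p q)"
      using short_path[OF geo[OF pq] K False] by blast
    have "\<bar>\<phi> (g 1) - \<phi> (g 0)\<bar> \<le> (\<Lambda> * k) * (2 * K * dist p q)"
      by (rule path_lipschitz_bound[OF g(1,2,5) _ \<rho> _ loc]) (use K \<Lambda> k in auto)
    then show ?thesis by (simp add: g mult_ac)
  qed simp
qed

text \<open>A Lipschitz function exceeding \<open>C\<close> in modulus at one point does so on a
  surface ball, which has positive outer measure and hence is not contained in the exceptional null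
  set.\<close>

lemma Linf_bound_pointwise:
  fixes \<Gamma> \<tau> :: "'a::euclidean_space set"
  assumes ms: "measure_space (UNIV :: 'a set) (sets borel) (hausdorff_outer (DIM('a) - 1))"
    and pos: "\<And>x r. x \<in> \<Gamma> \<Longrightarrow> 0 < r \<Longrightarrow> 0 < hausdorff_outer (DIM('a) - 1) (\<Gamma> \<inter> ball x r)"
    and \<tau>: "closed \<tau>" and out: "\<And>x. x \<in> \<Gamma> - \<tau> \<Longrightarrow> \<phi> x = 0"
    and bd: "Linf_norm_le \<tau> \<phi> C" and C: "0 \<le> C"
    and lip: "\<And>p q. p \<in> \<Gamma> \<Longrightarrow> q \<in> \<Gamma> \<Longrightarrow> \<bar>\<phi> q - \<phi> p\<bar> \<le> L * dist p q"
    and p: "p \<in> \<Gamma>"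
  shows "\<bar>\<phi> p\<bar> \<le> C"
proof (rule ccontr)
  assume "\<not> ?thesis"
  then have gap: "0 < \<bar>\<phi> p\<bar> - C" by simp
  obtain N where N: "hausdorff_outer (DIM('a) - 1) N = 0" "\<And>x. x \<in> \<tau> - N \<Longrightarrow> \<bar>\<phi> x\<bar> \<le> C"
    using AE_surface_measure_null[OF ms \<tau> bd[unfolded Linf_norm_le_def]] by blast
  define r where "r = (\<bar>\<phi> p\<bar> - C) / (\<bar>L\<bar> + 1)"
  have r: "0 < r" using gap by (simp add: r_def)
  have "\<Gamma> \<inter> ball p r \<subseteq> N"
  proof (rule ccontr)
    assume "\<not> ?thesis"
    then obtain q where q: "q \<in> \<Gamma>" "dist p q < r" "q \<notin> N" by (metis IntE mem_ball subsetI)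
    have "\<bar>\<phi> q\<bar> \<le> C" using N(2)[of q] out[of q] q C by (cases "q \<in> \<tau>") auto
    moreover have "\<bar>\<phi> q - \<phi> p\<bar> \<le> (\<bar>L\<bar> + 1) * dist p q"
      by (rule order_trans[OF lip[OF p q(1)] mult_right_mono]) auto
    moreover have "(\<bar>L\<bar> + 1) * dist p q < \<bar>\<phi> p\<bar> - C" using q(2) by (simp add: r_def field_simps)
    ultimately show False by linarith
  qed
  then have "hausdorff_outer (DIM('a) - 1) (\<Gamma> \<inter> ball p r) \<le> 0" using hausdorff_outer_mono N(1) by metis
  then show False using pos[OF p r] by simp
qed

section \<open>Fractional Sobolev norms\<close>

lemma space_surface_measure [simp]: "space (surface_measure \<tau>) = \<tau>"
  by (simp add: surface_measure_def space_restrict_space)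

lemma surface_measure_nested:
  assumes "\<tau> \<subseteq> \<Gamma>" "\<tau> \<in> sets borel" "\<Gamma> \<in> sets borel"
  shows "surface_measure \<tau> = restrict_space (surface_measure \<Gamma>) \<tau>"
proof -
  have "\<Gamma> \<inter> \<tau> = \<tau>" using assms by blast
  then show ?thesis using assms(2,3) by (simp add: surface_measure_def restrict_restrict_space)
qed

lemma square_sum_le: "(x + y)\<^sup>2 \<le> 2 * x\<^sup>2 + 2 * (y::real)\<^sup>2"
  using zero_le_power2[of "x - y"] by (simp add: power2_sum power2_diff)

lemma ennreal_lincomb_leI:
  assumes "z \<le> a * x + b * y" "0 \<le> a" "0 \<le> x" "0 \<le> b" "0 \<le> y"
  shows "ennreal z \<le> ennreal a * ennreal x + ennreal b * ennreal y"
  using ennreal_leI[OF assms(1)] assms(2-) by (simp add: ennreal_plus ennreal_mult)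

locale finite_surface =
  fixes \<Gamma> :: "'a::euclidean_space set"
  assumes closed: "closed \<Gamma>" and bounded: "bounded \<Gamma>"
    and fin: "emeasure (hausdorff_measure (DIM('a) - 1)) \<Gamma> < \<infinity>"
begin

abbreviation M where "M \<equiv> surface_measure \<Gamma>"

abbreviation kern :: "('a \<Rightarrow> real) \<Rightarrow> 'a \<Rightarrow> 'a \<Rightarrow> ennreal" where
  "kern v t s \<equiv> ennreal (\<bar>v t - v s\<bar>\<^sup>2 / dist t s ^ DIM('a))"

lemma Gamma_sets: "\<Gamma> \<in> sets borel"
  using closed by simp

lemma sets_M: "A \<in> sets borel \<Longrightarrow> A \<subseteq> \<Gamma> \<Longrightarrow> A \<in> sets M"
  using Gamma_sets by (simp add: surface_measure_def sets_restrict_space_iff)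

lemma emeasure_M: "A \<subseteq> \<Gamma> \<Longrightarrow> emeasure M A = emeasure (hausdorff_measure (DIM('a) - 1)) A"
  using Gamma_sets by (simp add: surface_measure_def emeasure_restrict_space)

sublocale finite_measure M
  by (rule finite_measureI) (use fin in \<open>simp add: emeasure_M\<close>)

sublocale P: pair_sigma_finite M M ..

lemma ident_measurable [measurable]: "(\<lambda>x. x) \<in> M \<rightarrow>\<^sub>M borel"
  unfolding surface_measure_def by (intro measurable_restrict_space1 measurable_ident_sets) simp

lemma kern_measurable [measurable]:
  assumes [measurable]: "v \<in> borel_measurable M"
  shows "(\<lambda>p. kern v (fst p) (snd p)) \<in> borel_measurable (M \<Otimes>\<^sub>M M)"
proof -
  have [measurable]: "(\<lambda>p. fst p) \<in> M \<Otimes>\<^sub>M M \<rightarrow>\<^sub>M borel" "(\<lambda>p. snd p) \<in> M \<Otimes>\<^sub>M M \<rightarrow>\<^sub>M borel"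
    by (rule measurable_compose[OF measurable_fst ident_measurable], rule measurable_compose[OF measurable_snd ident_measurable])
  show ?thesis by measurable
qed

lemma integral_kern_measurable [measurable]:
  assumes v: "v \<in> borel_measurable M"
  shows "(\<lambda>t. \<integral>\<^sup>+ s. kern v t s \<partial>M) \<in> borel_measurable M"
  using borel_measurable_nn_integral_fst[OF kern_measurable[OF v]] by simp

section \<open>The linear structure of \<open>H12_space\<close> on representatives\<close>

lemma H12_spaceD:
  assumes "v \<in> H12_space \<Gamma>"
  shows "v \<in> borel_measurable M" "L2_norm_sq \<Gamma> v < \<infinity>" "H12_seminorm_sq \<Gamma> v < \<infinity>"
  using assms by (auto simp: H12_space_def less_top[symmetric])

lemma H12_spaceI:
  assumes "v \<in> borel_measurable M" "L2_norm_sq \<Gamma> v < \<infinity>" "H12_seminorm_sq \<Gamma> v < \<infinity>"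
  shows "v \<in> H12_space \<Gamma>"
  using assms by (auto simp: H12_space_def less_top[symmetric])

lemma kern_lincomb: "kern (\<lambda>x. a * u x + b * v x) t s \<le> ennreal (2 * a\<^sup>2) * kern u t s + ennreal (2 * b\<^sup>2) * kern v t s"
proof -
  have "\<bar>a * u t + b * v t - (a * u s + b * v s)\<bar>\<^sup>2 = (a * (u t - u s) + b * (v t - v s))\<^sup>2"
    by (simp add: algebra_simps)
  also have "\<dots> \<le> 2 * (a * (u t - u s))\<^sup>2 + 2 * (b * (v t - v s))\<^sup>2" by (rule square_sum_le)
  also have "\<dots> = 2 * a\<^sup>2 * \<bar>u t - u s\<bar>\<^sup>2 + 2 * b\<^sup>2 * \<bar>v t - v s\<bar>\<^sup>2" by (simp add: power_mult_distrib)
  finally have "\<bar>a * u t + b * v t - (a * u s + b * v s)\<bar>\<^sup>2 / dist t s ^ DIM('a) \<le>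
      (2 * a\<^sup>2 * \<bar>u t - u s\<bar>\<^sup>2 + 2 * b\<^sup>2 * \<bar>v t - v s\<bar>\<^sup>2) / dist t s ^ DIM('a)"
    by (intro divide_right_mono) auto
  also have "\<dots> = 2 * a\<^sup>2 * (\<bar>u t - u s\<bar>\<^sup>2 / dist t s ^ DIM('a)) + 2 * b\<^sup>2 * (\<bar>v t - v s\<bar>\<^sup>2 / dist t s ^ DIM('a))"
    by (simp add: add_divide_distrib)
  finally show ?thesis by (intro ennreal_lincomb_leI) auto
qed

lemma H12_seminorm_sq_lincomb:
  assumes [measurable]: "u \<in> borel_measurable M" "v \<in> borel_measurable M"
  shows "H12_seminorm_sq \<Gamma> (\<lambda>x. a * u x + b * v x) \<le>
    ennreal (2 * a\<^sup>2) * H12_seminorm_sq \<Gamma> u + ennreal (2 * b\<^sup>2) * H12_seminorm_sq \<Gamma> v"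
proof -
  have "H12_seminorm_sq \<Gamma> (\<lambda>x. a * u x + b * v x) \<le>
     (\<integral>\<^sup>+ t. (\<integral>\<^sup>+ s. ennreal (2 * a\<^sup>2) * kern u t s + ennreal (2 * b\<^sup>2) * kern v t s \<partial>M) \<partial>M)"
    unfolding H12_seminorm_sq_def by (intro nn_integral_mono kern_lincomb)
  also have "\<dots> = ennreal (2 * a\<^sup>2) * H12_seminorm_sq \<Gamma> u + ennreal (2 * b\<^sup>2) * H12_seminorm_sq \<Gamma> v"
    unfolding H12_seminorm_sq_def by (simp add: nn_integral_add nn_integral_cmult)
  finally show ?thesis .
qed

lemma L2_norm_sq_lincomb:
  assumes [measurable]: "u \<in> borel_measurable M" "v \<in> borel_measurable M"
  shows "L2_norm_sq \<Gamma> (\<lambda>x. a * u x + b * v x) \<le>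
    ennreal (2 * a\<^sup>2) * L2_norm_sq \<Gamma> u + ennreal (2 * b\<^sup>2) * L2_norm_sq \<Gamma> v"
proof -
  have "ennreal ((a * u t + b * v t)\<^sup>2) \<le> ennreal (2 * a\<^sup>2) * ennreal ((u t)\<^sup>2) + ennreal (2 * b\<^sup>2) * ennreal ((v t)\<^sup>2)" for t
    using square_sum_le[of "a * u t" "b * v t"]
    by (intro ennreal_lincomb_leI) (auto simp: power_mult_distrib)
  then have "L2_norm_sq \<Gamma> (\<lambda>x. a * u x + b * v x) \<le>
     (\<integral>\<^sup>+ t. ennreal (2 * a\<^sup>2) * ennreal ((u t)\<^sup>2) + ennreal (2 * b\<^sup>2) * ennreal ((v t)\<^sup>2) \<partial>M)"
    unfolding L2_norm_sq_def by (intro nn_integral_mono) auto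
  also have "\<dots> = ennreal (2 * a\<^sup>2) * L2_norm_sq \<Gamma> u + ennreal (2 * b\<^sup>2) * L2_norm_sq \<Gamma> v"
    unfolding L2_norm_sq_def by (simp add: nn_integral_add nn_integral_cmult)
  finally show ?thesis .
qed

lemma H12_lincomb:
  assumes "u \<in> H12_space \<Gamma>" "v \<in> H12_space \<Gamma>"
  shows "(\<lambda>x. a * u x + b * v x) \<in> H12_space \<Gamma>"
proof (rule H12_spaceI)
  note [measurable] = H12_spaceD(1)[OF assms(1)] H12_spaceD(1)[OF assms(2)]
  show "(\<lambda>x. a * u x + b * v x) \<in> borel_measurable M" by measurable
  show "L2_norm_sq \<Gamma> (\<lambda>x. a * u x + b * v x) < \<infinity>" "H12_seminorm_sq \<Gamma> (\<lambda>x. a * u x + b * v x) < \<infinity>"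
    using assms[THEN H12_spaceD(2)] assms[THEN H12_spaceD(3)]
    by (auto intro!: order_le_less_trans[OF L2_norm_sq_lincomb] order_le_less_trans[OF H12_seminorm_sq_lincomb]
        simp: ennreal_mult_less_top)
qed

lemma H12_const: "(\<lambda>x. c) \<in> H12_space \<Gamma>"
  using fin by (intro H12_spaceI) (auto simp: L2_norm_sq_def H12_seminorm_sq_def emeasure_M ennreal_mult_less_top)

lemma H12_cong:
  assumes "u \<in> H12_space \<Gamma>" "\<And>x. x \<in> \<Gamma> \<Longrightarrow> u x = v x"
  shows "v \<in> H12_space \<Gamma>"
proof -
  have "v \<in> borel_measurable M"
    using H12_spaceD(1)[OF assms(1)] by (subst measurable_cong[symmetric, where f=u]) (auto simp: assms(2))
  moreover have "L2_norm_sq \<Gamma> v = L2_norm_sq \<Gamma> u" "H12_seminorm_sq \<Gamma> v = H12_seminorm_sq \<Gamma> u"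
    unfolding L2_norm_sq_def H12_seminorm_sq_def using assms(2) by (auto intro!: nn_integral_cong)
  ultimately show ?thesis using H12_spaceD(2,3)[OF assms(1)] by (intro H12_spaceI) auto
qed

lemma H12_seminorm_sq_cong:
  assumes "\<And>x. x \<in> \<Gamma> \<Longrightarrow> u x = v x" shows "H12_seminorm_sq \<Gamma> u = H12_seminorm_sq \<Gamma> v"
  unfolding H12_seminorm_sq_def using assms by (auto intro!: nn_integral_cong)

lemma H12_seminorm_sq_shift: "H12_seminorm_sq \<Gamma> (\<lambda>x. v x - c) = H12_seminorm_sq \<Gamma> v"
  by (simp add: H12_seminorm_sq_def)

lemma H12_sum:
  assumes "finite I" "\<And>i. i \<in> I \<Longrightarrow> w i \<in> H12_space \<Gamma>"
  shows "(\<lambda>x. \<Sum>i\<in>I. w i x) \<in> H12_space \<Gamma>"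
  using assms
proof (induction I rule: finite_induct)
  case empty
  then show ?case using H12_const[of 0] by simp
next
  case (insert i I)
  then show ?case using H12_lincomb[of "w i" "\<lambda>x. \<Sum>i\<in>I. w i x" 1 1] by simp
qed

lemma H12_zero_AE:
  assumes v: "AE t in M. v t = 0"
  shows "L2_norm_sq \<Gamma> v = 0" "H12_seminorm_sq \<Gamma> v = 0"
proof -
  have "L2_norm_sq \<Gamma> v = (\<integral>\<^sup>+ t. 0 \<partial>M)"
    unfolding L2_norm_sq_def using v by (intro nn_integral_cong_AE) auto
  then show "L2_norm_sq \<Gamma> v = 0" by simp
  have "(\<integral>\<^sup>+ s. kern v t s \<partial>M) = 0" if t: "v t = 0" for t
  proof -
    have "(\<integral>\<^sup>+ s. kern v t s \<partial>M) = (\<integral>\<^sup>+ s. 0 \<partial>M)"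
      using v t by (intro nn_integral_cong_AE) auto
    then show ?thesis by simp
  qed
  then have "H12_seminorm_sq \<Gamma> v = (\<integral>\<^sup>+ t. 0 \<partial>M)"
    unfolding H12_seminorm_sq_def using v by (intro nn_integral_cong_AE) auto
  then show "H12_seminorm_sq \<Gamma> v = 0" by simp
qed

text \<open>The squared seminorm of the restriction to \<tau>. Indicators instead of the measure on
  \<tau> keep all patches on one measure space, where sums and Fubini apply directly.\<close>

definition local_sq :: "'a set \<Rightarrow> ('a \<Rightarrow> real) \<Rightarrow> ennreal" where
  "local_sq \<tau> v = (\<integral>\<^sup>+ t. (\<integral>\<^sup>+ s. kern v t s * indicator \<tau> s \<partial>M) * indicator \<tau> t \<partial>M)"

lemma local_sq_Gamma: "local_sq \<Gamma> v = H12_seminorm_sq \<Gamma> v"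
  unfolding local_sq_def H12_seminorm_sq_def by (auto intro!: nn_integral_cong)

text \<open>
  The constant is a value of v at a well-chosen point; unlike for the mean value no
  integrability of v is needed.
\<close>

lemma local_poincare:
  assumes v [measurable]: "v \<in> borel_measurable M" and \<tau>: "\<tau> \<in> sets M"
    and m: "0 < m" "ennreal m \<le> emeasure M \<tau>"
    and D: "0 \<le> D" "\<And>s t. s \<in> \<tau> \<Longrightarrow> t \<in> \<tau> \<Longrightarrow> dist s t \<le> D"
    and finite: "local_sq \<tau> v < \<infinity>"
  shows "\<exists>c. (\<integral>\<^sup>+ t. ennreal ((v t - c)\<^sup>2) * indicator \<tau> t \<partial>M) \<le> ennreal (D ^ DIM('a) / m) * local_sq \<tau> v"
proof (rule ccontr)
  note [measurable] = \<tau>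
  let ?Dn = "D ^ DIM('a)"
  define B where "B = ennreal (?Dn / m) * local_sq \<tau> v"
  define g where "g s = (\<integral>\<^sup>+ t. ennreal ((v t - v s)\<^sup>2) * indicator \<tau> t \<partial>M)" for s
  assume "\<not> ?thesis"
  then have gB: "B < g s" for s unfolding B_def g_def by (meson not_le)
  have "(\<lambda>p. ennreal ((v (snd p) - v (fst p))\<^sup>2) * indicator \<tau> (snd p)) \<in> borel_measurable (M \<Otimes>\<^sub>M M)"
    by measurable
  then have gm [measurable]: "g \<in> borel_measurable M"
    unfolding g_def using borel_measurable_nn_integral_fst by fastforce
  have Bfin: "B < \<infinity>" using finite by (simp add: B_def ennreal_mult_less_top)
  have \<tau>pos: "0 < emeasure M \<tau>" using m by (metis ennreal_less_zero_iff order_less_le_trans)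
  \<comment> \<open>If no value v s were a suitable constant, integration of B < g s over \<tau>
    would give B |\<tau>| < \<integral> g. But dist s t \<le> D bounds that integral by D^n times
    \<open>local_sq \<tau> v\<close>, which is B m and at most B |\<tau>|.\<close>
  have "(\<integral>\<^sup>+ s. B * indicator \<tau> s \<partial>M) < (\<integral>\<^sup>+ s. g s * indicator \<tau> s \<partial>M)"
  proof (rule nn_integral_less)
    show "(\<integral>\<^sup>+ s. B * indicator \<tau> s \<partial>M) \<noteq> \<infinity>"
      using Bfin by (simp add: nn_integral_cmult_indicator ennreal_mult_eq_top_iff)
    show "AE s in M. B * indicator \<tau> s \<le> g s * indicator \<tau> s"
      using gB by (intro AE_I2 mult_right_mono) (auto simp: less_imp_le)
    show "\<not> (AE s in M. g s * indicator \<tau> s \<le> B * indicator \<tau> s)"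
    proof
      assume "AE s in M. g s * indicator \<tau> s \<le> B * indicator \<tau> s"
      then have "AE s in M. s \<notin> \<tau>"
      proof eventually_elim
        case (elim s)
        then show ?case using gB[of s] by (auto split: split_indicator_asm)
      qed
      then have "\<tau> \<in> null_sets M" using \<tau> by (simp add: AE_iff_null_sets)
      then show False using \<tau>pos by auto
    qed
  qed auto
  also have "(\<integral>\<^sup>+ s. g s * indicator \<tau> s \<partial>M) \<le> (\<integral>\<^sup>+ s. ennreal ?Dn * ((\<integral>\<^sup>+ t. kern v s t * indicator \<tau> t \<partial>M) * indicator \<tau> s) \<partial>M)"
  proof (intro nn_integral_mono)
    fix s
    show "g s * indicator \<tau> s \<le> ennreal ?Dn * ((\<integral>\<^sup>+ t. kern v s t * indicator \<tau> t \<partial>M) * indicator \<tau> s)"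
    proof (cases "s \<in> \<tau>")
      case True
      have "g s \<le> (\<integral>\<^sup>+ t. ennreal ?Dn * (kern v s t * indicator \<tau> t) \<partial>M)"
        unfolding g_def
      proof (intro nn_integral_mono)
        fix t
        show "ennreal ((v t - v s)\<^sup>2) * indicator \<tau> t \<le> ennreal ?Dn * (kern v s t * indicator \<tau> t)"
        proof (cases "t \<in> \<tau> \<and> s \<noteq> t")
          case st: True
          have "dist s t ^ DIM('a) \<le> ?Dn" using D True st by (intro power_mono) auto
          then have "dist s t ^ DIM('a) * (\<bar>v s - v t\<bar>\<^sup>2 / dist s t ^ DIM('a)) \<le> ?Dn * (\<bar>v s - v t\<bar>\<^sup>2 / dist s t ^ DIM('a))"
            by (intro mult_right_mono) auto
          then have "(v t - v s)\<^sup>2 \<le> ?Dn * (\<bar>v s - v t\<bar>\<^sup>2 / dist s t ^ DIM('a))"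
            using st by (simp add: power2_commute)
          then show ?thesis using st D by (simp add: ennreal_mult'[symmetric] ennreal_leI)
        qed (auto split: split_indicator)
      qed
      also have "\<dots> = ennreal ?Dn * (\<integral>\<^sup>+ t. kern v s t * indicator \<tau> t \<partial>M)"
        by (intro nn_integral_cmult) measurable
      finally show ?thesis using True by simp
    qed simp
  qed
  also have "\<dots> = ennreal ?Dn * local_sq \<tau> v"
  proof -
    have "(\<lambda>p. kern v (fst p) (snd p) * indicator \<tau> (snd p)) \<in> borel_measurable (M \<Otimes>\<^sub>M M)" by measurable
    from borel_measurable_nn_integral_fst[OF this]
    have [measurable]: "(\<lambda>s. \<integral>\<^sup>+ t. kern v s t * indicator \<tau> t \<partial>M) \<in> borel_measurable M" by simp
    show ?thesis unfolding local_sq_def by (intro nn_integral_cmult) measurable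
  qed
  also have "\<dots> = B * ennreal m"
    using m D by (simp add: B_def mult.assoc mult.commute[of _ "ennreal m"])
       (simp add: mult.assoc[symmetric] ennreal_mult'[symmetric])
  also have "\<dots> \<le> B * emeasure M \<tau>" using m by (intro mult_left_mono) auto
  finally show False by (simp add: nn_integral_cmult_indicator)
qed

end

section \<open>Dual norms\<close>

context finite_surface
begin

lemma H12_norm_eq:
  assumes "v \<in> H12_space \<Gamma>"
  shows "(H12_norm \<Gamma> v)\<^sup>2 = enn2real (L2_norm_sq \<Gamma> v) + (H12_seminorm \<Gamma> v)\<^sup>2"
  using H12_spaceD(2,3)[OF assms] by (simp add: H12_norm_def H12_seminorm_def enn2real_plus less_top)

lemma H12_norm_nonneg: "0 \<le> H12_norm \<Gamma> v"
  by (simp add: H12_norm_def)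

lemma H12_seminorm_le_norm:
  assumes "v \<in> H12_space \<Gamma>" shows "H12_seminorm \<Gamma> v \<le> H12_norm \<Gamma> v"
proof (rule power2_le_imp_le)
  show "(H12_seminorm \<Gamma> v)\<^sup>2 \<le> (H12_norm \<Gamma> v)\<^sup>2" by (simp add: H12_norm_eq[OF assms])
qed (rule H12_norm_nonneg)

lemma H12_norm_pos:
  assumes v: "v \<in> H12_space \<Gamma>" and nz: "\<not> (AE t in M. v t = 0)"
  shows "0 < H12_norm \<Gamma> v"
proof -
  have "L2_norm_sq \<Gamma> v \<noteq> 0"
  proof
    assume "L2_norm_sq \<Gamma> v = 0"
    then have "AE t in M. ennreal ((v t)\<^sup>2) = 0"
      using H12_spaceD(1)[OF v] by (simp add: L2_norm_sq_def nn_integral_0_iff_AE)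
    then show False using nz by (auto simp: ennreal_eq_0_iff)
  qed
  then have "0 < enn2real (L2_norm_sq \<Gamma> v)"
    using H12_spaceD(2)[OF v] by (simp add: enn2real_positive_iff zero_less_iff_neq_zero less_top)
  then have "0 < (H12_norm \<Gamma> v)\<^sup>2" by (simp add: H12_norm_eq[OF v] add_pos_nonneg)
  then show ?thesis using H12_norm_nonneg[of v] by (simp add: zero_less_power2 order_less_le)
qed

lemma Hm12D:
  assumes "\<zeta> \<in> Hm12_space \<Gamma>"
  shows "u \<in> H12_space \<Gamma> \<Longrightarrow> v \<in> H12_space \<Gamma> \<Longrightarrow> \<zeta> (\<lambda>x. a * u x + b * v x) = a * \<zeta> u + b * \<zeta> v"
    and "\<exists>k\<ge>0. \<forall>v\<in>H12_space \<Gamma>. \<bar>\<zeta> v\<bar> \<le> k * H12_norm \<Gamma> v"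
proof -
  show "u \<in> H12_space \<Gamma> \<Longrightarrow> v \<in> H12_space \<Gamma> \<Longrightarrow> \<zeta> (\<lambda>x. a * u x + b * v x) = a * \<zeta> u + b * \<zeta> v"
    using assms unfolding Hm12_space_def by blast
  obtain k where k: "\<forall>v\<in>H12_space \<Gamma>. \<bar>\<zeta> v\<bar> \<le> k * H12_norm \<Gamma> v"
    using assms unfolding Hm12_space_def by blast
  have "\<bar>\<zeta> v\<bar> \<le> \<bar>k\<bar> * H12_norm \<Gamma> v" if "v \<in> H12_space \<Gamma>" for v
    using bspec[OF k that] mult_right_mono[OF abs_ge_self[of k] H12_norm_nonneg[of v]] by linarith
  then show "\<exists>k\<ge>0. \<forall>v\<in>H12_space \<Gamma>. \<bar>\<zeta> v\<bar> \<le> k * H12_norm \<Gamma> v" by (intro exI[of _ "\<bar>k\<bar>"]) auto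
qed

lemma functional_AE_zero:
  assumes "\<zeta> \<in> Hm12_space \<Gamma>" "v \<in> H12_space \<Gamma>" "AE t in M. v t = 0"
  shows "\<zeta> v = 0"
proof -
  have "H12_norm \<Gamma> v = 0" using H12_zero_AE[OF assms(3)] by (simp add: H12_norm_def)
  then show ?thesis using Hm12D(2)[OF assms(1)] assms(2) by fastforce
qed

text \<open>Functionals act on representatives defined on the whole space; boundedness makes the
  values off \<Gamma> immaterial, as the difference has norm 0.\<close>

lemma functional_cong:
  assumes \<zeta>: "\<zeta> \<in> Hm12_space \<Gamma>" and u: "u \<in> H12_space \<Gamma>" and eq: "\<And>x. x \<in> \<Gamma> \<Longrightarrow> u x = v x"
  shows "\<zeta> u = \<zeta> v"
proof -
  have v: "v \<in> H12_space \<Gamma>" using H12_cong[OF u eq] .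
  have "\<zeta> (\<lambda>x. 1 * u x + (-1) * v x) = 0"
    by (rule functional_AE_zero[OF \<zeta> H12_lincomb[OF u v]]) (rule AE_I2, simp add: eq)
  then show ?thesis using Hm12D(1)[OF \<zeta> u v, of 1 "-1"] by simp
qed

lemma functional_diff:
  assumes \<zeta>: "\<zeta> \<in> Hm12_space \<Gamma>" and u: "u \<in> H12_space \<Gamma>" and v: "v \<in> H12_space \<Gamma>"
  shows "\<zeta> (\<lambda>x. u x - c * v x) = \<zeta> u - c * \<zeta> v"
  using Hm12D(1)[OF \<zeta> u v, of 1 "- c"] by simp

lemma functional_sum:
  assumes \<zeta>: "\<zeta> \<in> Hm12_space \<Gamma>" and "finite I" "\<And>i. i \<in> I \<Longrightarrow> w i \<in> H12_space \<Gamma>"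
  shows "\<zeta> (\<lambda>x. \<Sum>i\<in>I. w i x) = (\<Sum>i\<in>I. \<zeta> (w i))"
  using assms(2,3)
proof (induction I rule: finite_induct)
  case empty
  then show ?case using functional_AE_zero[OF \<zeta> H12_const[of 0]] by simp
next
  case (insert i I)
  then show ?case
    using Hm12D(1)[OF \<zeta>, of "w i" "\<lambda>x. \<Sum>i\<in>I. w i x" 1 1] H12_sum[of I w] by simp
qed

lemma Hm12_norm_finite:
  assumes "\<zeta> \<in> Hm12_space \<Gamma>" shows "Hm12_norm \<Gamma> \<zeta> < \<infinity>"
proof -
  obtain k where k: "0 \<le> k" "\<And>v. v \<in> H12_space \<Gamma> \<Longrightarrow> \<bar>\<zeta> v\<bar> \<le> k * H12_norm \<Gamma> v" using Hm12D(2)[OF assms] by blast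
  have "Hm12_norm \<Gamma> \<zeta> \<le> ennreal k"
    unfolding Hm12_norm_def
  proof (intro SUP_least ennreal_leI)
    fix v assume v: "v \<in> {v \<in> H12_space \<Gamma>. \<not> (AE t in M. v t = 0)}"
    then show "\<zeta> v / H12_norm \<Gamma> v \<le> k"
      using k(2)[of v] H12_norm_pos[of v] by (auto simp: divide_le_eq)
  qed
  then show ?thesis by (simp add: order_le_less_trans)
qed

lemma functional_le:
  assumes \<zeta>: "\<zeta> \<in> Hm12_space \<Gamma>" and v: "v \<in> H12_space \<Gamma>"
  shows "\<zeta> v \<le> enn2real (Hm12_norm \<Gamma> \<zeta>) * H12_norm \<Gamma> v"
proof (cases "AE t in M. v t = 0")
  case True
  then show ?thesis using functional_AE_zero[OF \<zeta> v] H12_norm_nonneg by simp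
next
  case False
  then have "ennreal (\<zeta> v / H12_norm \<Gamma> v) \<le> Hm12_norm \<Gamma> \<zeta>"
    unfolding Hm12_norm_def using v by (intro SUP_upper) auto
  also have "\<dots> = ennreal (enn2real (Hm12_norm \<Gamma> \<zeta>))" using Hm12_norm_finite[OF \<zeta>] by (simp add: less_top)
  finally have "\<zeta> v / H12_norm \<Gamma> v \<le> enn2real (Hm12_norm \<Gamma> \<zeta>)" by (simp add: ennreal_le_iff)
  then show ?thesis using H12_norm_pos[OF v False] by (simp add: divide_le_eq)
qed

text \<open>\<open>local_poincare\<close> on all of \<Gamma> supplies a constant, which \<zeta> does
  not see and whose subtraction leaves the seminorm unchanged but makes it control the L2
  part.\<close>

lemma functional_seminorm_le:
  assumes \<zeta>: "\<zeta> \<in> Hm12_space \<Gamma>" and one: "\<zeta> (\<lambda>x. 1) = 0" and v: "v \<in> H12_space \<Gamma>"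
    and m: "0 < m" "ennreal m \<le> emeasure M \<Gamma>"
  shows "\<zeta> v \<le> enn2real (Hm12_norm \<Gamma> \<zeta>) * sqrt (1 + diameter \<Gamma> ^ DIM('a) / m) * H12_seminorm \<Gamma> v"
proof -
  let ?D = "diameter \<Gamma>"
  have D0: "0 \<le> ?D" using bounded by (rule diameter_ge_0)
  have E: "local_sq \<Gamma> v < \<infinity>" using H12_spaceD(3)[OF v] by (simp add: local_sq_Gamma)
  obtain c where c: "(\<integral>\<^sup>+ t. ennreal ((v t - c)\<^sup>2) * indicator \<Gamma> t \<partial>M) \<le> ennreal (?D ^ DIM('a) / m) * local_sq \<Gamma> v"
    using local_poincare[OF H12_spaceD(1)[OF v] sets_M[OF Gamma_sets order_refl] m D0 _ E]
      diameter_bounded_bound[OF bounded] by blast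
  define w where "w = (\<lambda>x. v x - c)"
  have wH: "w \<in> H12_space \<Gamma>" using H12_lincomb[OF v H12_const[of 1], of 1 "- c"] by (simp add: w_def)
  have "L2_norm_sq \<Gamma> w = (\<integral>\<^sup>+ t. ennreal ((v t - c)\<^sup>2) * indicator \<Gamma> t \<partial>M)"
    unfolding L2_norm_sq_def w_def by (intro nn_integral_cong) simp
  then have "L2_norm_sq \<Gamma> w \<le> ennreal (?D ^ DIM('a) / m) * H12_seminorm_sq \<Gamma> v"
    using c by (simp add: local_sq_Gamma)
  then have "enn2real (L2_norm_sq \<Gamma> w) \<le> enn2real (ennreal (?D ^ DIM('a) / m) * H12_seminorm_sq \<Gamma> v)"
    using H12_spaceD(3)[OF v] by (intro enn2real_mono) (auto simp: ennreal_mult_less_top)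
  also have "\<dots> = ?D ^ DIM('a) / m * (H12_seminorm \<Gamma> v)\<^sup>2"
    using D0 m by (simp add: enn2real_mult H12_seminorm_def)
  finally have L: "enn2real (L2_norm_sq \<Gamma> w) \<le> ?D ^ DIM('a) / m * (H12_seminorm \<Gamma> v)\<^sup>2" .
  have S: "H12_seminorm \<Gamma> w = H12_seminorm \<Gamma> v"
    by (simp add: H12_seminorm_def w_def H12_seminorm_sq_shift)
  have "(H12_norm \<Gamma> w)\<^sup>2 \<le> (1 + ?D ^ DIM('a) / m) * (H12_seminorm \<Gamma> v)\<^sup>2"
    using L by (simp add: H12_norm_eq[OF wH] S algebra_simps)
  then have "H12_norm \<Gamma> w \<le> sqrt ((1 + ?D ^ DIM('a) / m) * (H12_seminorm \<Gamma> v)\<^sup>2)" by (rule real_le_rsqrt)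
  also have "\<dots> = sqrt (1 + ?D ^ DIM('a) / m) * H12_seminorm \<Gamma> v"
    by (simp add: real_sqrt_mult H12_seminorm_def)
  finally have N: "H12_norm \<Gamma> w \<le> sqrt (1 + ?D ^ DIM('a) / m) * H12_seminorm \<Gamma> v" .
  have "\<zeta> v = \<zeta> w" using functional_diff[OF \<zeta> v H12_const[of 1], of c] one by (simp add: w_def)
  also have "\<dots> \<le> enn2real (Hm12_norm \<Gamma> \<zeta>) * H12_norm \<Gamma> w" by (rule functional_le[OF \<zeta> wH])
  also have "\<dots> \<le> enn2real (Hm12_norm \<Gamma> \<zeta>) * (sqrt (1 + ?D ^ DIM('a) / m) * H12_seminorm \<Gamma> v)"
    using N by (intro mult_left_mono) auto
  finally show ?thesis by (simp add: mult.assoc)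
qed

section \<open>Finite overlap and the lower bound\<close>

lemma finite_overlap_seminorm:
  assumes I: "finite I" and w: "\<And>i. i \<in> I \<Longrightarrow> w i \<in> H12_space \<Gamma>"
    and out: "\<And>i x. i \<in> I \<Longrightarrow> x \<in> \<Gamma> - \<tau> i \<Longrightarrow> w i x = 0"
    and N: "\<And>x. x \<in> \<Gamma> \<Longrightarrow> real (card {i\<in>I. x \<in> \<tau> i}) \<le> N"
  shows "H12_seminorm_sq \<Gamma> (\<lambda>x. \<Sum>i\<in>I. w i x) \<le> ennreal (2 * N) * (\<Sum>i\<in>I. H12_seminorm_sq \<Gamma> (w i))"
proof (cases "\<Gamma> = {}")
  case True
  then show ?thesis by (simp add: H12_seminorm_sq_def nn_integral_empty)
next
  case False
  then have N0: "0 \<le> N" using N by (meson ex_in_conv of_nat_0_le_iff order_trans)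
  have pt: "kern (\<lambda>x. \<Sum>i\<in>I. w i x) t s \<le> ennreal (2 * N) * (\<Sum>i\<in>I. kern (w i) t s)"
    if t: "t \<in> \<Gamma>" and s: "s \<in> \<Gamma>" for t s
  proof -
    define J where "J = {i\<in>I. t \<in> \<tau> i} \<union> {i\<in>I. s \<in> \<tau> i}"
    have J: "J \<subseteq> I" "finite J" using I by (auto simp: J_def)
    have "card J \<le> card {i\<in>I. t \<in> \<tau> i} + card {i\<in>I. s \<in> \<tau> i}" unfolding J_def by (rule card_Un_le)
    then have cJ: "real (card J) \<le> 2 * N" using N[OF t] N[OF s] by linarith
    have "(\<Sum>i\<in>I. w i t) - (\<Sum>i\<in>I. w i s) = (\<Sum>i\<in>I. w i t - w i s)" by (rule sum_subtractf[symmetric])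
    also have "\<dots> = (\<Sum>i\<in>J. w i t - w i s)"
      using I J(1) out t s by (intro sum.mono_neutral_right) (auto simp: J_def)
    finally have "((\<Sum>i\<in>I. w i t) - (\<Sum>i\<in>I. w i s))\<^sup>2 = (\<Sum>i\<in>J. w i t - w i s)\<^sup>2" by simp
    also have "\<dots> \<le> (\<Sum>i\<in>J. (w i t - w i s)\<^sup>2) * real (card J)"
      by (rule sum_squared_le_sum_of_squares)
    also have "\<dots> \<le> (\<Sum>i\<in>I. (w i t - w i s)\<^sup>2) * (2 * N)"
      using cJ N0 I J by (intro mult_mono sum_mono2) (auto intro: sum_nonneg)
    finally have "\<bar>(\<Sum>i\<in>I. w i t) - (\<Sum>i\<in>I. w i s)\<bar>\<^sup>2 / dist t s ^ DIM('a) \<le>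
        (\<Sum>i\<in>I. (w i t - w i s)\<^sup>2) * (2 * N) / dist t s ^ DIM('a)"
      by (intro divide_right_mono) auto
    also have "\<dots> = 2 * N * (\<Sum>i\<in>I. \<bar>w i t - w i s\<bar>\<^sup>2 / dist t s ^ DIM('a))"
      by (simp add: sum_divide_distrib[symmetric])
    finally have "kern (\<lambda>x. \<Sum>i\<in>I. w i x) t s \<le> ennreal (2 * N * (\<Sum>i\<in>I. \<bar>w i t - w i s\<bar>\<^sup>2 / dist t s ^ DIM('a)))"
      by (rule ennreal_leI)
    also have "\<dots> = ennreal (2 * N) * (\<Sum>i\<in>I. kern (w i) t s)"
      using N0 by (subst ennreal_mult) (auto intro: sum_nonneg simp: sum_ennreal)
    finally show ?thesis .
  qed
  note [measurable] = H12_spaceD(1)[OF w]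
  have "H12_seminorm_sq \<Gamma> (\<lambda>x. \<Sum>i\<in>I. w i x) \<le> (\<integral>\<^sup>+ t. (\<integral>\<^sup>+ s. ennreal (2 * N) * (\<Sum>i\<in>I. kern (w i) t s) \<partial>M) \<partial>M)"
    unfolding H12_seminorm_sq_def using pt by (intro nn_integral_mono) auto
  also have "\<dots> = ennreal (2 * N) * (\<Sum>i\<in>I. H12_seminorm_sq \<Gamma> (w i))"
    unfolding H12_seminorm_sq_def by (simp add: nn_integral_cmult nn_integral_sum del: sum_ennreal power2_abs)
  finally show ?thesis .
qed

text \<open>The witnesses are normalised so that pairing and squared seminorm are both comparable to
  (r i)^2. With R the sum of these squares, testing with the sum of the witnesses gives R \<le> A
  sqrt P sqrt (2 N R), where one factor sqrt R cancels.\<close>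

lemma lower_estimate_witnesses:
  assumes \<zeta>: "\<zeta> \<in> Hm12_space \<Gamma>" and one: "\<zeta> (\<lambda>x. 1) = 0" and m: "0 < m" "ennreal m \<le> emeasure M \<Gamma>"
    and I: "finite I" and w: "\<And>i. i \<in> I \<Longrightarrow> w i \<in> H12_space \<Gamma>"
    and out: "\<And>i x. i \<in> I \<Longrightarrow> x \<in> \<Gamma> - \<tau> i \<Longrightarrow> w i x = 0"
    and N: "\<And>x. x \<in> \<Gamma> \<Longrightarrow> real (card {i\<in>I. x \<in> \<tau> i}) \<le> N" "0 \<le> N"
    and r: "\<And>i. i \<in> I \<Longrightarrow> H12_seminorm_sq \<Gamma> (w i) \<le> ennreal ((r i)\<^sup>2)" "\<And>i. i \<in> I \<Longrightarrow> (r i)\<^sup>2 \<le> \<zeta> (w i)"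
  shows "(\<Sum>i\<in>I. (r i)\<^sup>2) \<le> 2 * N * (1 + diameter \<Gamma> ^ DIM('a) / m) * (enn2real (Hm12_norm \<Gamma> \<zeta>))\<^sup>2"
proof -
  define R where "R = (\<Sum>i\<in>I. (r i)\<^sup>2)"
  define W where "W = (\<lambda>x. \<Sum>i\<in>I. w i x)"
  define A where "A = enn2real (Hm12_norm \<Gamma> \<zeta>)"
  define P where "P = 1 + diameter \<Gamma> ^ DIM('a) / m"
  have P0: "0 \<le> P" using m diameter_ge_0[OF bounded] by (simp add: P_def)
  have R0: "0 \<le> R" by (simp add: R_def sum_nonneg)
  have WH: "W \<in> H12_space \<Gamma>" unfolding W_def using H12_sum[OF I w] .
  have "H12_seminorm_sq \<Gamma> W \<le> ennreal (2 * N) * (\<Sum>i\<in>I. H12_seminorm_sq \<Gamma> (w i))"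
    unfolding W_def by (rule finite_overlap_seminorm[OF I w out N(1)])
  also have "\<dots> \<le> ennreal (2 * N) * (\<Sum>i\<in>I. ennreal ((r i)\<^sup>2))"
    using r(1) by (intro mult_left_mono sum_mono) auto
  also have "\<dots> = ennreal (2 * N * R)"
    using N(2) by (simp add: R_def sum_nonneg ennreal_mult')
  finally have "enn2real (H12_seminorm_sq \<Gamma> W) \<le> 2 * N * R" using N(2) R0 by (intro enn2real_leI) auto
  then have sW: "H12_seminorm \<Gamma> W \<le> sqrt (2 * N * R)" by (simp add: H12_seminorm_def)
  have "R \<le> (\<Sum>i\<in>I. \<zeta> (w i))" unfolding R_def using r(2) by (intro sum_mono) auto
  also have "\<dots> = \<zeta> W" unfolding W_def using functional_sum[OF \<zeta> I w] by simp
  also have "\<dots> \<le> A * sqrt P * H12_seminorm \<Gamma> W"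
    unfolding A_def P_def by (rule functional_seminorm_le[OF \<zeta> one WH m])
  also have "\<dots> \<le> A * sqrt P * sqrt (2 * N * R)" using sW P0 by (intro mult_left_mono) (auto simp: A_def)
  finally have "R\<^sup>2 \<le> (A * sqrt P * sqrt (2 * N * R))\<^sup>2" using R0 by (rule power_mono)
  also have "\<dots> = (2 * N * P * A\<^sup>2) * R" using P0 N(2) R0 by (simp add: power_mult_distrib)
  finally have "R * R \<le> (2 * N * P * A\<^sup>2) * R" by (simp add: power2_eq_square)
  then have "R \<le> 2 * N * P * A\<^sup>2"
    using R0 P0 N(2) by (cases "R = 0") (auto simp: mult_le_cancel_right)
  then show ?thesis by (simp add: R_def P_def A_def)
qed

abbreviation patch_norm :: "'a set \<Rightarrow> (('a \<Rightarrow> real) \<Rightarrow> real) \<Rightarrow> ennreal" where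
  "patch_norm \<tau> \<zeta> \<equiv> tilde_Hm12_norm \<Gamma> \<tau> (restrict_dual \<tau> \<zeta>)"

text \<open>Finiteness of the patch norms is asserted separately since the upper bound, too,
  computes with their real values.\<close>

lemma lower_estimate:
  assumes \<zeta>: "\<zeta> \<in> Hm12_space \<Gamma>" and one: "\<zeta> (\<lambda>x. 1) = 0" and m: "0 < m" "ennreal m \<le> emeasure M \<Gamma>"
    and I: "finite I" and N: "\<And>x. x \<in> \<Gamma> \<Longrightarrow> real (card {i\<in>I. x \<in> \<tau> i}) \<le> N" "0 \<le> N"
  shows "i \<in> I \<Longrightarrow> patch_norm (\<tau> i) \<zeta> < \<infinity>"
    and "(\<Sum>i\<in>I. (patch_norm (\<tau> i) \<zeta>)\<^sup>2)
      \<le> ennreal (2 * N * (1 + diameter \<Gamma> ^ DIM('a) / m)) * (Hm12_norm \<Gamma> \<zeta>)\<^sup>2"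
proof -
  define A where "A = enn2real (Hm12_norm \<Gamma> \<zeta>)"
  define P where "P = 1 + diameter \<Gamma> ^ DIM('a) / m"
  have P0: "0 \<le> P" using m diameter_ge_0[OF bounded] by (simp add: P_def)
  define T where "T i = patch_norm (\<tau> i) \<zeta>" for i
  have Tle: "T i \<le> ennreal (A * sqrt P)" for i
    unfolding T_def tilde_Hm12_norm_def
  proof (intro SUP_least ennreal_leI)
    fix v assume v: "v \<in> {v \<in> H1200_space \<Gamma> (\<tau> i). \<not> (AE t in surface_measure (\<tau> i). v t = 0)}"
    then have "zero_ext (\<tau> i) v \<in> H12_space \<Gamma>" by (simp add: H1200_space_def)
    then have "\<zeta> (zero_ext (\<tau> i) v) \<le> A * sqrt P * H1200_norm \<Gamma> (\<tau> i) v"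
      unfolding A_def P_def H1200_norm_def by (rule functional_seminorm_le[OF \<zeta> one _ m])
    moreover have "0 \<le> H1200_norm \<Gamma> (\<tau> i) v" by (simp add: H1200_norm_def H12_seminorm_def)
    \<comment> \<open>A vanishing seminorm makes the quotient 0, by the convention for division by
      0.\<close>
    ultimately show "restrict_dual (\<tau> i) \<zeta> v / H1200_norm \<Gamma> (\<tau> i) v \<le> A * sqrt P"
      using P0 by (cases "H1200_norm \<Gamma> (\<tau> i) v = 0") (auto simp: restrict_dual_def A_def divide_le_eq)
  qed
  have Tfin: "T i < \<infinity>" for i using Tle[of i] by (simp add: order_le_less_trans)
  then show "i \<in> I \<Longrightarrow> patch_norm (\<tau> i) \<zeta> < \<infinity>" by (simp add: T_def)
  define b where "b i = enn2real (T i)" for i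
  have Tb: "T i = ennreal (b i)" and b0: "0 \<le> b i" for i using Tfin[of i] by (auto simp: b_def less_top)
  \<comment> \<open>The supremum need not be attained, so each patch norm is approached only up to
    the factor \<theta> < 1.\<close>
  have wit: "\<exists>w. w \<in> H12_space \<Gamma> \<and> (\<forall>x\<in>\<Gamma> - \<tau> i. w x = 0) \<and> H12_seminorm_sq \<Gamma> w \<le> ennreal ((\<theta> * b i)\<^sup>2) \<and> (\<theta> * b i)\<^sup>2 \<le> \<zeta> w"
    if \<theta>: "0 < \<theta>" "\<theta> < 1" for \<theta> i
  proof (cases "b i = 0")
    case True
    then show ?thesis
      using functional_AE_zero[OF \<zeta> H12_const[of 0]] H12_const[of 0] H12_zero_AE[of "\<lambda>x. 0"]
      by (intro exI[of _ "\<lambda>x. 0"]) auto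
  next
    case False
    then have bp: "0 < b i" using b0[of i] by simp
    then have "ennreal (\<theta> * b i) < T i" using \<theta> by (simp add: Tb ennreal_lessI)
    then obtain v where v: "v \<in> H1200_space \<Gamma> (\<tau> i)"
      "ennreal (\<theta> * b i) < ennreal (restrict_dual (\<tau> i) \<zeta> v / H1200_norm \<Gamma> (\<tau> i) v)"
      unfolding T_def tilde_Hm12_norm_def less_SUP_iff by blast
    define u where "u = zero_ext (\<tau> i) v"
    define q where "q = H12_seminorm \<Gamma> u"
    have uH: "u \<in> H12_space \<Gamma>" using v(1) by (simp add: u_def H1200_space_def)
    have "\<theta> * b i < \<zeta> u / q"
      using v(2) \<theta> bp by (simp add: ennreal_less_iff restrict_dual_def H1200_norm_def u_def q_def)
    moreover have "0 \<le> q" by (simp add: q_def H12_seminorm_def)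
    moreover have "0 < \<theta> * b i" using \<theta> bp by simp
    ultimately have q: "0 < q" "\<theta> * b i * q < \<zeta> u" by (cases "q = 0"; simp add: less_divide_eq)+
    \<comment> \<open>This scaling gives the test function the seminorm \<theta> \<open>b i\<close>,
      equal to the lower bound for its quotient, so that pairing and squared seminorm match.\<close>
    define a where "a = \<theta> * b i / q"
    have a: "0 < a" "a * q = \<theta> * b i" using q \<theta> bp by (auto simp: a_def)
    define w where "w = (\<lambda>x. a * u x)"
    have wH: "w \<in> H12_space \<Gamma>" and \<zeta>w: "\<zeta> w = a * \<zeta> u"
      using H12_lincomb[OF uH uH, of a 0] Hm12D(1)[OF \<zeta> uH uH, of a 0] by (auto simp: w_def)
    have "(\<theta> * b i)\<^sup>2 = a * (\<theta> * b i * q)" using a by (simp add: power2_eq_square)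
    also have "\<dots> \<le> \<zeta> w" using q a by (simp add: \<zeta>w)
    finally have 1: "(\<theta> * b i)\<^sup>2 \<le> \<zeta> w" .
    have "kern w t s = ennreal (a\<^sup>2) * kern u t s" for t s
      by (simp add: w_def ennreal_mult'[symmetric] right_diff_distrib[symmetric] abs_mult power_mult_distrib)
    then have "H12_seminorm_sq \<Gamma> w = ennreal (a\<^sup>2) * H12_seminorm_sq \<Gamma> u"
      unfolding H12_seminorm_sq_def using H12_spaceD(1)[OF uH] by (simp add: nn_integral_cmult)
    also have "H12_seminorm_sq \<Gamma> u = ennreal (q\<^sup>2)"
      using H12_spaceD(3)[OF uH] by (simp add: q_def H12_seminorm_def less_top)
    also have "ennreal (a\<^sup>2) * ennreal (q\<^sup>2) = ennreal ((\<theta> * b i)\<^sup>2)"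
      by (simp add: ennreal_mult'[symmetric] power_mult_distrib[symmetric] a)
    finally have 2: "H12_seminorm_sq \<Gamma> w \<le> ennreal ((\<theta> * b i)\<^sup>2)" by simp
    have 3: "w x = 0" if "x \<in> \<Gamma> - \<tau> i" for x using that by (simp add: w_def u_def zero_ext_def)
    show ?thesis using wH 1 2 3 by blast
  qed
  have real: "(\<Sum>i\<in>I. (b i)\<^sup>2) \<le> 2 * N * P * A\<^sup>2"
  proof (rule field_le_mult_one_interval)
    fix z :: real assume z: "0 < z" "z < 1"
    \<comment> \<open>The factor enters squared, and its square \<open>z\<close> runs through the
      open unit interval.\<close>
    define \<theta> where "\<theta> = sqrt z"
    have \<theta>: "0 < \<theta>" "\<theta> < 1" "\<theta>\<^sup>2 = z" using z by (auto simp: \<theta>_def)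
    obtain w where w: "\<And>i. w i \<in> H12_space \<Gamma>" "\<And>i. \<forall>x\<in>\<Gamma> - \<tau> i. w i x = 0"
      "\<And>i. H12_seminorm_sq \<Gamma> (w i) \<le> ennreal ((\<theta> * b i)\<^sup>2)" "\<And>i. (\<theta> * b i)\<^sup>2 \<le> \<zeta> (w i)"
      using wit[OF \<theta>(1,2)] by metis
    have "(\<Sum>i\<in>I. (\<theta> * b i)\<^sup>2) \<le> 2 * N * P * A\<^sup>2"
      unfolding P_def A_def using w
      by (intro lower_estimate_witnesses[OF \<zeta> one m I, where w=w and \<tau>=\<tau>] N) auto
    then show "z * (\<Sum>i\<in>I. (b i)\<^sup>2) \<le> 2 * N * P * A\<^sup>2" by (simp add: power_mult_distrib \<theta>(3) sum_distrib_left)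
  qed
  have "(\<Sum>i\<in>I. (T i)\<^sup>2) = ennreal (\<Sum>i\<in>I. (b i)\<^sup>2)"
    using b0 by (simp add: Tb ennreal_power sum_ennreal)
  also have "\<dots> \<le> ennreal (2 * N * P * A\<^sup>2)" using real by (rule ennreal_leI)
  also have "\<dots> = ennreal (2 * N * P) * (ennreal A)\<^sup>2"
    using N(2) P0 by (simp add: ennreal_mult' ennreal_power A_def)
  also have "ennreal A = Hm12_norm \<Gamma> \<zeta>" using Hm12_norm_finite[OF \<zeta>] by (simp add: A_def less_top)
  finally show "(\<Sum>i\<in>I. (patch_norm (\<tau> i) \<zeta>)\<^sup>2)
      \<le> ennreal (2 * N * (1 + diameter \<Gamma> ^ DIM('a) / m)) * (Hm12_norm \<Gamma> \<zeta>)\<^sup>2" by (simp add: T_def P_def)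
qed

end

section \<open>Products with Lipschitz functions\<close>

lemma dyadic_above:
  fixes x :: real assumes "1 \<le> x" shows "\<exists>k. 2 ^ k \<le> x \<and> x < 2 ^ Suc k"
proof -
  define n where "n = (LEAST n. x < 2 ^ n)"
  have "\<exists>n. x < 2 ^ n" using real_arch_pow[of 2 x] by simp
  then have n: "x < 2 ^ n" unfolding n_def by (rule LeastI_ex)
  then have "n \<noteq> 0" using assms by (intro notI) simp
  then obtain k where k: "n = Suc k" using not0_implies_Suc by blast
  then have "\<not> x < 2 ^ k" using not_less_Least[of k "\<lambda>n. x < 2 ^ n"] by (simp add: n_def)
  then show ?thesis using n k by (intro exI[of _ k]) auto
qed

lemma dyadic_below:
  fixes x :: real assumes "0 < x" "x < 1" shows "\<exists>k. (1/2) ^ Suc k \<le> x \<and> x < (1/2) ^ k"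
proof -
  define n where "n = (LEAST n. (1/2) ^ n \<le> x)"
  have "\<exists>n. (1/2) ^ n \<le> x" using real_arch_pow_inv[of x "1/2"] assms by (auto intro: less_imp_le)
  then have n: "(1/2) ^ n \<le> x" unfolding n_def by (rule LeastI_ex)
  then have "n \<noteq> 0" using assms by (intro notI) simp
  then obtain k where k: "n = Suc k" using not0_implies_Suc by blast
  then have "\<not> (1/2) ^ k \<le> x" using not_less_Least[of k "\<lambda>n. (1/2) ^ n \<le> x"] by (simp add: n_def)
  then show ?thesis using n k by (intro exI[of _ k]) auto
qed

lemma ennreal_le_suminf: "f k \<le> (\<Sum>i. f i :: ennreal)"
  using sum_le_suminf[of f "{k}"] by simp

lemma suminf_ennreal_half: "0 \<le> K \<Longrightarrow> (\<Sum>k. ennreal (K * (1/2) ^ k)) = ennreal (2 * K)"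
  using sums_mult[OF geometric_sums[of "1/2 :: real"], of K] by (intro suminf_ennreal_eq) (auto simp: mult.commute)

context finite_surface
begin

text \<open>At distance r from t, volume growth contributes r^(n-1) and the kernel r^(-n). For r
  \<ge> h the oscillation bound gives B^2 / r, and for r < h the Lipschitz bound gives P^2 r / h^2.
  Over dyadic shells both sum geometrically to the order 1/h.\<close>

lemma kernel_bound:
  assumes dim: "2 \<le> DIM('a)" and A: "0 \<le> A"
    and up: "\<And>x r. x \<in> \<Gamma> \<Longrightarrow> 0 < r \<Longrightarrow> emeasure M (\<Gamma> \<inter> ball x r) \<le> ennreal (A * r ^ (DIM('a) - 1))"
    and h: "0 < h"
    and lip: "\<And>p q. p \<in> \<Gamma> \<Longrightarrow> q \<in> \<Gamma> \<Longrightarrow> \<bar>\<phi> q - \<phi> p\<bar> \<le> P / h * dist p q"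
    and bd: "\<And>p q. p \<in> \<Gamma> \<Longrightarrow> q \<in> \<Gamma> \<Longrightarrow> \<bar>\<phi> q - \<phi> p\<bar> \<le> B" and t: "t \<in> \<Gamma>"
  shows "(\<integral>\<^sup>+ s. kern \<phi> t s \<partial>M) \<le> ennreal (A * 2 ^ DIM('a) * (B\<^sup>2 + 2 * P\<^sup>2) / h)"
proof -
  let ?n = "DIM('a)" and ?d = "DIM('a) - 1"
  have pn: "x ^ ?n = x * x ^ ?d" for x :: real using dim by (cases ?n) auto
  define F where "F = (\<lambda>k::nat. B\<^sup>2 / (2 ^ k * h) ^ ?n)"
  define G where "G = (\<lambda>k::nat. (P / h)\<^sup>2 * ((1/2) ^ k * h)\<^sup>2 / ((1/2) ^ Suc k * h) ^ ?n)"
  \<comment> \<open>Whole balls replace the shells: \<open>F\<close> and \<open>G\<close> bound the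
    kernel on the shells, and overcounting is harmless for an upper bound.\<close>
  define UF where "UF = (\<lambda>k::nat. \<Gamma> \<inter> ball t (2 ^ Suc k * h))"
  define UG where "UG = (\<lambda>k::nat. \<Gamma> \<inter> ball t ((1/2) ^ k * h))"
  have F0: "0 \<le> F k" and G0: "0 \<le> G k" for k using h by (auto simp: F_def G_def)
  have [measurable]: "UF k \<in> sets M" "UG k \<in> sets M" for k
    unfolding UF_def UG_def using Gamma_sets by (auto intro!: sets_M)
  have pt: "kern \<phi> t s \<le> (\<Sum>k. ennreal (F k) * indicator (UF k) s) + (\<Sum>k. ennreal (G k) * indicator (UG k) s)"
    if s: "s \<in> \<Gamma>" for s
  proof (cases "s = t")
    case True
    then show ?thesis by simp
  next
    case False
    define x where "x = dist t s / h"
    have x: "0 < x" "dist t s = x * h" using False h by (auto simp: x_def)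
    show ?thesis
    proof (cases "1 \<le> x")
      case True
      then obtain k where k: "2 ^ k \<le> x" "x < 2 ^ Suc k" using dyadic_above by blast
      have "\<bar>\<phi> t - \<phi> s\<bar>\<^sup>2 \<le> B\<^sup>2" using bd[OF s t] by (intro power_mono) auto
      moreover have "(2 ^ k * h) ^ ?n \<le> dist t s ^ ?n" using k h x by (intro power_mono) auto
      ultimately have "\<bar>\<phi> t - \<phi> s\<bar>\<^sup>2 / dist t s ^ ?n \<le> F k"
        unfolding F_def using h by (intro frac_le) auto
      moreover have "s \<in> UF k" using k s h x by (auto simp: UF_def)
      ultimately have "kern \<phi> t s \<le> ennreal (F k) * indicator (UF k) s" by (simp add: ennreal_leI)
      also have "\<dots> \<le> (\<Sum>k. ennreal (F k) * indicator (UF k) s)"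
        by (rule ennreal_le_suminf[of "\<lambda>k. ennreal (F k) * indicator (UF k) s"])
      finally show ?thesis by (rule order_trans) simp
    next
      case False
      then obtain k where k: "(1/2) ^ Suc k \<le> x" "x < (1/2) ^ k" using dyadic_below[OF x(1)] by auto
      have "\<bar>\<phi> t - \<phi> s\<bar> \<le> P / h * dist t s" using lip[OF s t] by (simp add: dist_commute)
      then have "\<bar>\<phi> t - \<phi> s\<bar>\<^sup>2 \<le> (P / h * dist t s)\<^sup>2" by (intro power_mono) auto
      also have "\<dots> = (P / h)\<^sup>2 * (dist t s)\<^sup>2" by (rule power_mult_distrib)
      also have "\<dots> \<le> (P / h)\<^sup>2 * ((1/2) ^ k * h)\<^sup>2"
        using k x h by (intro mult_left_mono power_mono) auto
      finally have "\<bar>\<phi> t - \<phi> s\<bar>\<^sup>2 \<le> (P / h)\<^sup>2 * ((1/2) ^ k * h)\<^sup>2" .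
      moreover have "((1/2) ^ Suc k * h) ^ ?n \<le> dist t s ^ ?n"
        unfolding x(2) using k(1) h by (intro power_mono mult_right_mono) auto
      ultimately have "\<bar>\<phi> t - \<phi> s\<bar>\<^sup>2 / dist t s ^ ?n \<le> G k"
        unfolding G_def using h by (intro frac_le) auto
      moreover have "s \<in> UG k" using k s h x by (auto simp: UG_def)
      ultimately have "kern \<phi> t s \<le> ennreal (G k) * indicator (UG k) s" by (simp add: ennreal_leI)
      also have "\<dots> \<le> (\<Sum>k. ennreal (G k) * indicator (UG k) s)"
        by (rule ennreal_le_suminf[of "\<lambda>k. ennreal (G k) * indicator (UG k) s"])
      finally show ?thesis by (rule order_trans) simp
    qed
  qed
  have IF: "(\<integral>\<^sup>+ s. ennreal (F k) * indicator (UF k) s \<partial>M) \<le> ennreal (A * 2 ^ ?d * B\<^sup>2 / h * (1/2) ^ k)" for k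
  proof -
    have "(\<integral>\<^sup>+ s. ennreal (F k) * indicator (UF k) s \<partial>M) = ennreal (F k) * emeasure M (UF k)"
      by (simp add: nn_integral_cmult_indicator)
    also have "\<dots> \<le> ennreal (F k) * ennreal (A * (2 ^ Suc k * h) ^ ?d)"
      unfolding UF_def using h t by (intro mult_left_mono up) auto
    also have "\<dots> = ennreal (F k * (A * (2 ^ Suc k * h) ^ ?d))" using F0 by (simp add: ennreal_mult')
    also have "F k * (A * (2 ^ Suc k * h) ^ ?d) = A * 2 ^ ?d * B\<^sup>2 / h * (1/2) ^ k"
    proof -
      have "(2 ^ Suc k * h) ^ ?d = 2 ^ ?d * (2 ^ k * h) ^ ?d" by (simp add: power_mult_distrib)
      moreover have "(2 ^ k * h) ^ ?n = 2 ^ k * h * (2 ^ k * h) ^ ?d" by (rule pn)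
      ultimately show ?thesis using h by (simp add: F_def power_divide mult_ac)
    qed
    finally show ?thesis .
  qed
  have IG: "(\<integral>\<^sup>+ s. ennreal (G k) * indicator (UG k) s \<partial>M) \<le> ennreal (A * 2 ^ ?n * P\<^sup>2 / h * (1/2) ^ k)" for k
  proof -
    have "(\<integral>\<^sup>+ s. ennreal (G k) * indicator (UG k) s \<partial>M) = ennreal (G k) * emeasure M (UG k)"
      by (simp add: nn_integral_cmult_indicator)
    also have "\<dots> \<le> ennreal (G k) * ennreal (A * ((1/2) ^ k * h) ^ ?d)"
      unfolding UG_def using h t by (intro mult_left_mono up) auto
    also have "\<dots> = ennreal (G k * (A * ((1/2) ^ k * h) ^ ?d))" using G0 by (simp add: ennreal_mult')
    also have "G k * (A * ((1/2) ^ k * h) ^ ?d) = A * 2 ^ ?n * P\<^sup>2 / h * (1/2) ^ k"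
    proof -
      define y where "y = (1/2) ^ k * h"
      have y: "0 < y" using h by (simp add: y_def)
      have "((1/2) ^ Suc k * h) ^ ?n = (y / 2) ^ ?n" by (simp add: y_def)
      also have "\<dots> = y * y ^ ?d / 2 ^ ?n" by (simp add: power_divide pn[of y])
      finally have "G k = (P / h)\<^sup>2 * y\<^sup>2 / (y * y ^ ?d / 2 ^ ?n)" by (simp add: G_def y_def)
      then have "G k * (A * y ^ ?d) = (P / h)\<^sup>2 * y\<^sup>2 / (y * y ^ ?d / 2 ^ ?n) * (A * y ^ ?d)" by simp
      also have "\<dots> = A * 2 ^ ?n * (P / h)\<^sup>2 * y" using y by (simp add: power2_eq_square)
      also have "\<dots> = A * 2 ^ ?n * P\<^sup>2 / h * (1/2) ^ k" using h by (simp add: y_def power2_eq_square)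
      finally show ?thesis by (simp add: y_def)
    qed
    finally show ?thesis .
  qed
  have "(\<integral>\<^sup>+ s. kern \<phi> t s \<partial>M) \<le>
     (\<integral>\<^sup>+ s. (\<Sum>k. ennreal (F k) * indicator (UF k) s) + (\<Sum>k. ennreal (G k) * indicator (UG k) s) \<partial>M)"
    using pt by (intro nn_integral_mono) auto
  also have "\<dots> = (\<Sum>k. \<integral>\<^sup>+ s. ennreal (F k) * indicator (UF k) s \<partial>M) + (\<Sum>k. \<integral>\<^sup>+ s. ennreal (G k) * indicator (UG k) s \<partial>M)"
    by (subst nn_integral_add) (auto simp: nn_integral_suminf)
  also have "\<dots> \<le> (\<Sum>k. ennreal (A * 2 ^ ?d * B\<^sup>2 / h * (1/2) ^ k)) + (\<Sum>k. ennreal (A * 2 ^ ?n * P\<^sup>2 / h * (1/2) ^ k))"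
    using IF IG by (intro add_mono suminf_le) auto
  also have "\<dots> = ennreal (2 * (A * 2 ^ ?d * B\<^sup>2 / h)) + ennreal (2 * (A * 2 ^ ?n * P\<^sup>2 / h))"
    using A h by (subst (1 2) suminf_ennreal_half) auto
  also have "\<dots> = ennreal (2 * (A * 2 ^ ?d * B\<^sup>2 / h) + 2 * (A * 2 ^ ?n * P\<^sup>2 / h))"
    using A h by (subst ennreal_plus) auto
  also have "2 * (A * 2 ^ ?d * B\<^sup>2 / h) + 2 * (A * 2 ^ ?n * P\<^sup>2 / h) = A * 2 ^ ?n * (B\<^sup>2 + 2 * P\<^sup>2) / h"
  proof -
    have "(2::real) ^ ?n = 2 * 2 ^ ?d" by (rule pn)
    then show ?thesis using h by (simp add: field_simps)
  qed
  finally show ?thesis .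
qed

text \<open>With both points in \<tau>, the difference is \<phi> s (v t - v s) + (v t - c) (\<phi> t
  - \<phi> s). With one point in \<tau>, \<phi> vanishes at the other and only a term of the second
  kind remains, centred at t or at s; hence the two symmetric terms.\<close>

lemma kern_product:
  assumes bd: "\<And>p. p \<in> \<Gamma> \<Longrightarrow> \<bar>\<phi> p\<bar> \<le> B" and out: "\<And>x. x \<in> \<Gamma> - \<tau> \<Longrightarrow> \<phi> x = 0"
    and ts: "t \<in> \<Gamma>" "s \<in> \<Gamma>"
  shows "kern (\<lambda>x. \<phi> x * (v x - c)) t s \<le>
    ennreal (2 * B\<^sup>2) * (kern v t s * indicator \<tau> s * indicator \<tau> t) +
    (2 * (ennreal ((v t - c)\<^sup>2) * indicator \<tau> t * kern \<phi> t s) + 2 * (ennreal ((v s - c)\<^sup>2) * indicator \<tau> s * kern \<phi> t s))"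
proof -
  define D where "D = dist t s ^ DIM('a)"
  have D: "0 \<le> D" by (simp add: D_def)
  define it js where "it = indicat_real \<tau> t" and "js = indicat_real \<tau> s"
  have ind: "0 \<le> it" "0 \<le> js" by (auto simp: it_def js_def)
  have real: "(\<phi> t * (v t - c) - \<phi> s * (v s - c))\<^sup>2 \<le>
      2 * B\<^sup>2 * ((v t - v s)\<^sup>2 * js * it) +
      (2 * ((v t - c)\<^sup>2 * it * (\<phi> t - \<phi> s)\<^sup>2) + 2 * ((v s - c)\<^sup>2 * js * (\<phi> t - \<phi> s)\<^sup>2))"
  proof (cases "t \<in> \<tau>")
    case t: True
    show ?thesis
    proof (cases "s \<in> \<tau>")
      case True
      have "\<phi> t * (v t - c) - \<phi> s * (v s - c) = \<phi> s * (v t - v s) + (v t - c) * (\<phi> t - \<phi> s)"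
        by (simp add: algebra_simps)
      then have "(\<phi> t * (v t - c) - \<phi> s * (v s - c))\<^sup>2 \<le> 2 * (\<phi> s * (v t - v s))\<^sup>2 + 2 * ((v t - c) * (\<phi> t - \<phi> s))\<^sup>2"
        by (simp add: square_sum_le)
      moreover have "(\<phi> s)\<^sup>2 \<le> B\<^sup>2" using power_mono[OF bd[OF ts(2)], of 2] by simp
      then have "(\<phi> s * (v t - v s))\<^sup>2 \<le> B\<^sup>2 * (v t - v s)\<^sup>2" by (simp add: power_mult_distrib mult_right_mono)
      moreover have "0 \<le> (v s - c)\<^sup>2 * (\<phi> t - \<phi> s)\<^sup>2" by simp
      moreover have "it = 1" "js = 1" using t True by (auto simp: it_def js_def)
      ultimately show ?thesis unfolding power_mult_distrib by (simp only: mult_1_right)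
    next
      case False
      then have "\<phi> s = 0" using out ts by blast
      moreover have "0 \<le> (v t - c)\<^sup>2 * (\<phi> t)\<^sup>2" by simp
      ultimately show ?thesis using t False by (simp add: it_def js_def power_mult_distrib mult.commute)
    qed
  next
    case t: False
    then have ft: "\<phi> t = 0" using out ts by blast
    show ?thesis
    proof (cases "s \<in> \<tau>")
      case True
      have "0 \<le> (v s - c)\<^sup>2 * (\<phi> s)\<^sup>2" by simp
      then show ?thesis using t ft True by (simp add: it_def js_def power_mult_distrib mult.commute)
    next
      case False
      then have "\<phi> s = 0" using out ts by blast
      then show ?thesis using t ft False by (simp add: it_def js_def)
    qed
  qed
  define a b e where "a = (v t - v s)\<^sup>2 / D * js * it" and "b = (v t - c)\<^sup>2 * it * ((\<phi> t - \<phi> s)\<^sup>2 / D)"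
    and "e = (v s - c)\<^sup>2 * js * ((\<phi> t - \<phi> s)\<^sup>2 / D)"
  have abe: "0 \<le> a" "0 \<le> b" "0 \<le> e" using ind D by (auto simp: a_def b_def e_def)
  have "(\<phi> t * (v t - c) - \<phi> s * (v s - c))\<^sup>2 / D \<le>
      (2 * B\<^sup>2 * ((v t - v s)\<^sup>2 * js * it) +
      (2 * ((v t - c)\<^sup>2 * it * (\<phi> t - \<phi> s)\<^sup>2) + 2 * ((v s - c)\<^sup>2 * js * (\<phi> t - \<phi> s)\<^sup>2))) / D"
    using real D by (rule divide_right_mono)
  also have "\<dots> = 2 * B\<^sup>2 * a + (2 * b + 2 * e)"
    by (simp add: add_divide_distrib a_def b_def e_def)
  finally have "kern (\<lambda>x. \<phi> x * (v x - c)) t s \<le> ennreal (2 * B\<^sup>2 * a + (2 * b + 2 * e))"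
    by (simp add: D_def ennreal_leI)
  also have "\<dots> = ennreal (2 * B\<^sup>2) * ennreal a + (2 * ennreal b + 2 * ennreal e)"
    using abe by (simp add: ennreal_plus ennreal_mult)
  also have "ennreal a = kern v t s * indicator \<tau> s * indicator \<tau> t"
    using D by (simp add: a_def it_def js_def D_def ennreal_mult split: split_indicator)
  also have "ennreal b = ennreal ((v t - c)\<^sup>2) * indicator \<tau> t * kern \<phi> t s"
    by (cases "t \<in> \<tau>") (simp_all add: b_def it_def D_def ennreal_mult[symmetric])
  also have "ennreal e = ennreal ((v s - c)\<^sup>2) * indicator \<tau> s * kern \<phi> t s"
    by (cases "s \<in> \<tau>") (simp_all add: e_def js_def D_def ennreal_mult[symmetric])
  finally show ?thesis .
qed

text \<open>The kernel is symmetric, so Fubini turns the term weighted at s into the one weighted at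
  t; 2 + 2 gives the factor 4.\<close>

lemma product_estimate:
  assumes v [measurable]: "v \<in> borel_measurable M" and \<phi> [measurable]: "\<phi> \<in> borel_measurable M"
    and \<tau> [measurable]: "\<tau> \<in> sets M"
    and bd: "\<And>p. p \<in> \<Gamma> \<Longrightarrow> \<bar>\<phi> p\<bar> \<le> B" and out: "\<And>x. x \<in> \<Gamma> - \<tau> \<Longrightarrow> \<phi> x = 0"
    and ker: "\<And>t. t \<in> \<Gamma> \<Longrightarrow> (\<integral>\<^sup>+ s. kern \<phi> t s \<partial>M) \<le> k"
  shows "H12_seminorm_sq \<Gamma> (\<lambda>x. \<phi> x * (v x - c)) \<le>
     ennreal (2 * B\<^sup>2) * local_sq \<tau> v + 4 * k * (\<integral>\<^sup>+ t. ennreal ((v t - c)\<^sup>2) * indicator \<tau> t \<partial>M)"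
proof -
  define W where "W = (\<lambda>t. ennreal ((v t - c)\<^sup>2) * indicator \<tau> t)"
  have [measurable]: "W \<in> borel_measurable M" unfolding W_def by measurable
  have m1: "(\<lambda>p. kern v (fst p) (snd p) * indicator \<tau> (snd p) * indicator \<tau> (fst p)) \<in> borel_measurable (M \<Otimes>\<^sub>M M)"
    and m2: "(\<lambda>p. W (fst p) * kern \<phi> (fst p) (snd p)) \<in> borel_measurable (M \<Otimes>\<^sub>M M)"
    and m3: "(\<lambda>p. W (snd p) * kern \<phi> (fst p) (snd p)) \<in> borel_measurable (M \<Otimes>\<^sub>M M)"
    by measurable
  note [measurable] = borel_measurable_nn_integral_fst[OF m1, simplified]
    borel_measurable_nn_integral_fst[OF m2, simplified] borel_measurable_nn_integral_fst[OF m3, simplified]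
  have W1: "(\<integral>\<^sup>+ t. (\<integral>\<^sup>+ s. W t * kern \<phi> t s \<partial>M) \<partial>M) \<le> k * (\<integral>\<^sup>+ t. W t \<partial>M)"
  proof -
    have "(\<integral>\<^sup>+ t. (\<integral>\<^sup>+ s. W t * kern \<phi> t s \<partial>M) \<partial>M) \<le> (\<integral>\<^sup>+ t. k * W t \<partial>M)"
    proof (intro nn_integral_mono)
      fix t assume "t \<in> space M"
      then show "(\<integral>\<^sup>+ s. W t * kern \<phi> t s \<partial>M) \<le> k * W t"
        using ker[of t] by (simp add: nn_integral_cmult mult.commute[of k] mult_left_mono del: power2_abs)
    qed
    also have "\<dots> = k * (\<integral>\<^sup>+ t. W t \<partial>M)" by (rule nn_integral_cmult) measurable
    finally show ?thesis .
  qed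
  have swap: "(\<integral>\<^sup>+ t. (\<integral>\<^sup>+ s. W s * kern \<phi> t s \<partial>M) \<partial>M) = (\<integral>\<^sup>+ t. (\<integral>\<^sup>+ s. W t * kern \<phi> t s \<partial>M) \<partial>M)"
  proof -
    have "(\<integral>\<^sup>+ t. (\<integral>\<^sup>+ s. W s * kern \<phi> t s \<partial>M) \<partial>M) = (\<integral>\<^sup>+ s. (\<integral>\<^sup>+ t. W s * kern \<phi> t s \<partial>M) \<partial>M)"
      using m3 by (intro P.Fubini'[symmetric]) (simp add: case_prod_beta')
    then show ?thesis by (simp add: dist_commute abs_minus_commute del: power2_abs)
  qed
  have "H12_seminorm_sq \<Gamma> (\<lambda>x. \<phi> x * (v x - c)) \<le>
    (\<integral>\<^sup>+ t. (\<integral>\<^sup>+ s. ennreal (2 * B\<^sup>2) * (kern v t s * indicator \<tau> s * indicator \<tau> t) +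
       (2 * (W t * kern \<phi> t s) + 2 * (W s * kern \<phi> t s)) \<partial>M) \<partial>M)"
    unfolding H12_seminorm_sq_def W_def using kern_product[of \<phi> B \<tau> _ _ v c, OF bd out]
    by (intro nn_integral_mono) auto
  also have "\<dots> = (\<integral>\<^sup>+ t. ennreal (2 * B\<^sup>2) * (\<integral>\<^sup>+ s. kern v t s * indicator \<tau> s * indicator \<tau> t \<partial>M) +
       (2 * (\<integral>\<^sup>+ s. W t * kern \<phi> t s \<partial>M) + 2 * (\<integral>\<^sup>+ s. W s * kern \<phi> t s \<partial>M)) \<partial>M)"
    by (intro nn_integral_cong) (simp add: nn_integral_add nn_integral_cmult del: power2_abs)
  also have "\<dots> = ennreal (2 * B\<^sup>2) * (\<integral>\<^sup>+ t. (\<integral>\<^sup>+ s. kern v t s * indicator \<tau> s * indicator \<tau> t \<partial>M) \<partial>M) +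
       (2 * (\<integral>\<^sup>+ t. (\<integral>\<^sup>+ s. W t * kern \<phi> t s \<partial>M) \<partial>M) + 2 * (\<integral>\<^sup>+ t. (\<integral>\<^sup>+ s. W s * kern \<phi> t s \<partial>M) \<partial>M))"
    by (simp add: nn_integral_add nn_integral_cmult del: power2_abs)
  also have "(\<integral>\<^sup>+ t. (\<integral>\<^sup>+ s. kern v t s * indicator \<tau> s * indicator \<tau> t \<partial>M) \<partial>M) = local_sq \<tau> v"
    unfolding local_sq_def by (simp add: nn_integral_multc del: power2_abs)
  also have "2 * (\<integral>\<^sup>+ t. (\<integral>\<^sup>+ s. W t * kern \<phi> t s \<partial>M) \<partial>M) + 2 * (\<integral>\<^sup>+ t. (\<integral>\<^sup>+ s. W s * kern \<phi> t s \<partial>M) \<partial>M)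
     = 4 * (\<integral>\<^sup>+ t. (\<integral>\<^sup>+ s. W t * kern \<phi> t s \<partial>M) \<partial>M)"
    unfolding swap by (simp add: distrib_right[symmetric])
  also have "ennreal (2 * B\<^sup>2) * local_sq \<tau> v + 4 * (\<integral>\<^sup>+ t. (\<integral>\<^sup>+ s. W t * kern \<phi> t s \<partial>M) \<partial>M)
     \<le> ennreal (2 * B\<^sup>2) * local_sq \<tau> v + 4 * (k * (\<integral>\<^sup>+ t. W t \<partial>M))"
    using W1 by (intro add_left_mono mult_left_mono) auto
  finally show ?thesis by (simp add: W_def mult.assoc)
qed

end

section \<open>Functions supported in a patch, and the upper bound\<close>

context finite_surface
begin

text \<open>A function on \<Gamma> that vanishes off \<tau> is its own extension by zero. The third
  claim ensures that it competes in the supremum of the patch norm unless it is zero on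
  \<Gamma>.\<close>

lemma restrict_to_patch:
  assumes \<tau>: "\<tau> \<subseteq> \<Gamma>" "\<tau> \<in> sets borel" and u: "u \<in> H12_space \<Gamma>" and out: "\<And>x. x \<in> \<Gamma> - \<tau> \<Longrightarrow> u x = 0"
  shows "u \<in> H1200_space \<Gamma> \<tau>" "H1200_norm \<Gamma> \<tau> u = H12_seminorm \<Gamma> u"
    and "(AE t in surface_measure \<tau>. u t = 0) \<Longrightarrow> AE t in M. u t = 0"
proof -
  have eq: "surface_measure \<tau> = restrict_space M \<tau>" by (rule surface_measure_nested[OF \<tau> Gamma_sets])
  have \<tau>M: "\<tau> \<inter> space M \<in> sets M" using sets_M[OF \<tau>(2,1)] \<tau>(1) by (simp add: Int_absorb2)
  have ext: "zero_ext \<tau> u x = u x" if "x \<in> \<Gamma>" for x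
    using out that by (cases "x \<in> \<tau>") (auto simp: zero_ext_def)
  have meas: "u \<in> borel_measurable (surface_measure \<tau>)"
    unfolding eq using H12_spaceD(1)[OF u] by (rule measurable_restrict_space1)
  have restr: "(\<integral>\<^sup>+ t. f t \<partial>surface_measure \<tau>) \<le> (\<integral>\<^sup>+ t. f t \<partial>M)" for f :: "'a \<Rightarrow> ennreal"
    unfolding eq nn_integral_restrict_space[OF \<tau>M]
    by (intro nn_integral_mono) (simp add: indicator_def)
  have "L2_norm_sq \<tau> u \<le> L2_norm_sq \<Gamma> u" unfolding L2_norm_sq_def by (rule restr)
  moreover have "H12_seminorm_sq \<tau> u \<le> H12_seminorm_sq \<Gamma> u"
    unfolding H12_seminorm_sq_def by (rule order_trans[OF restr nn_integral_mono[OF restr]])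
  ultimately have "u \<in> H12_space \<tau>"
    using meas H12_spaceD(2,3)[OF u] unfolding H12_space_def
    by (simp add: order_le_less_trans)
  moreover have "zero_ext \<tau> u \<in> H12_space \<Gamma>" using H12_cong[OF u] ext by metis
  ultimately show "u \<in> H1200_space \<Gamma> \<tau>" by (simp add: H1200_space_def)
  show "H1200_norm \<Gamma> \<tau> u = H12_seminorm \<Gamma> u"
    unfolding H1200_norm_def H12_seminorm_def using H12_seminorm_sq_cong[OF ext] by simp
  show "AE t in M. u t = 0" if "AE t in surface_measure \<tau>. u t = 0"
  proof -
    have "AE t in M. t \<in> \<tau> \<longrightarrow> u t = 0" using that unfolding eq AE_restrict_space_iff[OF \<tau>M] .
    moreover have "AE t in M. t \<in> \<Gamma>" by (rule AE_I2) simp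
    ultimately show ?thesis
    proof eventually_elim
      case (elim t)
      then show ?case using out by (cases "t \<in> \<tau>") auto
    qed
  qed
qed

lemma functional_one:
  assumes \<zeta>: "\<zeta> \<in> Hm12_space \<Gamma>" and I: "finite I" and \<phi>: "\<And>i. i \<in> I \<Longrightarrow> \<phi> i \<in> H12_space \<Gamma>"
    and unity: "\<And>x. x \<in> \<Gamma> \<Longrightarrow> (\<Sum>i\<in>I. \<phi> i x) = 1" and orth: "\<And>i. i \<in> I \<Longrightarrow> \<zeta> (\<phi> i) = 0"
  shows "\<zeta> (\<lambda>x. 1) = 0"
proof -
  have "\<zeta> (\<lambda>x. \<Sum>i\<in>I. \<phi> i x) = 0" using functional_sum[OF \<zeta> I \<phi>] orth by simp
  moreover have "\<zeta> (\<lambda>x. \<Sum>i\<in>I. \<phi> i x) = \<zeta> (\<lambda>x. 1)"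
    by (rule functional_cong[OF \<zeta> H12_sum[OF I \<phi>]]) (simp_all add: unity)
  ultimately show ?thesis by simp
qed

text \<open>\<open>H1200_norm\<close> is a mere seminorm when \<tau> exhausts \<Gamma>. Where it
  vanishes, the quotient in the supremum is 0 by convention and carries no information;
  \<open>functional_seminorm_le\<close> then yields \<zeta> u \<le> 0 instead.\<close>

lemma functional_patch_le:
  assumes \<zeta>: "\<zeta> \<in> Hm12_space \<Gamma>" and one: "\<zeta> (\<lambda>x. 1) = 0" and m: "0 < m" "ennreal m \<le> emeasure M \<Gamma>"
    and \<tau>: "\<tau> \<subseteq> \<Gamma>" "\<tau> \<in> sets borel" and u: "u \<in> H12_space \<Gamma>" and out: "\<And>x. x \<in> \<Gamma> - \<tau> \<Longrightarrow> u x = 0"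
    and fin: "patch_norm \<tau> \<zeta> < \<infinity>"
  shows "\<zeta> u \<le> enn2real (patch_norm \<tau> \<zeta>) * H12_seminorm \<Gamma> u"
proof -
  note patch = restrict_to_patch[OF \<tau> u out]
  let ?T = "patch_norm \<tau> \<zeta>"
  have s0: "0 \<le> H12_seminorm \<Gamma> u" by (simp add: H12_seminorm_def)
  have "\<zeta> u = \<zeta> (zero_ext \<tau> u)"
    by (rule functional_cong[OF \<zeta> u]) (use out in \<open>auto simp: zero_ext_def\<close>)
  then have \<zeta>u: "restrict_dual \<tau> \<zeta> u = \<zeta> u" by (simp add: restrict_dual_def)
  consider "H12_seminorm \<Gamma> u = 0" | "AE t in M. u t = 0" | "0 < H12_seminorm \<Gamma> u" "\<not> (AE t in M. u t = 0)"
    using s0 by fastforce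
  then show ?thesis
  proof cases
    case 1
    then show ?thesis using functional_seminorm_le[OF \<zeta> one u m] by simp
  next
    case 2
    then show ?thesis using functional_AE_zero[OF \<zeta> u] s0 by simp
  next
    case 3
    then have "u \<in> {v \<in> H1200_space \<Gamma> \<tau>. \<not> (AE t in surface_measure \<tau>. v t = 0)}" using patch(1,3) by blast
    then have "ennreal (restrict_dual \<tau> \<zeta> u / H1200_norm \<Gamma> \<tau> u) \<le> ?T"
      unfolding tilde_Hm12_norm_def by (rule SUP_upper)
    also have "\<dots> = ennreal (enn2real ?T)" using fin by (simp add: less_top)
    finally have "\<zeta> u / H1200_norm \<Gamma> \<tau> u \<le> enn2real ?T" by (simp add: \<zeta>u ennreal_le_iff)
    moreover have "H1200_norm \<Gamma> \<tau> u = H12_seminorm \<Gamma> u" by (rule restrict_to_patch(2)[OF \<tau> u out])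
    ultimately have "\<zeta> u / H12_seminorm \<Gamma> u \<le> enn2real ?T" by simp
    then show ?thesis using 3(1) by (simp add: divide_le_eq)
  qed
qed

lemma H12_product:
  assumes \<phi>: "\<phi> \<in> borel_measurable M" and v: "v \<in> H12_space \<Gamma>"
    and bd: "\<And>p. p \<in> \<Gamma> \<Longrightarrow> \<bar>\<phi> p\<bar> \<le> B" and fin: "H12_seminorm_sq \<Gamma> (\<lambda>x. \<phi> x * v x) < \<infinity>"
  shows "(\<lambda>x. \<phi> x * v x) \<in> H12_space \<Gamma>"
proof (rule H12_spaceI[OF _ _ fin])
  note [measurable] = \<phi> H12_spaceD(1)[OF v]
  show "(\<lambda>x. \<phi> x * v x) \<in> borel_measurable M" by measurable
  have "L2_norm_sq \<Gamma> (\<lambda>x. \<phi> x * v x) \<le> (\<integral>\<^sup>+ t. ennreal (B\<^sup>2) * ennreal ((v t)\<^sup>2) \<partial>M)"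
    unfolding L2_norm_sq_def
  proof (intro nn_integral_mono)
    fix t assume "t \<in> space M"
    then have "(\<phi> t)\<^sup>2 \<le> B\<^sup>2" using power_mono[OF bd[of t], of 2] by simp
    then show "ennreal ((\<phi> t * v t)\<^sup>2) \<le> ennreal (B\<^sup>2) * ennreal ((v t)\<^sup>2)"
      by (simp add: power_mult_distrib ennreal_mult'[symmetric] ennreal_leI mult_right_mono)
  qed
  also have "\<dots> = ennreal (B\<^sup>2) * L2_norm_sq \<Gamma> v" unfolding L2_norm_sq_def by (rule nn_integral_cmult) measurable
  also have "\<dots> < \<infinity>" using H12_spaceD(2)[OF v] by (simp add: ennreal_mult_less_top)
  finally show "L2_norm_sq \<Gamma> (\<lambda>x. \<phi> x * v x) < \<infinity>" .
qed

text \<open>The indicator in s is dropped, and the indicators in t sum to the overlap number at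
  t.\<close>

lemma sum_local_sq_le:
  assumes v [measurable]: "v \<in> borel_measurable M" and I: "finite I" and \<tau>: "\<And>i. i \<in> I \<Longrightarrow> \<tau> i \<in> sets M"
    and N: "\<And>x. x \<in> \<Gamma> \<Longrightarrow> real (card {i\<in>I. x \<in> \<tau> i}) \<le> N"
  shows "(\<Sum>i\<in>I. local_sq (\<tau> i) v) \<le> ennreal N * H12_seminorm_sq \<Gamma> v"
proof -
  have le: "local_sq (\<tau> i) v \<le> (\<integral>\<^sup>+ t. (\<integral>\<^sup>+ s. kern v t s \<partial>M) * indicator (\<tau> i) t \<partial>M)" for i
    unfolding local_sq_def by (intro nn_integral_mono mult_right_mono) (auto simp: indicator_def)
  note [measurable] = \<tau> integral_kern_measurable[OF v]
  have "(\<Sum>i\<in>I. local_sq (\<tau> i) v) \<le> (\<Sum>i\<in>I. \<integral>\<^sup>+ t. (\<integral>\<^sup>+ s. kern v t s \<partial>M) * indicator (\<tau> i) t \<partial>M)"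
    by (intro sum_mono le)
  also have "\<dots> = (\<integral>\<^sup>+ t. (\<Sum>i\<in>I. (\<integral>\<^sup>+ s. kern v t s \<partial>M) * indicator (\<tau> i) t) \<partial>M)"
    by (intro nn_integral_sum[symmetric] borel_measurable_times_ennreal) auto
  also have "\<dots> \<le> (\<integral>\<^sup>+ t. ennreal N * (\<integral>\<^sup>+ s. kern v t s \<partial>M) \<partial>M)"
  proof (intro nn_integral_mono)
    fix t assume "t \<in> space M"
    then have t: "t \<in> \<Gamma>" by simp
    have "(\<Sum>i\<in>I. indicator (\<tau> i) t :: ennreal) = of_nat (card {i\<in>I. t \<in> \<tau> i})"
      using I by (simp add: indicator_def sum.If_cases Int_def)
    also have "\<dots> \<le> ennreal N" using N[OF t] by (simp add: ennreal_of_nat_eq_real_of_nat ennreal_leI)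
    finally show "(\<Sum>i\<in>I. (\<integral>\<^sup>+ s. kern v t s \<partial>M) * indicator (\<tau> i) t) \<le> ennreal N * (\<integral>\<^sup>+ s. kern v t s \<partial>M)"
      by (simp only: sum_distrib_left[symmetric] mult.commute[of "ennreal N"]) (rule mult_left_mono, simp_all)
  qed
  also have "\<dots> = ennreal N * H12_seminorm_sq \<Gamma> v"
    unfolding H12_seminorm_sq_def by (rule nn_integral_cmult) measurable
  finally show ?thesis .
qed

text \<open>The kernel contributes C1 / h and the Poincare inequality on a patch D^n h / a, so the
  local constant C2 is free of h. The patch contributions are then combined by the discrete
  Cauchy-Schwarz inequality and finite overlap.\<close>

lemma upper_estimate:
  assumes dim: "2 \<le> DIM('a)" and A: "0 \<le> A"
    and up: "\<And>x r. x \<in> \<Gamma> \<Longrightarrow> 0 < r \<Longrightarrow> emeasure M (\<Gamma> \<inter> ball x r) \<le> ennreal (A * r ^ (DIM('a) - 1))"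
    and h: "0 < h" and B: "0 \<le> B" and a: "0 < a" and D: "0 \<le> D" and N0: "0 \<le> N"
    and I: "finite I" and \<tau>: "\<And>i. i \<in> I \<Longrightarrow> \<tau> i \<subseteq> \<Gamma>" "\<And>i. i \<in> I \<Longrightarrow> \<tau> i \<in> sets borel"
    and diam: "\<And>i s t. i \<in> I \<Longrightarrow> s \<in> \<tau> i \<Longrightarrow> t \<in> \<tau> i \<Longrightarrow> dist s t \<le> D * h"
    and low: "\<And>i. i \<in> I \<Longrightarrow> ennreal (a * h ^ (DIM('a) - 1)) \<le> emeasure M (\<tau> i)"
    and N: "\<And>x. x \<in> \<Gamma> \<Longrightarrow> real (card {i\<in>I. x \<in> \<tau> i}) \<le> N"
    and \<phi>: "\<And>i. i \<in> I \<Longrightarrow> \<phi> i \<in> H12_space \<Gamma>"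
    and bd: "\<And>i p. i \<in> I \<Longrightarrow> p \<in> \<Gamma> \<Longrightarrow> \<bar>\<phi> i p\<bar> \<le> B" and out: "\<And>i x. i \<in> I \<Longrightarrow> x \<in> \<Gamma> - \<tau> i \<Longrightarrow> \<phi> i x = 0"
    and lip: "\<And>i p q. i \<in> I \<Longrightarrow> p \<in> \<Gamma> \<Longrightarrow> q \<in> \<Gamma> \<Longrightarrow> \<bar>\<phi> i q - \<phi> i p\<bar> \<le> P / h * dist p q"
    and unity: "\<And>x. x \<in> \<Gamma> \<Longrightarrow> (\<Sum>i\<in>I. \<phi> i x) = 1"
    and \<zeta>: "\<zeta> \<in> Hm12_space \<Gamma>" and orth: "\<And>i. i \<in> I \<Longrightarrow> \<zeta> (\<phi> i) = 0"
    and m: "0 < m" "ennreal m \<le> emeasure M \<Gamma>"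
    and Tfin: "\<And>i. i \<in> I \<Longrightarrow> patch_norm (\<tau> i) \<zeta> < \<infinity>"
  shows "(Hm12_norm \<Gamma> \<zeta>)\<^sup>2 \<le> ennreal ((2 * B\<^sup>2 + 4 * (A * 2 ^ DIM('a) * ((2 * B)\<^sup>2 + 2 * P\<^sup>2)) * D ^ DIM('a) / a) * N) *
    (\<Sum>i\<in>I. (patch_norm (\<tau> i) \<zeta>)\<^sup>2)"
proof -
  define C1 where "C1 = A * 2 ^ DIM('a) * ((2 * B)\<^sup>2 + 2 * P\<^sup>2)"
  define C2 where "C2 = 2 * B\<^sup>2 + 4 * C1 * D ^ DIM('a) / a"
  have C1: "0 \<le> C1" using A by (simp add: C1_def)
  have C2: "0 \<le> C2" using C1 D a by (simp add: C2_def)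
  define T where "T i = enn2real (patch_norm (\<tau> i) \<zeta>)" for i
  have T: "patch_norm (\<tau> i) \<zeta> = ennreal (T i)" if "i \<in> I" for i
    using Tfin[OF that] by (simp add: T_def less_top)
  have T0: "0 \<le> T i" for i by (simp add: T_def)
  have one: "\<zeta> (\<lambda>x. 1) = 0" by (rule functional_one[OF \<zeta> I \<phi> unity orth])
  have ker: "(\<integral>\<^sup>+ s. kern (\<phi> i) t s \<partial>M) \<le> ennreal (C1 / h)" if i: "i \<in> I" and t: "t \<in> \<Gamma>" for i t
    unfolding C1_def
  proof (rule kernel_bound[OF dim A up h lip[OF i] _ t])
    fix p q assume "p \<in> \<Gamma>" "q \<in> \<Gamma>"
    then show "\<bar>\<phi> i q - \<phi> i p\<bar> \<le> 2 * B" using bd[OF i, of p] bd[OF i, of q] by linarith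
  qed
  have main: "\<zeta> v \<le> sqrt (C2 * N * (\<Sum>i\<in>I. (T i)\<^sup>2)) * H12_seminorm \<Gamma> v" if v: "v \<in> H12_space \<Gamma>" for v
  proof -
    note vm = H12_spaceD(1)[OF v]
    have loc_le: "local_sq (\<tau> i) v \<le> H12_seminorm_sq \<Gamma> v" for i
      unfolding local_sq_def H12_seminorm_sq_def
      by (intro nn_integral_mono) (auto simp: indicator_def intro!: nn_integral_mono)
    have loc_fin: "local_sq (\<tau> i) v < \<infinity>" for i
      using loc_le H12_spaceD(3)[OF v] by (rule order_le_less_trans)
    have est: "\<exists>c. H12_seminorm_sq \<Gamma> (\<lambda>x. \<phi> i x * (v x - c)) \<le> ennreal C2 * local_sq (\<tau> i) v" if i: "i \<in> I" for i
    proof -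
      have \<tau>M: "\<tau> i \<in> sets M" using sets_M \<tau> i by blast
      have m': "0 < a * h ^ (DIM('a) - 1)" using a h by simp
      have Dh: "0 \<le> D * h" using D h by simp
      obtain c where c: "(\<integral>\<^sup>+ t. ennreal ((v t - c)\<^sup>2) * indicator (\<tau> i) t \<partial>M)
          \<le> ennreal ((D * h) ^ DIM('a) / (a * h ^ (DIM('a) - 1))) * local_sq (\<tau> i) v"
        using local_poincare[OF vm \<tau>M m' low[OF i] Dh diam[OF i] loc_fin] by blast
      have "h ^ DIM('a) = h * h ^ (DIM('a) - 1)" using dim by (cases "DIM('a)") auto
      \<comment> \<open>The Poincare constant of a patch is proportional to h, which cancels the 1/h
        of the kernel.\<close>
      then have q: "(D * h) ^ DIM('a) / (a * h ^ (DIM('a) - 1)) = D ^ DIM('a) / a * h"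
        using h a by (simp add: power_mult_distrib)
      have "H12_seminorm_sq \<Gamma> (\<lambda>x. \<phi> i x * (v x - c)) \<le>
        ennreal (2 * B\<^sup>2) * local_sq (\<tau> i) v + 4 * ennreal (C1 / h) * (\<integral>\<^sup>+ t. ennreal ((v t - c)\<^sup>2) * indicator (\<tau> i) t \<partial>M)"
        by (rule product_estimate[OF vm H12_spaceD(1)[OF \<phi>[OF i]] \<tau>M bd[OF i] out[OF i] ker[OF i]])
      also have "\<dots> \<le> ennreal (2 * B\<^sup>2) * local_sq (\<tau> i) v + 4 * ennreal (C1 / h) * (ennreal (D ^ DIM('a) / a * h) * local_sq (\<tau> i) v)"
        using c unfolding q by (intro add_left_mono mult_left_mono) auto
      also have "\<dots> = (ennreal (2 * B\<^sup>2) + ennreal 4 * ennreal (C1 / h) * ennreal (D ^ DIM('a) / a * h)) * local_sq (\<tau> i) v"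
        by (simp add: distrib_right mult.assoc)
      also have "ennreal (2 * B\<^sup>2) + ennreal 4 * ennreal (C1 / h) * ennreal (D ^ DIM('a) / a * h) =
          ennreal (2 * B\<^sup>2 + 4 * (C1 / h) * (D ^ DIM('a) / a * h))"
      proof -
        have "ennreal (4 * (C1 / h) * (D ^ DIM('a) / a * h)) = ennreal (4 * (C1 / h)) * ennreal (D ^ DIM('a) / a * h)"
          using C1 h D a by (intro ennreal_mult) auto
        moreover have "ennreal (4 * (C1 / h)) = ennreal 4 * ennreal (C1 / h)"
          using C1 h by (intro ennreal_mult) auto
        moreover have "0 \<le> 4 * (C1 / h) * (D ^ DIM('a) / a * h)" using C1 h D a by simp
        ultimately show ?thesis by (subst ennreal_plus) simp_all
      qed
      also have "2 * B\<^sup>2 + 4 * (C1 / h) * (D ^ DIM('a) / a * h) = C2" using h by (simp add: C2_def)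
      finally show ?thesis by blast
    qed
    then obtain c where c: "\<And>i. i \<in> I \<Longrightarrow> H12_seminorm_sq \<Gamma> (\<lambda>x. \<phi> i x * (v x - c i)) \<le> ennreal C2 * local_sq (\<tau> i) v"
      by metis
    define u where "u i = (\<lambda>x. \<phi> i x * (v x - c i))" for i
    define q where "q i = enn2real (local_sq (\<tau> i) v)" for i
    have uH: "u i \<in> H12_space \<Gamma>" if i: "i \<in> I" for i
      unfolding u_def
    proof (rule H12_product[OF H12_spaceD(1)[OF \<phi>[OF i]] _ bd[OF i]])
      show "(\<lambda>x. v x - c i) \<in> H12_space \<Gamma>" using H12_lincomb[OF v H12_const[of 1], of 1 "- c i"] by simp
      show "H12_seminorm_sq \<Gamma> (\<lambda>x. \<phi> i x * (v x - c i)) < \<infinity>"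
        by (rule order_le_less_trans[OF c[OF i]]) (use loc_fin[of i] in \<open>simp add: ennreal_mult_less_top\<close>)
    qed
    have su: "H12_seminorm \<Gamma> (u i) \<le> sqrt (C2 * q i)" if i: "i \<in> I" for i
    proof -
      have "enn2real (H12_seminorm_sq \<Gamma> (u i)) \<le> enn2real (ennreal C2 * local_sq (\<tau> i) v)"
        using c[OF i] loc_fin[of i] by (intro enn2real_mono) (auto simp: u_def ennreal_mult_less_top)
      then show ?thesis using C2 by (simp add: H12_seminorm_def enn2real_mult q_def)
    qed
    \<comment> \<open>The partition of unity splits v into the products \<open>u i\<close> and
      multiples of \<open>\<phi> i\<close>; the latter are annihilated by \<zeta>, which is what
      makes the constants \<open>c i\<close> admissible.\<close>
    have "\<zeta> v = \<zeta> (\<lambda>x. \<Sum>i\<in>I. u i x + c i * \<phi> i x)"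
    proof (rule functional_cong[OF \<zeta> v])
      fix x assume x: "x \<in> \<Gamma>"
      have "(\<Sum>i\<in>I. u i x + c i * \<phi> i x) = (\<Sum>i\<in>I. \<phi> i x) * v x"
        unfolding sum_distrib_right by (intro sum.cong) (auto simp: u_def algebra_simps)
      then show "v x = (\<Sum>i\<in>I. u i x + c i * \<phi> i x)" using unity[OF x] by simp
    qed
    also have "\<dots> = (\<Sum>i\<in>I. \<zeta> (\<lambda>x. u i x + c i * \<phi> i x))"
      using H12_lincomb[OF uH \<phi>, of _ _ 1] by (intro functional_sum[OF \<zeta> I]) auto
    also have "\<dots> = (\<Sum>i\<in>I. \<zeta> (u i))"
      using Hm12D(1)[OF \<zeta> uH \<phi>, of _ _ 1] orth by (intro sum.cong) auto
    also have "\<dots> \<le> (\<Sum>i\<in>I. T i * sqrt (C2 * q i))"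
    proof (intro sum_mono)
      fix i assume i: "i \<in> I"
      have "\<zeta> (u i) \<le> T i * H12_seminorm \<Gamma> (u i)"
        unfolding T_def
        by (rule functional_patch_le[OF \<zeta> one m \<tau>(1,2)[OF i] uH[OF i] _ Tfin[OF i]]) (simp add: u_def out[OF i])
      also have "\<dots> \<le> T i * sqrt (C2 * q i)" using su[OF i] T0 by (rule mult_left_mono)
      finally show "\<zeta> (u i) \<le> T i * sqrt (C2 * q i)" .
    qed
    also have "\<dots> = (\<Sum>i\<in>I. \<bar>T i\<bar> * \<bar>sqrt (C2 * q i)\<bar>)"
      using T0 C2 by (intro sum.cong) (auto simp: q_def)
    also have "\<dots> \<le> L2_set T I * L2_set (\<lambda>i. sqrt (C2 * q i)) I" by (rule L2_set_mult_ineq)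
    also have "\<dots> = sqrt (\<Sum>i\<in>I. (T i)\<^sup>2) * sqrt (C2 * (\<Sum>i\<in>I. q i))"
      using C2 by (simp add: L2_set_def q_def sum_distrib_left)
    also have "\<dots> \<le> sqrt (\<Sum>i\<in>I. (T i)\<^sup>2) * sqrt (C2 * (N * (H12_seminorm \<Gamma> v)\<^sup>2))"
    proof (intro mult_left_mono real_sqrt_le_mono)
      have "ennreal (\<Sum>i\<in>I. q i) = (\<Sum>i\<in>I. ennreal (q i))" by (rule sum_ennreal[symmetric]) (simp add: q_def)
      also have "\<dots> = (\<Sum>i\<in>I. local_sq (\<tau> i) v)" using loc_fin by (simp add: q_def less_top)
      also have "\<dots> \<le> ennreal N * H12_seminorm_sq \<Gamma> v"
        using \<tau> sets_M by (intro sum_local_sq_le[OF vm I _ N]) auto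
      also have "\<dots> = ennreal (N * (H12_seminorm \<Gamma> v)\<^sup>2)"
        using H12_spaceD(3)[OF v] N0 by (simp add: H12_seminorm_def ennreal_mult' less_top)
      finally show "(\<Sum>i\<in>I. q i) \<le> N * (H12_seminorm \<Gamma> v)\<^sup>2" using N0 by (simp add: ennreal_le_iff)
    qed (use C2 in \<open>auto simp: sum_nonneg\<close>)
    also have "\<dots> = sqrt (C2 * N * (\<Sum>i\<in>I. (T i)\<^sup>2)) * H12_seminorm \<Gamma> v"
      by (simp add: real_sqrt_mult H12_seminorm_def)
    finally show ?thesis .
  qed
  define R where "R = sqrt (C2 * N * (\<Sum>i\<in>I. (T i)\<^sup>2))"
  have R0: "0 \<le> R" using C2 N0 by (simp add: R_def sum_nonneg)
  have "Hm12_norm \<Gamma> \<zeta> \<le> ennreal R"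
    unfolding Hm12_norm_def
  proof (intro SUP_least ennreal_leI)
    fix v assume v: "v \<in> {v \<in> H12_space \<Gamma>. \<not> (AE t in M. v t = 0)}"
    then have "\<zeta> v \<le> R * H12_seminorm \<Gamma> v" using main by (simp add: R_def)
    also have "\<dots> \<le> R * H12_norm \<Gamma> v" using v R0 by (intro mult_left_mono H12_seminorm_le_norm) auto
    finally show "\<zeta> v / H12_norm \<Gamma> v \<le> R" using v H12_norm_pos[of v] by (simp add: divide_le_eq)
  qed
  then have "(Hm12_norm \<Gamma> \<zeta>)\<^sup>2 \<le> (ennreal R)\<^sup>2" by (rule power_mono) simp
  also have "\<dots> = ennreal (C2 * N * (\<Sum>i\<in>I. (T i)\<^sup>2))"
    using R0 C2 N0 by (simp add: ennreal_power) (simp add: R_def sum_nonneg)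
  also have "\<dots> = ennreal (C2 * N) * (\<Sum>i\<in>I. (ennreal (T i))\<^sup>2)"
    using C2 N0 T0 by (simp add: ennreal_mult' sum_nonneg ennreal_power)
  also have "(\<Sum>i\<in>I. (ennreal (T i))\<^sup>2) = (\<Sum>i\<in>I. (patch_norm (\<tau> i) \<zeta>)\<^sup>2)"
    using T by (intro sum.cong) auto
  finally show ?thesis by (simp add: C2_def C1_def)
qed

end

section \<open>The two-sided estimate\<close>

text \<open>
  Should \<^const>\<open>hausdorff_outer\<close> fail to be a measure on the Borel sets, \<^const>\<open>measure_of\<close> would return
  the zero measure and all norms would vanish. This case distinction makes a proof of
  countable additivity superfluous.
\<close>

lemma AE_degenerate:
  fixes \<tau> :: "'a::euclidean_space set"
  assumes ms: "\<not> measure_space (UNIV :: 'a set) (sets borel) (hausdorff_outer (DIM('a) - 1))" and \<tau>: "closed \<tau>"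
  shows "AE x in surface_measure \<tau>. P x"
proof (rule AE_I[where N=\<tau>])
  show "emeasure (surface_measure \<tau>) \<tau> = 0"
    using \<tau> hausdorff_measure_degenerate[OF ms] by (simp add: surface_measure_def emeasure_restrict_space)
  show "\<tau> \<in> sets (surface_measure \<tau>)" using sets.top[of "surface_measure \<tau>"] by simp
qed auto

text \<open>Every function vanishes almost everywhere, so both suprema range over the empty
  set.\<close>

lemma norms_degenerate:
  fixes \<Gamma> \<tau> :: "'a::euclidean_space set"
  assumes ms: "\<not> measure_space (UNIV :: 'a set) (sets borel) (hausdorff_outer (DIM('a) - 1))"
  shows "closed \<Gamma> \<Longrightarrow> Hm12_norm \<Gamma> \<zeta> = 0" and "closed \<tau> \<Longrightarrow> tilde_Hm12_norm \<Gamma> \<tau> \<eta> = 0"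
  using AE_degenerate[OF ms] by (auto simp: Hm12_norm_def tilde_Hm12_norm_def bot_ennreal)

theorem theorem4p2:
  fixes \<Omega> \<Gamma> :: "'a::euclidean_space set" and \<kappa> \<sigma> C0 :: real
  assumes "DIM('a) = 2 \<or> DIM('a) = 3"
    and "open \<Omega>" "\<Omega> \<noteq> {}" "bounded \<Omega>" "simply_connected \<Omega>"
    and "\<Gamma> = frontier \<Omega>"
    and "lipschitz_boundary \<Omega>"
    and "curvilinear_polytope_boundary \<Gamma>"
    and "\<exists>K::real. \<forall>x\<in>\<Gamma>. \<forall>y\<in>\<Gamma>. geodesic_dist \<Gamma> x y \<le> ennreal (K * dist x y)"
    and "C0 > 0"
  shows "\<exists>c>0. \<exists>C>0. \<forall>(h::real) Th F \<phi>.
           h > 0 \<longrightarrow> surface_mesh \<Gamma> Th F \<longrightarrow> quasi_uniform \<kappa> h Th \<longrightarrow> shape_regular \<sigma> \<Gamma> Th \<longrightarrow>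
           admissible_partition C0 h \<Gamma> Th F \<phi> \<longrightarrow>
           (\<forall>\<zeta>\<in>Hm12_space \<Gamma>. (\<forall>y\<in>mesh_nodes Th F. \<zeta> (\<phi> y) = 0) \<longrightarrow>
              ennreal c * (\<Sum>y\<in>mesh_nodes Th F.
                  (tilde_Hm12_norm \<Gamma> (node_patch Th F y) (restrict_dual (node_patch Th F y) \<zeta>))\<^sup>2)
                \<le> (Hm12_norm \<Gamma> \<zeta>)\<^sup>2 \<and>
              (Hm12_norm \<Gamma> \<zeta>)\<^sup>2
                \<le> ennreal C * (\<Sum>y\<in>mesh_nodes Th F.
                  (tilde_Hm12_norm \<Gamma> (node_patch Th F y) (restrict_dual (node_patch Th F y) \<zeta>))\<^sup>2))"
proof -
  let ?n = "DIM('a)" and ?d = "DIM('a) - 1"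
  let ?H = "hausdorff_measure ?d :: 'a measure"
  have dim: "2 \<le> ?n" using assms(1) by auto
  have \<Gamma>c: "compact \<Gamma>" using assms(4,6) by (simp add: compact_frontier_bounded)
  then have \<Gamma>cl: "closed \<Gamma>" and \<Gamma>b: "bounded \<Gamma>" by (auto simp: compact_imp_closed compact_imp_bounded)
  have "\<Omega> \<noteq> UNIV" using assms(4) not_bounded_UNIV by blast
  then have \<Gamma>ne: "\<Gamma> \<noteq> {}" using frontier_not_empty[OF assms(3)] assms(6) by blast
  then obtain x0 where x0: "x0 \<in> \<Gamma>" by blast
  obtain \<rho> \<Lambda> where \<rho>: "0 < \<rho>" and \<Lambda>: "1 \<le> \<Lambda>"
    and ch: "\<And>x. x \<in> \<Gamma> \<Longrightarrow> \<exists>e \<Psi>. graph_chart \<Gamma> x \<rho> \<Lambda> e \<Psi>"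
    using lipschitz_boundary_charts[OF assms(2,7,4)] assms(6) by blast
  obtain K' where K': "\<And>x y. x \<in> \<Gamma> \<Longrightarrow> y \<in> \<Gamma> \<Longrightarrow> geodesic_dist \<Gamma> x y \<le> ennreal (K' * dist x y)"
    using assms(9) by blast
  \<comment> \<open>The hypothesis allows any real constant; a value of at least 1 keeps quotients
    by \<open>K\<close> and strict inequalities meaningful.\<close>
  define K where "K = max 1 K'"
  have K: "1 \<le> K" by (simp add: K_def)
  have geo: "geodesic_dist \<Gamma> x y \<le> ennreal (K * dist x y)" if "x \<in> \<Gamma>" "y \<in> \<Gamma>" for x y
    by (rule order_trans[OF K'[OF that] ennreal_leI]) (simp add: K_def mult_right_mono)
  \<comment> \<open>The same quantity as in \<open>regular_mesh\<close>, introduced here because the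
    constants have to be fixed before any mesh is given.\<close>
  define rad where "rad = 1 / (2 * \<sigma> * \<kappa> * K)"
  \<comment> \<open>Radius 1 is used for the total mass and for positivity of small balls; the other
    bound covers \<open>rad * h\<close> for every possible mesh size h \<le> \<kappa>
    \<open>diameter \<Gamma>\<close>.\<close>
  obtain b where b: "0 < b" and low: "\<And>x r. x \<in> \<Gamma> \<Longrightarrow> 0 < r \<Longrightarrow> r \<le> max 1 (rad * (\<kappa> * diameter \<Gamma>)) \<Longrightarrow>
      ennreal (b * r ^ ?d) \<le> hausdorff_outer ?d (\<Gamma> \<inter> ball x r)"
    using ahlfors_lower[OF dim \<rho> \<Lambda> ch] by blast
  have pos: "0 < hausdorff_outer ?d (\<Gamma> \<inter> ball x r)" if x: "x \<in> \<Gamma>" and r: "0 < r" for x r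
  proof -
    have "0 < ennreal (b * (min r 1) ^ ?d)" using b r by simp
    also have "\<dots> \<le> hausdorff_outer ?d (\<Gamma> \<inter> ball x (min r 1))" using r by (intro low x) auto
    also have "\<dots> \<le> hausdorff_outer ?d (\<Gamma> \<inter> ball x r)" by (intro hausdorff_outer_mono) auto
    finally show ?thesis .
  qed
  have mesh: "regular_mesh \<Gamma> \<kappa> \<sigma> K h Th F"
    if "h > 0" "surface_mesh \<Gamma> Th F" "quasi_uniform \<kappa> h Th" "shape_regular \<sigma> \<Gamma> Th" for h Th F
    by unfold_locales (use assms(1) \<Gamma>c \<Gamma>ne geo K pos that in auto)
  define S where "S = (\<lambda>Th F \<zeta>. \<Sum>y\<in>mesh_nodes Th F.
    (tilde_Hm12_norm \<Gamma> (node_patch Th F y) (restrict_dual (node_patch Th F y) \<zeta>))\<^sup>2)"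
  define Est where "Est = (\<lambda>c C. \<forall>(h::real) Th F \<phi>.
    h > 0 \<longrightarrow> surface_mesh \<Gamma> Th F \<longrightarrow> quasi_uniform \<kappa> h Th \<longrightarrow> shape_regular \<sigma> \<Gamma> Th \<longrightarrow>
    admissible_partition C0 h \<Gamma> Th F \<phi> \<longrightarrow>
    (\<forall>\<zeta>\<in>Hm12_space \<Gamma>. (\<forall>y\<in>mesh_nodes Th F. \<zeta> (\<phi> y) = 0) \<longrightarrow>
       ennreal c * S Th F \<zeta> \<le> (Hm12_norm \<Gamma> \<zeta>)\<^sup>2 \<and> (Hm12_norm \<Gamma> \<zeta>)\<^sup>2 \<le> ennreal C * S Th F \<zeta>))"
  have "\<exists>c>0. \<exists>C>0. Est c C"
  proof (cases "measure_space (UNIV :: 'a set) (sets borel) (hausdorff_outer ?d)")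
    case False
    have "Est 1 1"
      unfolding Est_def
    proof (intro allI impI ballI)
      fix h :: real and Th F \<phi> \<zeta>
      assume "h > 0" "surface_mesh \<Gamma> Th F" "quasi_uniform \<kappa> h Th" "shape_regular \<sigma> \<Gamma> Th"
      then interpret regular_mesh \<Gamma> \<kappa> \<sigma> K h Th F by (rule mesh)
      show "ennreal 1 * S Th F \<zeta> \<le> (Hm12_norm \<Gamma> \<zeta>)\<^sup>2 \<and> (Hm12_norm \<Gamma> \<zeta>)\<^sup>2 \<le> ennreal 1 * S Th F \<zeta>"
        by (simp add: S_def norms_degenerate[OF False] \<Gamma>cl patch_closed)
    qed
    then show ?thesis using zero_less_one by blast
  next
    case ms: True
    obtain A where A: "0 < A" and up: "\<And>x r. x \<in> \<Gamma> \<Longrightarrow> 0 < r \<Longrightarrow> emeasure ?H (\<Gamma> \<inter> ball x r) \<le> ennreal (A * r ^ ?d)"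
      using ahlfors_upper[OF ms \<Gamma>c \<rho> \<Lambda> ch] by blast
    have fin: "emeasure ?H \<Gamma> < \<infinity>"
    proof -
      obtain R where R: "0 < R" "\<Gamma> \<subseteq> ball x0 R" using bounded_subset_ballD[OF \<Gamma>b] by blast
      then have "emeasure ?H \<Gamma> \<le> ennreal (A * R ^ ?d)" using up[OF x0 R(1)] by (simp add: Int_absorb2)
      then show ?thesis by (simp add: order_le_less_trans)
    qed
    interpret finite_surface \<Gamma> by unfold_locales (use \<Gamma>cl \<Gamma>b fin in auto)
    have lowH: "ennreal (b * r ^ ?d) \<le> emeasure M (\<Gamma> \<inter> ball x r)"
      if "x \<in> \<Gamma>" "0 < r" "r \<le> max 1 (rad * (\<kappa> * diameter \<Gamma>))" for x r
      using low[OF that] emeasure_hausdorff_measure[OF ms, of "\<Gamma> \<inter> ball x r"] \<Gamma>cl by (simp add: emeasure_M)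
    have upM: "emeasure M (\<Gamma> \<inter> ball x r) \<le> ennreal (A * r ^ ?d)" if "x \<in> \<Gamma>" "0 < r" for x r
      using up[OF that] by (simp add: emeasure_M)
    have mass: "ennreal b \<le> emeasure M \<Gamma>"
    proof -
      have "ennreal b \<le> emeasure M (\<Gamma> \<inter> ball x0 1)" using lowH[OF x0, of 1] by simp
      also have "\<dots> \<le> emeasure M \<Gamma>" using sets_M[OF Gamma_sets order_refl] by (intro emeasure_mono) auto
      finally show ?thesis .
    qed
    define N where "N = real ?n * ((2 * (\<kappa> + \<kappa>) + rad) ^ ?n / rad ^ ?n)"
    define P where "P = 2 * K * \<Lambda> * C0"
    define c1 where "c1 = 2 * N * (1 + diameter \<Gamma> ^ ?n / b)"
    define c2 where "c2 = (2 * C0\<^sup>2 + 4 * (A * 2 ^ ?n * ((2 * C0)\<^sup>2 + 2 * P\<^sup>2)) * (2 * \<kappa>) ^ ?n / (b * rad ^ ?d)) * N"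
    have main: "S Th F \<zeta> \<le> ennreal c1 * (Hm12_norm \<Gamma> \<zeta>)\<^sup>2"
        "(Hm12_norm \<Gamma> \<zeta>)\<^sup>2 \<le> ennreal c2 * S Th F \<zeta>"
      if h: "h > 0" and "surface_mesh \<Gamma> Th F" "quasi_uniform \<kappa> h Th" "shape_regular \<sigma> \<Gamma> Th"
        and part: "admissible_partition C0 h \<Gamma> Th F \<phi>" and \<zeta>: "\<zeta> \<in> Hm12_space \<Gamma>"
        and orth: "\<forall>y\<in>mesh_nodes Th F. \<zeta> (\<phi> y) = 0" for h Th F \<phi> \<zeta>
    proof -
      interpret rm: regular_mesh \<Gamma> \<kappa> \<sigma> K h Th F by (rule mesh) fact+
      have rad: "rm.rad = rad" by (simp add: rm.rad_def rad_def)
      have rad0: "0 < rad" using rm.rad_pos by (simp add: rad)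
      have N: "real (card {y\<in>mesh_nodes Th F. z \<in> node_patch Th F y}) \<le> N" for z
        using rm.patch_overlap by (simp add: rm.overlap_def rad N_def)
      have N0: "0 \<le> N" using order_trans[OF of_nat_0_le_iff N] .
      have H12: "\<phi> y \<in> H12_space \<Gamma>" and W: "\<phi> y \<in> W1inf0_space \<Gamma> (node_patch Th F y)"
        and Linf: "Linf_norm_le (node_patch Th F y) (\<phi> y) C0"
        and grad: "W1inf_seminorm_le (node_patch Th F y) (\<phi> y) (C0 / h)" if "y \<in> mesh_nodes Th F" for y
        using part that by (auto simp: admissible_partition_def)
      have unity: "(\<Sum>y\<in>mesh_nodes Th F. \<phi> y x) = 1" if "x \<in> \<Gamma>" for x
        using part that by (simp add: admissible_partition_def)
      have lip: "\<bar>\<phi> y q - \<phi> y p\<bar> \<le> P / h * dist p q" if y: "y \<in> mesh_nodes Th F" and "p \<in> \<Gamma>" "q \<in> \<Gamma>" for y p q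
        using W1inf0_lipschitz[OF dim ms W[OF y] rm.patch_subset rm.patch_closed geo K \<rho> \<Lambda> ch grad[OF y] _ that(2,3)]
          assms(10) h by (simp add: P_def)
      have out: "\<phi> y x = 0" if "y \<in> mesh_nodes Th F" "x \<in> \<Gamma> - node_patch Th F y" for y x
        using W[OF that(1)] that(2) unfolding W1inf0_space_def by blast
      have bd: "\<bar>\<phi> y p\<bar> \<le> C0" if y: "y \<in> mesh_nodes Th F" and p: "p \<in> \<Gamma>" for y p
        using assms(10) by (intro Linf_bound_pointwise[OF ms pos rm.patch_closed out[OF y] Linf[OF y] _ lip[OF y] p]) auto
      have one: "\<zeta> (\<lambda>x. 1) = 0"
        using orth by (intro functional_one[OF \<zeta> rm.finite_nodes H12 unity]) auto
      have patch_low: "ennreal (b * rad ^ ?d * h ^ ?d) \<le> emeasure M (node_patch Th F y)" if y: "y \<in> mesh_nodes Th F" for y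
      proof -
        obtain x where x: "x \<in> \<Gamma>" "\<Gamma> \<inter> ball x (rad * h) \<subseteq> node_patch Th F y"
          using rm.patch_ball[OF y] rad by auto
        have "rad * h \<le> rad * (\<kappa> * diameter \<Gamma>)" using rad0 rm.mesh_size_le by simp
        then have "ennreal (b * (rad * h) ^ ?d) \<le> emeasure M (\<Gamma> \<inter> ball x (rad * h))"
          using rad0 h by (intro lowH x(1)) (auto intro: max.coboundedI2)
        also have "\<dots> \<le> emeasure M (node_patch Th F y)"
          using x(2) rm.patch_closed rm.patch_subset by (intro emeasure_mono sets_M) auto
        finally show ?thesis by (simp add: power_mult_distrib mult.assoc)
      qed
      note lower = lower_estimate[OF \<zeta> one b mass rm.finite_nodes N N0]
      show "S Th F \<zeta> \<le> ennreal c1 * (Hm12_norm \<Gamma> \<zeta>)\<^sup>2"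
        using lower(2) by (simp add: S_def c1_def)
      have tf: "tilde_Hm12_norm \<Gamma> (node_patch Th F y) (restrict_dual (node_patch Th F y) \<zeta>) < \<infinity>"
        if "y \<in> mesh_nodes Th F" for y using lower(1)[OF that] by simp
      show "(Hm12_norm \<Gamma> \<zeta>)\<^sup>2 \<le> ennreal c2 * S Th F \<zeta>"
        unfolding S_def c2_def
      \<comment> \<open>A patch has diameter at most 2 \<kappa> h, hence D = 2 \<kappa>, and
        contains a surface ball of radius \<open>rad * h\<close>, hence a = b rad^(n-1).\<close>
      proof (rule upper_estimate[OF dim less_imp_le[OF A] upM h, where m=b and \<phi>=\<phi> and P=P])
        show "0 < b * rad ^ ?d" using b rad0 by simp
        show "dist s t \<le> 2 * \<kappa> * h" if "s \<in> node_patch Th F y" "t \<in> node_patch Th F y" for s t y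
          using rm.patch_dist that .
        show "node_patch Th F y \<in> sets borel" for y using rm.patch_closed by simp
      qed (use assms(10) N N0 rm.kappa_pos rm.finite_nodes rm.patch_subset patch_low H12 bd out lip unity \<zeta> orth b mass tf in auto)
    qed
    \<comment> \<open>The signs of \<kappa> and \<sigma>, and so of \<open>c1\<close> and
      \<open>c2\<close>, are known only once a mesh exists. Absolute values plus 1 give positive
      constants in every case, while \<open>ennreal\<close> is monotone.\<close>
    have scale1: "ennreal (1 / (\<bar>c1\<bar> + 1)) * s \<le> t" if "s \<le> ennreal c1 * t" for s t
    proof -
      have "ennreal (1 / (\<bar>c1\<bar> + 1)) * s \<le> ennreal (1 / (\<bar>c1\<bar> + 1)) * (ennreal (\<bar>c1\<bar> + 1) * t)"
        by (intro mult_left_mono order_trans[OF that] mult_right_mono ennreal_leI) auto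
      also have "\<dots> = t" by (simp add: mult.assoc[symmetric] ennreal_mult'[symmetric] del: ennreal_plus)
      finally show ?thesis .
    qed
    have scale2: "t \<le> ennreal (\<bar>c2\<bar> + 1) * s" if "t \<le> ennreal c2 * s" for s t
      by (rule order_trans[OF that]) (intro mult_right_mono ennreal_leI, auto)
    have "Est (1 / (\<bar>c1\<bar> + 1)) (\<bar>c2\<bar> + 1)"
      unfolding Est_def by (intro allI impI ballI conjI; rule scale1[OF main(1)] scale2[OF main(2)])
    moreover have "0 < 1 / (\<bar>c1\<bar> + 1)" "0 < \<bar>c2\<bar> + 1" by (auto simp: add_nonneg_pos)
    ultimately show ?thesis by blast
  qed
  then show ?thesis unfolding Est_def S_def .
qed

end
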